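(* Let $t\in\mathbb Q$, $t\neq 0,\pm1,\pm2$, and let $X\in\mathcal R(t)$ with $\det X\neq 0$. Then the set of prime divisors $\Gamma_X$ is contained in the set of primes $p\in\Pi_t$ such that $\det X$ is a square $\bmod\ p$. If moreover $\det X$ is not the square of a rational number, then the upper prime density of $\Gamma_X$ does not exceed $1/2$.
   Context: For $t\in\mathbb Q$ let $D_t=\begin{pmatrix}0&-1\\1&t\end{pmatrix}$ and let $\mathcal R(t)$ be the commutative ring of all $2\times2$ rational matrices commuting with $D_t$. Its elements are exactly the matrices $\begin{pmatrix}x_1-tx_0&-x_0\\ x_0&x_1\end{pmatrix}$ with $x_0,x_1\in\mathbb Q$; such a matrix is denoted $[x_0\ x_1]$ and is identified with the two-sided sequence $\{x_n\}_{n\in\mathbb Z}$ determined by $x_{n+1}=tx_n-x_{n-1}$. Thus $\det[x_0\ x_1]=x_1^2-tx_0x_1+x_0^2$. Every $X\in\mathcal R(t)$ with $\det X\ne0$ is a nonzero rational multiple of a reduced representative, i.e. of some $[x_0\ x_1]$ with $x_0,x_1$ relatively prime integers; the reduced representative is unique up to sign, and passing to it changes $\det X$ only by a nonzero rational square factor. The condition "$\det X$ is a square $\bmod\ p$" is understood for the reduced representative. $\Pi_t$ is the set of odd primes not dividing the numerator or denominator of $t$ or of $t^2-4$ (written as reduced fractions). A rational number whose denominator is prime to $p$ is $0\bmod p$ if $p$ divides its numerator. The set of prime divisors is $\Gamma_X=\{p\in\Pi_t : \exists\, n\in\mathbb Z,\ x_n=0 \bmod p\}$, where $\{x_n\}$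 is the sequence of the reduced representative of $X$ (for $p\in\Pi_t$ all its terms have denominators prime to $p$). The upper prime density of a set $A$ of primes is $\limsup_{x\to\infty}\#\{p\in A: p\le x\}/\#\{p \text{ prime}: p\le x\}$. *)

theory Defs
  imports "HOL-Analysis.Analysis" "HOL-Computational_Algebra.Primes"
begin

definition D_mat :: "rat \<Rightarrow> rat^2^2" where
  "D_mat t = vector [vector [0, -1], vector [1, t]]"

definition R_ring :: "rat \<Rightarrow> (rat^2^2) set" where
  "R_ring t = {X. X ** D_mat t = D_mat t ** X}"

definition bracket :: "rat \<Rightarrow> rat \<Rightarrow> rat \<Rightarrow> rat^2^2" where
  "bracket t x0 x1 = vector [vector [x1 - t * x0, - x0], vector [x0, x1]]"

fun rec_seq :: "rat \<Rightarrow> rat \<Rightarrow> rat \<Rightarrow> nat \<Rightarrow> rat" where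
  "rec_seq t a b 0 = a"
| "rec_seq t a b (Suc 0) = b"
| "rec_seq t a b (Suc (Suc n)) = t * rec_seq t a b (Suc n) - rec_seq t a b n"

text \<open>The two-sided sequence of a matrix \<open>[x\<^sub>0 x\<^sub>1]\<close>, whose bottom row is \<open>x\<^sub>0, x\<^sub>1\<close>.
  The recurrence is invariant under the reflection \<open>n \<mapsto> 1 - n\<close>, which gives the
  terms of negative index.\<close>

definition seq_term :: "rat \<Rightarrow> rat^2^2 \<Rightarrow> int \<Rightarrow> rat" where
  "seq_term t X n =
     (if 0 \<le> n then rec_seq t (X $ 2 $ 1) (X $ 2 $ 2) (nat n)
      else rec_seq t (X $ 2 $ 2) (X $ 2 $ 1) (nat (1 - n)))"

definition is_reduced_rep :: "rat \<Rightarrow> rat^2^2 \<Rightarrow> rat^2^2 \<Rightarrow> bool" where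
  "is_reduced_rep t X Y \<longleftrightarrow>
     (\<exists>a b :: int. coprime a b \<and> Y = bracket t (of_int a) (of_int b)) \<and>
     (\<exists>c. c \<noteq> 0 \<and> X = map_matrix ((*) c) Y)"

text \<open>Well defined only up to sign; see \<open>is_reduced_rep_reduced_rep\<close> and
  \<open>is_reduced_rep_unique\<close> below.  Nothing that follows depends on the sign.\<close>

definition reduced_rep :: "rat \<Rightarrow> rat^2^2 \<Rightarrow> rat^2^2" where
  "reduced_rep t X = (SOME Y. is_reduced_rep t X Y)"

definition prime_in_rat :: "nat \<Rightarrow> rat \<Rightarrow> bool" where
  "prime_in_rat p r \<longleftrightarrow>
     int p dvd fst (quotient_of r) \<or> int p dvd snd (quotient_of r)"

definition Pi_primes :: "rat \<Rightarrow> nat set" where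
  "Pi_primes t =
     {p. prime p \<and> odd p \<and> \<not> prime_in_rat p t \<and> \<not> prime_in_rat p (t^2 - 4)}"

definition zero_mod :: "nat \<Rightarrow> rat \<Rightarrow> bool" where
  "zero_mod p r \<longleftrightarrow>
     coprime (int p) (snd (quotient_of r)) \<and> int p dvd fst (quotient_of r)"

text \<open>Integers represent all residue classes modulo \<open>p\<close> of rationals with denominator
  prime to \<open>p\<close>.  As usual, \<open>0\<close> counts as a square.\<close>

definition square_mod :: "nat \<Rightarrow> rat \<Rightarrow> bool" where
  "square_mod p r \<longleftrightarrow>
     coprime (int p) (snd (quotient_of r)) \<and> (\<exists>m :: int. zero_mod p (r - (of_int m)^2))"

definition Gamma_primes :: "rat \<Rightarrow> rat^2^2 \<Rightarrow> nat set" where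
  "Gamma_primes t X =
     {p \<in> Pi_primes t. \<exists>n :: int. zero_mod p (seq_term t (reduced_rep t X) n)}"

definition upper_prime_density :: "nat set \<Rightarrow> ereal" where
  "upper_prime_density A =
     Limsup at_top (\<lambda>x :: real. ereal
       (real (card {p. prime p \<and> p \<in> A \<and> real p \<le> x}) /
        real (card {p :: nat. prime p \<and> real p \<le> x})))"

lemma R_ring_iff: "X \<in> R_ring t \<longleftrightarrow> X = bracket t (X $ 2 $ 1) (X $ 2 $ 2)"
  by (auto simp: R_ring_def D_mat_def bracket_def vec_eq_iff forall_2 sum_2
      matrix_matrix_mult_def algebra_simps)

lemma det_bracket: "det (bracket t x0 x1) = x1^2 - t * x0 * x1 + x0^2"
  by (simp add: det_2 bracket_def power2_eq_square algebra_simps)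

lemma seq_term_bracket:
  "seq_term t (bracket t x0 x1) 0 = x0" "seq_term t (bracket t x0 x1) 1 = x1"
  by (simp_all add: seq_term_def bracket_def)

lemma seq_term_rec: "seq_term t X (n + 1) = t * seq_term t X n - seq_term t X (n - 1)"
proof -
  consider "n \<ge> 1" | "n = 0" | "n = -1" | "n < -1" by linarith
  then show ?thesis
  proof cases
    case 1
    define k where "k = nat (n - 1)"
    have "nat (n + 1) = Suc (Suc k)" "nat n = Suc k" "nat (n - 1) = k"
      using 1 by (auto simp: k_def)
    then show ?thesis using 1 by (simp add: seq_term_def)
  next
    case 4
    define k where "k = nat (- n)"
    have "nat (1 - (n + 1)) = k" "nat (1 - n) = Suc k" "nat (1 - (n - 1)) = Suc (Suc k)"
      using 4 by (auto simp: k_def)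
    then show ?thesis using 4 by (simp add: seq_term_def)
  qed (simp_all add: seq_term_def numeral_2_eq_2 numeral_3_eq_3)
qed

lemma is_reduced_rep_exists:
  assumes "X \<in> R_ring t" "det X \<noteq> 0"
  shows "\<exists>Y. is_reduced_rep t X Y"
proof -
  define x0 x1 where "x0 = X $ 2 $ 1" and "x1 = X $ 2 $ 2"
  have X: "X = bracket t x0 x1"
    using assms(1) unfolding R_ring_iff x0_def x1_def .
  have nz: "x0 \<noteq> 0 \<or> x1 \<noteq> 0"
    using assms(2) unfolding X det_bracket by auto
  obtain a d where a: "x0 = of_int a / of_int d" "d > 0"
    by (metis quotient_of_div quotient_of_denom_pos surj_pair)
  obtain b e where b: "x1 = of_int b / of_int e" "e > 0"
    by (metis quotient_of_div quotient_of_denom_pos surj_pair)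
  define g where "g = gcd (a * e) (b * d)"
  have g: "g \<noteq> 0" using nz a b by (auto simp: g_def)
  obtain a' b' where ab: "a * e = a' * g" "b * d = b' * g" "coprime a' b'"
    using gcd_coprime_exists[of "a * e" "b * d"] g unfolding g_def by auto
  define c :: rat where "c = of_int g / of_int (d * e)"
  have "x0 = of_int (a * e) / of_int (d * e)" using a b by simp
  then have x0: "x0 = c * of_int a'" by (simp add: ab c_def)
  have "x1 = of_int (b * d) / of_int (d * e)" using a b by simp
  then have x1: "x1 = c * of_int b'" by (simp add: ab c_def)
  have "X = map_matrix ((*) c) (bracket t (of_int a') (of_int b'))"
    by (simp add: X x0 x1 bracket_def vec_eq_iff forall_2 algebra_simps)
  moreover have "c \<noteq> 0" using g a b by (simp add: c_def)
  ultimately show ?thesis using ab(3) unfolding is_reduced_rep_def by blast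
qed

lemma is_reduced_rep_reduced_rep:
  assumes "X \<in> R_ring t" "det X \<noteq> 0"
  shows "is_reduced_rep t X (reduced_rep t X)"
  unfolding reduced_rep_def using is_reduced_rep_exists[OF assms] by (rule someI_ex)

lemma is_reduced_rep_unique:
  assumes "is_reduced_rep t X Y" "is_reduced_rep t X Z"
  shows "Z = Y \<or> Z = - Y"
proof -
  obtain a b :: int and c where Y: "coprime a b" "Y = bracket t (of_int a) (of_int b)"
    "c \<noteq> 0" "X = map_matrix ((*) c) Y"
    using assms(1) unfolding is_reduced_rep_def by blast
  obtain a' b' :: int and c' where Z: "coprime a' b'" "Z = bracket t (of_int a') (of_int b')"
    "c' \<noteq> 0" "X = map_matrix ((*) c') Z"
    using assms(2) unfolding is_reduced_rep_def by blast
  have eq: "c * of_int a = c' * of_int a'" "c * of_int b = c' * of_int b'"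
    using Y(4) unfolding Z(4) Y(2) Z(2) by (auto simp: bracket_def vec_eq_iff forall_2)
  have "(c * c') * of_int (a * b') = (c * c') * of_int (a' * b)"
    using eq by (simp add: mult_ac)
  then have cross: "a * b' = a' * b"
    using Y(3) Z(3) by (simp flip: of_int_mult)
  then have "\<bar>a\<bar> * \<bar>b'\<bar> = \<bar>a'\<bar> * \<bar>b\<bar>" by (simp flip: abs_mult)
  then have abs: "\<bar>a\<bar> = \<bar>a'\<bar>" "\<bar>b\<bar> = \<bar>b'\<bar>"
    using coprime_crossproduct_int[of a b a' b'] Y(1) Z(1) by (auto simp: mult.commute)
  then have "(a' = a \<and> b' = b) \<or> (a' = - a \<and> b' = - b)"
    using cross by (auto simp: abs_eq_iff)
  then show ?thesis
    unfolding Y(2) Z(2) by (auto simp: bracket_def vec_eq_iff forall_2)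
qed

end

theory Submission
  imports Defs "HOL-Complex_Analysis.Complex_Analysis" "HOL-Number_Theory.Number_Theory"
    "HOL-Computational_Algebra.Squarefree" "HOL-Real_Asymp.Real_Asymp"
begin

text \<open>
  Containment. Along the sequence of a matrix the quadratic form
  \<open>x\<^sub>n\<^sub>+\<^sub>1\<^sup>2 - t x\<^sub>n x\<^sub>n\<^sub>+\<^sub>1 + x\<^sub>n\<^sup>2\<close> is constant, equal to the determinant. If \<open>x\<^sub>n\<close> vanishes
  modulo \<open>p\<close>, the determinant is congruent to \<open>x\<^sub>n\<^sub>+\<^sub>1\<^sup>2\<close>; this is
  \<open>Gamma_primes_det_square\<close>.

  Density. Suppose that \<open>det X\<close> is not a rational square. Let the determinant of the reduced
  representative be \<open>n / m\<close> in lowest terms; then \<open>d = n m\<close> is not a square either. Up to finitely many primes \<open>Gamma_primes t X\<close> consists of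
  primes with Legendre symbol \<open>(d / p) = 1\<close>. Quadratic reciprocity makes \<open>p \<mapsto> (d / p)\<close> the
  restriction of a periodic, completely multiplicative function \<open>chi\<close> whose sum over a period is
  zero (\<open>quadratic_character_exists\<close>). Since
  \<open>2 #{p \<le> N. chi p = 1} \<le> \<pi>(N) + \<Sum>\<^sub>p\<^sub>\<le>\<^sub>N chi p\<close>, it remains to show that the sum on the right is
  \<open>o(\<pi>(N))\<close>. The density in question is the natural one, so this has the strength of the prime
  number theorem for \<open>chi\<close>: Dirichlet's estimates for \<open>\<Sum> chi p / p\<close> control only logarithmic
  averages.

  The proof of that theorem goes through the Moebius function \<open>\<mu>\<close>. The series
  \<open>L s = \<Sum> chi n n\<^sup>-\<^sup>s\<close> has coefficients with bounded partial sums and is therefore holomorphic for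
  \<open>Re s > 0\<close>. It has no zero with \<open>Re s = 1\<close>: away from \<open>1\<close> by the inequality
  \<open>3 + 4 cos \<theta> + cos 2\<theta> \<ge> 0\<close> (\<open>nonzero_on_line\<close>), and at \<open>1\<close> by Monsky's argument with the
  Lambert series \<open>\<Sum> chi n x\<^sup>n / (1 - x\<^sup>n)\<close> (\<open>L_one_nonzero\<close>). Hence
  \<open>1 / L s = \<Sum> \<mu> n chi n n\<^sup>-\<^sup>s\<close> continues holomorphically across the line \<open>Re s = 1\<close>. Its coefficients
  are bounded, so Newman's contour argument (\<open>Newman_Dirichlet_series\<close>) shows that
  \<open>\<Sum> \<mu> n chi n / n\<close> converges, and partial summation gives \<open>\<Sum>\<^sub>n\<^sub>\<le>\<^sub>N \<mu> n chi n = o(N)\<close>.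

  The hyperbola method for the convolution \<open>\<Lambda> chi = \<mu> chi * chi ln\<close> carries this over to
  \<open>\<Sum>\<^sub>n\<^sub>\<le>\<^sub>N \<Lambda> n chi n = o(N)\<close> (\<open>mangoldt_twist_sum_small\<close>). Chebyshev's bounds, which give
  \<open>\<pi>(N)\<close> the order of magnitude \<open>N / ln N\<close>, turn it into the statement about
  \<open>\<Sum>\<^sub>p\<^sub>\<le>\<^sub>N chi p\<close> (\<open>prime_sum_small\<close>).
\<close>

section \<open>Newman's Tauberian theorem for Dirichlet series\<close>

text \<open>
  Cauchy's formula at \<open>0\<close> for a closed contour cut at its two points on the imaginary axis. The
  two halves are separate because Newman's argument changes the left one while keeping the right
  one. On a convex set \<open>(F z - F 0) / z\<close> has a primitive, so it contributes zero to the sum, and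
  \<open>F 0 / z\<close> contributes \<open>i \<pi> F 0\<close> on each side, read off from the branches \<open>Ln z\<close> and \<open>Ln (- z)\<close>.
\<close>

lemma half_plane_Cauchy:
  fixes F :: "complex \<Rightarrow> complex"
  assumes hol: "F holomorphic_on S" and S: "open S" "convex S" "0 \<in> S" and r: "r > 0"
    and A: "valid_path A" "pathstart A = - \<i> * of_real r" "pathfinish A = \<i> * of_real r"
           "path_image A \<subseteq> S \<inter> {z. Re z \<ge> 0} - {0}"
    and B: "valid_path B" "pathstart B = \<i> * of_real r" "pathfinish B = - \<i> * of_real r"
           "path_image B \<subseteq> S \<inter> {z. Re z \<le> 0} - {0}"
  shows "\<exists>I J. ((\<lambda>z. F z / z) has_contour_integral I) A \<and>
               ((\<lambda>z. F z / z) has_contour_integral J) B \<and> I + J = 2 * of_real pi * \<i> * F 0"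
proof -
  define h where "h = (\<lambda>z. if z = 0 then deriv F 0 else (F z - F 0) / (z - 0))"
  have "h holomorphic_on S"
    unfolding h_def by (rule pole_lemma_open[OF hol S(1)])
  then obtain K where K: "\<And>z. z \<in> S \<Longrightarrow> (K has_field_derivative h z) (at z within S)"
    using holomorphic_convex_primitive'[of S h] S by blast
  have 1: "(h has_contour_integral (K (\<i> * of_real r) - K (- \<i> * of_real r))) A"
    using contour_integral_primitive[OF K A(1)] A by auto
  have 2: "(h has_contour_integral (K (- \<i> * of_real r) - K (\<i> * of_real r))) B"
    using contour_integral_primitive[OF K B(1)] B by auto
  have nA: "z \<notin> \<real>\<^sub>\<le>\<^sub>0" if "z \<in> path_image A" for z
    using A(4) that by (auto simp: complex_nonpos_Reals_iff complex_eq_iff)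
  have nB: "- z \<notin> \<real>\<^sub>\<le>\<^sub>0" if "z \<in> path_image B" for z
    using B(4) that by (auto simp: complex_nonpos_Reals_iff complex_eq_iff)
  have lnA: "((\<lambda>z. 1 / z) has_contour_integral (Ln (\<i> * of_real r) - Ln (- \<i> * of_real r))) A"
    using contour_integral_primitive[of "path_image A" Ln "\<lambda>z. 1 / z" A] A nA
    by (force intro!: derivative_eq_intros simp: field_simps)
  have lnB: "((\<lambda>z. 1 / z) has_contour_integral (Ln (\<i> * of_real r) - Ln (- \<i> * of_real r))) B"
  proof -
    have "((\<lambda>z. Ln (- z)) has_field_derivative 1 / z) (at z within path_image B)"
      if "z \<in> path_image B" for z
      using nB[OF that] B(4) that by (auto intro!: derivative_eq_intros simp: field_simps)
    from contour_integral_primitive[OF this B(1)] B show ?thesis by auto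
  qed
  have "Ln (\<i> * of_real r) = of_real (ln r) + \<i> * of_real (pi / 2)"
    using r by (subst mult.commute, subst Ln_times_of_real) (auto simp: Ln_of_real)
  moreover have "Ln (- \<i> * of_real r) = of_real (ln r) - \<i> * of_real (pi / 2)"
    using r by (subst mult.commute, subst Ln_times_of_real) (auto simp: Ln_of_real)
  ultimately have L: "Ln (\<i> * of_real r) - Ln (- \<i> * of_real r) = \<i> * of_real pi"
    by simp
  have "((\<lambda>z. h z + F 0 * (1 / z)) has_contour_integral
      ((K (\<i> * of_real r) - K (- \<i> * of_real r)) + F 0 * (\<i> * of_real pi))) A"
    using has_contour_integral_add[OF 1 has_contour_integral_lmul[OF lnA, of "F 0"]] L by simp
  then have IA: "((\<lambda>z. F z / z) has_contour_integral
      ((K (\<i> * of_real r) - K (- \<i> * of_real r)) + F 0 * (\<i> * of_real pi))) A"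
    by (rule has_contour_integral_eq) (use A(4) in \<open>auto simp: h_def field_simps\<close>)
  have "((\<lambda>z. h z + F 0 * (1 / z)) has_contour_integral
      ((K (- \<i> * of_real r) - K (\<i> * of_real r)) + F 0 * (\<i> * of_real pi))) B"
    using has_contour_integral_add[OF 2 has_contour_integral_lmul[OF lnB, of "F 0"]] L by simp
  then have IB: "((\<lambda>z. F z / z) has_contour_integral
      ((K (- \<i> * of_real r) - K (\<i> * of_real r)) + F 0 * (\<i> * of_real pi))) B"
    by (rule has_contour_integral_eq) (use B(4) in \<open>auto simp: h_def field_simps\<close>)
  show ?thesis
    using IA IB by (intro exI conjI) (auto simp: algebra_simps)
qed

lemma powr_MVT:
  fixes x u :: real
  assumes "u > 0"
  obtains z where "u < z" "z < u + 1" "(u + 1) powr x - u powr x = x * z powr (x - 1)"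
proof -
  have "\<exists>z. z > u \<and> z < u + 1 \<and> (u+1) powr x - u powr x = (u + 1 - u) * (x * z powr (x - 1))"
    using assms by (intro MVT2) (auto intro!: derivative_eq_intros)
  then show ?thesis using that by auto
qed

lemma neg_powr_telescope:
  fixes x u :: real
  assumes "x > 0" "u > 0"
  shows "(u + 1) powr (-1-x) \<le> (u powr (-x) - (u+1) powr (-x)) / x"
proof -
  obtain z where z: "z > u" "z < u + 1" "(u+1) powr (-x) - u powr (-x) = - x * z powr (-x-1)"
    using powr_MVT[OF assms(2), of "-x"] by metis
  have "(u+1) powr (-x-1) \<le> z powr (-x-1)"
    using z assms by (intro powr_mono2') auto
  moreover have "-1 - x = -x - 1" by simp
  ultimately have le: "(u+1) powr (-1-x) \<le> z powr (-x-1)" by (simp only:)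
  have "u powr (-x) - (u+1) powr (-x) = x * z powr (-x-1)" using z(3) by linarith
  then show ?thesis using le assms(1) by simp
qed

lemma tail_sum_powr_le:
  fixes x :: real
  assumes "x > 0" "N > 0"
  shows "summable (\<lambda>n. real (n + Suc N) powr (-1-x))"
    and "(\<Sum>n. real (n + Suc N) powr (-1-x)) \<le> real N powr (-x) / x"
proof -
  let ?g = "\<lambda>n. real (n + N) powr (-x) / x"
  have "filterlim (\<lambda>n. real (n + N)) at_top sequentially"
    by (intro filterlim_compose[OF filterlim_real_sequentially] filterlim_add_const_nat_at_top)
  then have "(\<lambda>n. real (n + N) powr (-x)) \<longlonglongrightarrow> 0"
    using assms by (intro tendsto_neg_powr) auto
  then have "?g \<longlonglongrightarrow> 0 / x" by (intro tendsto_divide) (use assms in auto)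
  then have s: "(\<lambda>n. ?g n - ?g (Suc n)) sums (?g 0 - 0 / x)"
    by (rule telescope_sums')
  have le: "real (n + Suc N) powr (-1-x) \<le> ?g n - ?g (Suc n)" for n
    using neg_powr_telescope[of x "real (n + N)"] assms by (simp add: diff_divide_distrib add_ac)
  show sm: "summable (\<lambda>n. real (n + Suc N) powr (-1-x))"
    by (rule summable_comparison_test'[of "\<lambda>n. ?g n - ?g (Suc n)" 0])
       (use s le in \<open>auto simp: sums_iff\<close>)
  have "(\<Sum>n. real (n + Suc N) powr (-1-x)) \<le> (\<Sum>n. ?g n - ?g (Suc n))"
    by (rule suminf_le) (use sm s le in \<open>auto simp: sums_iff\<close>)
  also have "\<dots> = real N powr (-x) / x" using s by (simp add: sums_iff)
  finally show "(\<Sum>n. real (n + Suc N) powr (-1-x)) \<le> real N powr (-x) / x" .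
qed

text \<open>
  Comparison of the sum with the integral of \<open>u\<^sup>x\<^sup>-\<^sup>1\<close>. For \<open>x \<le> 1\<close> the summands decrease and the integral
  over \<open>[0, N]\<close> bounds them; for \<open>x > 1\<close> they increase, and the last one is split off, which is
  where \<open>1 / N\<close> comes from.
\<close>

lemma sum_powr_le:
  fixes x :: real
  assumes "x > 0" "N > 0"
  shows "(\<Sum>n=1..N. real n powr (x - 1)) \<le> real N powr x * (1 / x + 1 / real N)"
proof (cases "x \<le> 1")
  case True
  have "(\<Sum>n=1..N. real n powr (x - 1)) \<le> real N powr x / x" for N
  proof (induction N)
    case (Suc N)
    have "real (Suc N) powr (x - 1) \<le> (real (Suc N) powr x - real N powr x) / x"
    proof (cases "N = 0")
      case True
      then show ?thesis using \<open>x \<le> 1\<close> assms by simp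
    next
      case False
      obtain z where z: "z > real N" "z < real N + 1"
         "(real N + 1) powr x - real N powr x = x * z powr (x - 1)"
        using powr_MVT[of "real N" x] False by auto
      have "real (Suc N) powr (x - 1) \<le> z powr (x - 1)"
        using z True \<open>x \<le> 1\<close> False by (intro powr_mono2') auto
      then show ?thesis using z(3) assms by (simp add: field_simps)
    qed
    then show ?case using Suc by (simp add: diff_divide_distrib)
  qed (use assms in auto)
  from this[of N] have "(\<Sum>n=1..N. real n powr (x - 1)) \<le> real N powr x * (1 / x)" by simp
  also have "\<dots> \<le> real N powr x * (1 / x + 1 / real N)"
    by (intro mult_left_mono) auto
  finally show ?thesis .
next
  case False
  have *: "(\<Sum>n=1..<Suc N. real n powr (x - 1)) \<le> real (Suc N) powr x / x" for N
  proof (induction N)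
    case (Suc N)
    obtain z where z: "z > real (Suc N)" "z < real (Suc N) + 1"
       "(real (Suc N) + 1) powr x - real (Suc N) powr x = x * z powr (x - 1)"
      using powr_MVT[of "real (Suc N)" x] by auto
    have "real (Suc N) powr (x - 1) \<le> z powr (x - 1)"
      using z False by (intro powr_mono2) auto
    then have "real (Suc N) powr (x - 1) \<le> (real (Suc (Suc N)) powr x - real (Suc N) powr x) / x"
      using z(3) assms by (simp add: field_simps)
    then show ?case using Suc by (simp add: diff_divide_distrib)
  qed (use assms in auto)
  obtain M where M: "N = Suc M" using assms by (cases N) auto
  have "(\<Sum>n=1..N. real n powr (x - 1)) = (\<Sum>n=1..<Suc M. real n powr (x - 1)) + real N powr (x - 1)"
    unfolding M atLeastLessThanSuc_atLeastAtMost[symmetric] by simp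
  also have "\<dots> \<le> real N powr x / x + real N powr x / real N"
    using *[of M] M by (simp add: powr_diff)
  finally show ?thesis by (simp add: algebra_simps)
qed

text \<open>
  On the circle \<open>1 / z\<close> equals \<open>cnj z / r\<^sup>2\<close>, so Newman's kernel collapses to \<open>2 Re z / r\<^sup>2\<close>. This
  zero on the imaginary axis cancels the factor \<open>1 / Re z\<close> in the bounds for partial sums and tails.
\<close>

lemma Newman_kernel_norm:
  fixes z :: complex
  assumes "norm z = r" "r > 0"
  shows "norm ((1 + z\<^sup>2 / of_real (r\<^sup>2)) / z) = 2 * \<bar>Re z\<bar> / r\<^sup>2"
proof -
  have z: "z \<noteq> 0" using assms by auto
  have "of_real (r\<^sup>2) = z * cnj z"
    using assms complex_norm_square[of z] by simp
  then have "(1 + z\<^sup>2 / of_real (r\<^sup>2)) / z = (cnj z + z) / of_real (r\<^sup>2)"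
    using z assms(2) by (simp add: field_simps power2_eq_square)
  also have "cnj z + z = of_real (2 * Re z)"
    by (simp add: complex_add_cnj add.commute)
  finally show ?thesis
    by (simp add: norm_divide norm_power abs_mult)
qed

lemma path_image_right_half_circle:
  assumes "r > 0" "z \<in> path_image (part_circlepath 0 r (- pi / 2) (pi / 2))"
  shows "norm z = r" "Re z \<ge> 0"
proof -
  obtain t where t: "t \<in> {-pi/2..pi/2}" "z = of_real r * cis t"
    using assms(2) by (auto simp: path_image_part_circlepath' closed_segment_eq_real_ivl)
  show "norm z = r" "Re z \<ge> 0"
    using t assms(1) cos_ge_zero[of t] by (auto simp: norm_mult)
qed

lemma path_image_left_half_circle:
  assumes "r > 0" "z \<in> path_image (part_circlepath 0 r (pi / 2) (3 * pi / 2))"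
  shows "norm z = r" "Re z \<le> 0"
proof -
  obtain t where t: "t \<in> {pi/2..3*pi/2}" "z = of_real r * cis t"
    using assms(2) by (auto simp: path_image_part_circlepath' closed_segment_eq_real_ivl)
  have "cos t \<le> 0" using t(1) cos_ge_zero[of "t - pi"] by (auto simp: cos_diff)
  then show "norm z = r" "Re z \<le> 0"
    using t assms(1) by (auto simp: norm_mult mult_nonneg_nonpos)
qed

text \<open>
  Newman's Tauberian theorem, with the boundary point moved to \<open>0\<close>. The difference of the limit
  function \<open>g\<close> and a partial sum \<open>S N\<close> at \<open>0\<close> is written with Cauchy's formula on a circle of
  radius \<open>R\<close>, after multiplication by \<open>N\<^sup>z (1 + z\<^sup>2 / R\<^sup>2)\<close>. On the right half of the circle
  \<open>g - S N\<close> is a tail of the series, of size \<open>N\<^sup>-\<^sup>x / x\<close> with \<open>x = Re z\<close>, and the kernel makes the integrand \<open>O(1 / R\<^sup>2)\<close>.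
  On the left half \<open>S N\<close> and \<open>g\<close> are treated apart: \<open>S N\<close> is entire and satisfies a similar bound on
  the left half circle, whereas for \<open>g\<close> the left part of the contour is a rectangle of width
  \<open>\<epsilon>\<close>, inside the region of holomorphy, where \<open>N\<^sup>z\<close> tends to \<open>0\<close> off the imaginary axis. The
  resulting error is \<open>O(1 / R) + O(\<epsilon>)\<close> for large \<open>N\<close>, with \<open>R\<close> chosen before \<open>\<epsilon>\<close>.
\<close>

theorem Newman_Dirichlet_series:
  fixes b :: "nat \<Rightarrow> complex"
  assumes b: "\<And>n. norm (b n) \<le> 1"
    and U: "open U" "{z. Re z \<ge> 0} \<subseteq> U" and g: "g holomorphic_on U"
    and ser: "\<And>z. Re z > 0 \<Longrightarrow> (\<lambda>n. b n * of_nat n powr (-1-z)) sums g z"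
  shows "(\<lambda>n. b n / of_nat n) sums g 0"
proof -
  define S where "S = (\<lambda>N z. \<Sum>n\<le>N. b n * of_nat n powr (-1-z))"
  have S0: "S N 0 = (\<Sum>n\<le>N. b n / of_nat n)" for N
    unfolding S_def by (intro sum.cong) (auto simp: powr_minus_divide powr_to_1)
  have holS: "S N holomorphic_on X" for N X
    unfolding S_def by (intro holomorphic_intros)
  have nrm: "norm (of_nat n powr w :: complex) = real n powr Re w" for n w
    by (simp add: norm_powr_real_powr)
  have rem: "norm (g z - S N z) \<le> real N powr (- Re z) / Re z" if z: "Re z > 0" and N: "N > 0" for z N
  proof -
    let ?t = "\<lambda>n. b n * of_nat n powr (-1-z)"
    have "(\<lambda>n. ?t (n + Suc N)) sums (g z - (\<Sum>n<Suc N. ?t n))"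
      using sums_split_initial_segment[OF ser[OF z], of "Suc N"] by simp
    then have *: "(\<lambda>n. ?t (n + Suc N)) sums (g z - S N z)"
      by (simp add: S_def lessThan_Suc_atMost)
    have le: "norm (?t (n + Suc N)) \<le> real (n + Suc N) powr (-1 - Re z)" for n
      using mult_right_mono[OF b[of "n + Suc N"], of "real (n + Suc N) powr (-1 - Re z)"]
      by (simp only: norm_mult nrm) simp
    have "norm (g z - S N z) \<le> (\<Sum>n. real (n + Suc N) powr (-1 - Re z))"
      using norm_suminf_le[OF le tail_sum_powr_le(1)[OF z N]] * by (simp add: sums_iff)
    also have "\<dots> \<le> real N powr (- Re z) / Re z"
      by (rule tail_sum_powr_le(2)[OF z N])
    finally show ?thesis .
  qed
  have Sle: "norm (S N z) \<le> real N powr (- Re z) * (1 / (- Re z) + 1 / real N)"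
    if z: "Re z < 0" and N: "N > 0" for z N
  proof -
    have "norm (S N z) \<le> (\<Sum>n\<le>N. real n powr (- Re z - 1))"
      unfolding S_def
    proof (rule sum_norm_le)
      fix n
      show "norm (b n * of_nat n powr (-1-z)) \<le> real n powr (- Re z - 1)"
      proof -
        have "- Re z - 1 = - 1 - Re z" by simp
        then show ?thesis
          using mult_right_mono[OF b[of n], of "real n powr (-1 - Re z)"]
          by (simp only: norm_mult nrm) simp
      qed
    qed
    also have "\<dots> = (\<Sum>n=1..N. real n powr (- Re z - 1))"
      by (intro sum.mono_neutral_right) (auto simp: not_le)
    also have "\<dots> \<le> real N powr (- Re z) * (1 / (- Re z) + 1 / real N)"
      using sum_powr_le[of "- Re z" N] z N by simp
    finally show ?thesis .
  qed
  have "\<forall>\<^sub>F N in sequentially. dist (S N 0) (g 0) < e" if e: "e > 0" for e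
  proof -
    \<comment> \<open>The circular arcs contribute \<open>2 / R + 1 / N\<close>, and \<open>2 / R\<close> is a quarter of \<open>e\<close>.\<close>
    define R where "R = 8 / e"
    have R: "R > 0" using e by (simp add: R_def)
    \<comment> \<open>Compactness gives room of uniform width \<open>\<delta>\<close> to the left of the imaginary axis; \<open>\<Omega>\<close> is convex.\<close>
    have "compact ({z. Re z \<ge> 0} \<inter> cball (0::complex) (R + 1))"
      by (intro closed_Int_compact closed_halfspace_Re_ge compact_cball)
    then obtain \<delta> where \<delta>: "\<delta> > 0" "(\<Union>z\<in>{z. Re z \<ge> 0} \<inter> cball 0 (R + 1). ball z \<delta>) \<subseteq> U"
      using compact_subset_open_imp_ball_epsilon_subset[of "{z. Re z \<ge> 0} \<inter> cball 0 (R + 1)" U] U by blast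
    define \<Omega> where "\<Omega> = {z. Re z > -\<delta>} \<inter> ball (0::complex) (R + 1)"
    have \<Omega>: "open \<Omega>" "convex \<Omega>" "0 \<in> \<Omega>"
      using \<delta> R by (auto simp: \<Omega>_def open_halfspace_Re_gt convex_halfspace_Re_gt intro!: convex_Int)
    have "\<Omega> \<subseteq> U"
    proof
      fix z assume z: "z \<in> \<Omega>"
      define w where "w = Complex (max 0 (Re z)) (Im z)"
      have "norm w \<le> norm z" by (auto simp: w_def cmod_def max_def)
      moreover have "dist w z < \<delta>"
        using z \<delta> by (auto simp: \<Omega>_def w_def dist_complex_def cmod_def max_def)
      ultimately show "z \<in> U"
        using z \<delta>(2) by (force simp: \<Omega>_def w_def)
    qed
    then have hol: "g holomorphic_on \<Omega>" using g holomorphic_on_subset by blast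
    have "compact (g ` ({z. Re z \<ge> -\<delta>/2} \<inter> cball (0::complex) (R + 1/2)))"
    proof (rule compact_continuous_image)
      have "{z. Re z \<ge> -\<delta>/2} \<inter> cball (0::complex) (R + 1/2) \<subseteq> \<Omega>"
        using \<delta> by (auto simp: \<Omega>_def)
      then show "continuous_on ({z. Re z \<ge> -\<delta>/2} \<inter> cball (0::complex) (R + 1/2)) g"
        using hol holomorphic_on_imp_continuous_on continuous_on_subset by blast
    qed (intro closed_Int_compact closed_halfspace_Re_ge compact_cball)
    then obtain C where "C > 0" and C: "\<And>z. Re z \<ge> -\<delta>/2 \<Longrightarrow> norm z \<le> R + 1/2 \<Longrightarrow> norm (g z) \<le> C"
      by (force dest!: compact_imp_bounded simp: bounded_pos)
    \<comment> \<open>\<open>D\<close> bounds the integrand on the two horizontal sides, where \<open>norm z \<ge> R\<close>.\<close>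
    define D where "D = C * (1 / R + (R + 1) / R\<^sup>2)"
    have D: "D > 0" using \<open>C > 0\<close> R by (simp add: D_def add_pos_pos)
    define \<epsilon> where "\<epsilon> = min (min (\<delta> / 2) (1 / 2)) (e / (4 * D))"
    have \<epsilon>: "\<epsilon> > 0" "\<epsilon> \<le> \<delta> / 2" "\<epsilon> \<le> 1 / 2" "D * \<epsilon> \<le> e / 4"
    proof -
      have "\<epsilon> \<le> e / (4 * D)" by (simp add: \<epsilon>_def)
      then show "D * \<epsilon> \<le> e / 4" using D by (simp add: field_simps)
    qed (use \<delta> e D in \<open>auto simp: \<epsilon>_def\<close>)
    \<comment> \<open>\<open>E N\<^sup>-\<^sup>\<epsilon>\<close> bounds the integrand on the vertical side, where only \<open>norm z \<ge> \<epsilon>\<close> is available.\<close>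
    define E where "E = C * (1 / \<epsilon> + (R + 1) / R\<^sup>2)"
    have E: "E > 0" using \<open>C > 0\<close> R \<epsilon> by (simp add: E_def add_pos_pos)
    have bound: "norm (S N 0 - g 0) \<le> 2 / R + 1 / real N + D * \<epsilon> / pi + E * real N powr (-\<epsilon>) * R / pi"
      if N: "N > 0" for N
    proof -
      define A where "A = part_circlepath 0 R (- pi / 2) (pi / 2)"
      define C' where "C' = part_circlepath 0 R (pi / 2) (3 * pi / 2)"
      define p q where "p = Complex (-\<epsilon>) R" and "q = Complex (-\<epsilon>) (-R)"
      define B where "B = linepath (\<i> * of_real R) p +++ linepath p q +++ linepath q (- \<i> * of_real R)"
      define k where "k = (\<lambda>z::complex. of_nat N powr z * (1 + z\<^sup>2 / of_real (R\<^sup>2)))"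
      have holk: "k holomorphic_on X" for X
        unfolding k_def using R N by (intro holomorphic_intros) auto
      have circ_ends: "exp (\<i> * of_real s) = cis s" for s
        by (simp add: cis_conv_exp)
      have A: "valid_path A" "pathstart A = - \<i> * of_real R" "pathfinish A = \<i> * of_real R"
        using circ_ends[of "- pi / 2"] circ_ends[of "pi / 2"] by (auto simp: A_def complex_eq_iff)
      have imA: "path_image A \<subseteq> \<Omega> \<inter> {z. Re z \<ge> 0} - {0}"
        using path_image_right_half_circle[OF R] R \<delta> unfolding A_def \<Omega>_def by fastforce
      have C'1: "valid_path C'" "pathstart C' = \<i> * of_real R" "pathfinish C' = - \<i> * of_real R"
        using circ_ends[of "pi / 2"] circ_ends[of "3 * pi / 2"] cos_3over2_pi sin_3over2_pi
        by (auto simp: C'_def complex_eq_iff)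
      have imC': "path_image C' \<subseteq> UNIV \<inter> {z. Re z \<le> 0} - {0}"
        using path_image_left_half_circle[OF R] R unfolding C'_def by fastforce
      have B: "valid_path B" "pathstart B = \<i> * of_real R" "pathfinish B = - \<i> * of_real R"
        by (auto simp: B_def)
      have seg1: "Im z = R \<and> Re z \<in> {-\<epsilon>..0}" if zs: "z \<in> closed_segment (\<i> * of_real R) (p)" for z
      proof -
        obtain u where u: "0 \<le> u" "u \<le> 1" "z = (1 - u) *\<^sub>R (\<i> * of_real R) + u *\<^sub>R (p)"
          using zs unfolding in_segment by blast
        have "u * \<epsilon> \<le> \<epsilon>" "0 \<le> u * \<epsilon>" using u \<epsilon> by (auto simp: mult_le_cancel_right1)
        then show ?thesis unfolding u(3) by (simp add: p_def algebra_simps)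
      qed
      have seg2: "Re z = -\<epsilon> \<and> Im z \<in> {-R..R}" if zs: "z \<in> closed_segment p q" for z
      proof -
        obtain u where u: "0 \<le> u" "u \<le> 1" "z = (1 - u) *\<^sub>R p + u *\<^sub>R q"
          using zs unfolding in_segment by blast
        have "u * R \<le> R" "0 \<le> u * R" using u R by (auto simp: mult_le_cancel_right1)
        then show ?thesis using R unfolding u(3) by (auto simp: p_def q_def algebra_simps)
      qed
      have seg3: "Im z = -R \<and> Re z \<in> {-\<epsilon>..0}" if zs: "z \<in> closed_segment (q) (- \<i> * of_real R)" for z
      proof -
        obtain u where u: "0 \<le> u" "u \<le> 1" "z = (1 - u) *\<^sub>R (q) + u *\<^sub>R (- \<i> * of_real R)"
          using zs unfolding in_segment by blast
        have "u * \<epsilon> \<le> \<epsilon>" "0 \<le> u * \<epsilon>" using u \<epsilon> by (auto simp: mult_le_cancel_right1)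
        then show ?thesis unfolding u(3) by (simp add: q_def algebra_simps)
      qed
      have nz: "norm z \<le> R + 1/2" if "Re z \<in> {-\<epsilon>..0}" "Im z \<in> {-R..R}" for z
        using cmod_le[of z] that \<epsilon> by auto
      have imB: "path_image B \<subseteq> closed_segment (\<i> * of_real R) p \<union> closed_segment p q \<union> closed_segment q (- \<i> * of_real R)"
        unfolding B_def by (auto simp: path_image_join)
      have imB': "path_image B \<subseteq> \<Omega> \<inter> {z. Re z \<le> 0} - {0}"
      proof
        fix z assume "z \<in> path_image B"
        then consider "z \<in> closed_segment (\<i> * of_real R) p" | "z \<in> closed_segment p q" |
            "z \<in> closed_segment q (- \<i> * of_real R)"
          using imB by blast
        then have "Re z \<in> {-\<epsilon>..0} \<and> Im z \<in> {-R..R} \<and> z \<noteq> 0"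
        proof cases
          case 1 then show ?thesis using seg1[OF 1] R by auto
        next
          case 2 then show ?thesis using seg2[OF 2] \<epsilon>(1) by auto
        next
          case 3 then show ?thesis using seg3[OF 3] R by auto
        qed
        then have z: "Re z \<in> {-\<epsilon>..0}" "Im z \<in> {-R..R}" "z \<noteq> 0" by auto
        then show "z \<in> \<Omega> \<inter> {z. Re z \<le> 0} - {0}"
          using nz[OF z(1,2)] \<epsilon> \<delta>(1) by (auto simp: \<Omega>_def)
      qed
      obtain I J where I: "((\<lambda>z. g z * k z / z) has_contour_integral I) A"
        and J: "((\<lambda>z. g z * k z / z) has_contour_integral J) B"
        and IJ: "I + J = 2 * of_real pi * \<i> * (g 0 * k 0)"
        using half_plane_Cauchy[OF holomorphic_on_mult[OF hol holk] \<Omega> R A imA B imB'] by blast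
      obtain I' J' where I': "((\<lambda>z. S N z * k z / z) has_contour_integral I') A"
        and J': "((\<lambda>z. S N z * k z / z) has_contour_integral J') C'"
        and IJ': "I' + J' = 2 * of_real pi * \<i> * (S N 0 * k 0)"
        using half_plane_Cauchy[OF holomorphic_on_mult[OF holS holk] open_UNIV convex_UNIV UNIV_I R A
            _ C'1 imC'] imA by blast
      have k0: "k 0 = 1" using N by (simp add: k_def)
      have normk: "norm (k z / z) = real N powr Re z * (2 * \<bar>Re z\<bar> / R\<^sup>2)" if "norm z = R" for z
        using Newman_kernel_norm[OF that R]
        by (simp only: k_def times_divide_eq_right[symmetric] norm_mult nrm)
      have bA: "norm (I - I') \<le> 2 / R\<^sup>2 * R * (pi / 2 - (- pi / 2))"
      proof (rule has_contour_integral_bound_part_circlepath[where f = "\<lambda>z. g z * k z / z - S N z * k z / z"])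
        show "((\<lambda>z. g z * k z / z - S N z * k z / z) has_contour_integral I - I')
              (part_circlepath 0 R (- pi / 2) (pi / 2))"
          using has_contour_integral_diff[OF I I'] by (simp add: A_def)
        fix z assume "z \<in> path_image (part_circlepath 0 R (- pi / 2) (pi / 2))"
        then have z: "norm z = R" "Re z \<ge> 0" using path_image_right_half_circle[OF R] by auto
        have "norm (g z * k z / z - S N z * k z / z) = norm (g z - S N z) * norm (k z / z)"
          unfolding norm_mult[symmetric] by (simp add: algebra_simps diff_divide_distrib)
        also have "\<dots> \<le> 2 / R\<^sup>2"
        proof (cases "Re z = 0")
          case True
          then have "norm (k z / z) = 0" unfolding normk[OF z(1)] by simp
          then show ?thesis by (simp only:) simp
        next
          case False
          then have "Re z > 0" using z by simp
          then have "norm (g z - S N z) * norm (k z / z) \<le>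
             (real N powr (- Re z) / Re z) * (real N powr Re z * (2 * \<bar>Re z\<bar> / R\<^sup>2))"
            unfolding normk[OF z(1)] by (intro mult_right_mono rem N) auto
          also have "\<dots> = 2 / R\<^sup>2"
            using \<open>Re z > 0\<close> N by (simp add: powr_minus field_simps)
          finally show ?thesis .
        qed
        finally show "norm (g z * k z / z - S N z * k z / z) \<le> 2 / R\<^sup>2" .
      qed (use R in auto)
      have bC: "norm J' \<le> (2 / R\<^sup>2 + 2 / (real N * R)) * R * (3 * pi / 2 - pi / 2)"
      proof (rule has_contour_integral_bound_part_circlepath[where f = "\<lambda>z. S N z * k z / z"])
        show "((\<lambda>z. S N z * k z / z) has_contour_integral J') (part_circlepath 0 R (pi / 2) (3 * pi / 2))"
          using J' by (simp add: C'_def)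
        fix z assume "z \<in> path_image (part_circlepath 0 R (pi / 2) (3 * pi / 2))"
        then have z: "norm z = R" "Re z \<le> 0" using path_image_left_half_circle[OF R] by auto
        have "norm (S N z * k z / z) = norm (S N z) * norm (k z / z)"
          unfolding norm_mult[symmetric] by simp
        also have "\<dots> \<le> 2 / R\<^sup>2 + 2 / (real N * R)"
        proof (cases "Re z = 0")
          case True
          then have "norm (k z / z) = 0" unfolding normk[OF z(1)] by simp
          then show ?thesis using R by (simp only:) simp
        next
          case False
          then have x: "Re z < 0" using z by simp
          have nn: "0 \<le> real N powr Re z * (2 * \<bar>Re z\<bar> / R\<^sup>2)" by simp
          have "norm (S N z) * norm (k z / z) \<le>
             (real N powr (- Re z) * (1 / (- Re z) + 1 / real N)) * (real N powr Re z * (2 * \<bar>Re z\<bar> / R\<^sup>2))"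
            unfolding normk[OF z(1)] by (intro mult_right_mono Sle N nn x)
          also have "\<dots> = 2 / R\<^sup>2 + 2 * \<bar>Re z\<bar> / (real N * R\<^sup>2)"
            using x N R by (simp add: powr_minus field_simps)
          also have "2 * \<bar>Re z\<bar> / (real N * R\<^sup>2) \<le> 2 * R / (real N * R\<^sup>2)"
            using abs_Re_le_cmod[of z] z N R by (intro divide_right_mono) auto
          also have "2 * R / (real N * R\<^sup>2) = 2 / (real N * R)"
            using R by (simp add: power2_eq_square)
          finally show ?thesis by simp
        qed
        finally show "norm (S N z * k z / z) \<le> 2 / R\<^sup>2 + 2 / (real N * R)" .
      qed (use R in auto)
      have kle: "norm (k z / z) \<le> real N powr Re z * (1 / m + (R + 1) / R\<^sup>2)"
        if "m > 0" "norm z \<ge> m" "norm z \<le> R + 1/2" for z m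
      proof -
        have "z \<noteq> 0" using that by auto
        then have eq: "k z / z = of_nat N powr z * (1 / z + z / of_real (R\<^sup>2))"
          by (simp add: k_def field_simps power2_eq_square)
        have "norm (1 / z + z / of_real (R\<^sup>2)) \<le> 1 / norm z + norm z / R\<^sup>2"
          by (rule order_trans[OF norm_triangle_ineq]) (simp add: norm_divide norm_power)
        also have "\<dots> \<le> 1 / m + (R + 1) / R\<^sup>2"
          using that by (intro add_mono divide_left_mono divide_right_mono) (auto intro!: mult_pos_pos)
        finally show ?thesis
          unfolding eq norm_mult nrm by (intro mult_left_mono) auto
      qed
      let ?f = "\<lambda>z. g z * k z / z"
      have "?f contour_integrable_on B" using J by (auto simp: contour_integrable_on_def)
      then have int: "?f contour_integrable_on (linepath (\<i> * of_real R) p)"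
        "?f contour_integrable_on (linepath p q)"
        "?f contour_integrable_on (linepath q (- \<i> * of_real R))"
        by (simp_all add: B_def)
      then obtain J1 J2 J3 where J1: "(?f has_contour_integral J1) (linepath (\<i> * of_real R) p)"
        and J2: "(?f has_contour_integral J2) (linepath p q)"
        and J3: "(?f has_contour_integral J3) (linepath q (- \<i> * of_real R))"
        unfolding contour_integrable_on_def by blast
      have "(?f has_contour_integral (J1 + (J2 + J3))) B"
        unfolding B_def by (intro has_contour_integral_join J1 J2 J3) auto
      then have Jeq: "J = J1 + (J2 + J3)" using J contour_integral_unique by metis
      have fle: "norm (?f z) \<le> C * (real N powr Re z * (1 / m + (R + 1) / R\<^sup>2))"
        if "Re z \<in> {-\<epsilon>..0}" "Im z \<in> {-R..R}" "m > 0" "norm z \<ge> m" for z m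
      proof -
        have "norm (?f z) = norm (g z) * norm (k z / z)" unfolding norm_mult[symmetric] by simp
        also have "\<dots> \<le> C * (real N powr Re z * (1 / m + (R + 1) / R\<^sup>2))"
          using that nz[of z] \<epsilon> R \<open>C > 0\<close> by (intro mult_mono C kle) auto
        finally show ?thesis .
      qed
      have fle1: "norm (?f z) \<le> D" if z: "Re z \<in> {-\<epsilon>..0}" "\<bar>Im z\<bar> = R" for z
      proof -
        have "norm (?f z) \<le> C * (real N powr Re z * (1 / R + (R + 1) / R\<^sup>2))"
          using z R abs_Im_le_cmod[of z] by (intro fle) auto
        also have "real N powr Re z \<le> 1"
          using z N powr_mono[of "Re z" 0 "real N"] by simp
        finally show ?thesis using \<open>C > 0\<close> R
          by (simp add: D_def mult_left_mono mult_right_mono)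
      qed
      have b1: "norm J1 \<le> D * norm (p - \<i> * of_real R)"
        by (rule has_contour_integral_bound_linepath[OF J1]) (use D fle1 seg1 R in auto)
      have b3: "norm J3 \<le> D * norm (- \<i> * of_real R - q)"
        by (rule has_contour_integral_bound_linepath[OF J3]) (use D fle1 seg3 R in auto)
      have b2: "norm J2 \<le> E * real N powr (-\<epsilon>) * norm (q - p)"
      proof (rule has_contour_integral_bound_linepath[OF J2])
        fix z assume z: "z \<in> closed_segment p q"
        have "norm (?f z) \<le> C * (real N powr Re z * (1 / \<epsilon> + (R + 1) / R\<^sup>2))"
          using seg2[OF z] \<epsilon> abs_Re_le_cmod[of z] by (intro fle) auto
        then show "norm (?f z) \<le> E * real N powr (-\<epsilon>)"
          using seg2[OF z] by (simp add: E_def mult_ac)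
      qed (use E in auto)
      have "p - \<i> * of_real R = of_real (-\<epsilon>)" "- \<i> * of_real R - q = of_real \<epsilon>"
        "q - p = of_real (-2 * R) * \<i>"
        by (auto simp: p_def q_def complex_eq_iff)
      then have b': "norm J1 \<le> D * \<epsilon>" "norm J3 \<le> D * \<epsilon>" "norm J2 \<le> E * real N powr (-\<epsilon>) * (2 * R)"
        using b1 b2 b3 \<epsilon> R by (simp_all only: norm_mult norm_of_real) auto
      have "2 * pi * norm (S N 0 - g 0) = norm (2 * of_real pi * \<i> * (g 0 - S N 0))"
        by (simp add: norm_mult norm_minus_commute)
      also have "2 * of_real pi * \<i> * (g 0 - S N 0) = (I - I') + (J1 + (J2 + J3)) - J'"
        using IJ IJ' k0 Jeq by (simp add: algebra_simps)
      also have "norm \<dots> \<le> norm (I - I') + (norm J1 + (norm J2 + norm J3)) + norm J'"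
        by (intro norm_triangle_le_diff norm_triangle_mono add_mono norm_triangle_ineq order.refl) 
      also have "\<dots> \<le> 2 * pi / R + (D * \<epsilon> + (E * real N powr (-\<epsilon>) * (2 * R) + D * \<epsilon>)) + (2 * pi / R + 2 * pi / real N)"
      proof (intro add_mono b')
        show "norm (I - I') \<le> 2 * pi / R" using bA R by (simp add: power2_eq_square)
        show "norm J' \<le> 2 * pi / R + 2 * pi / real N"
        proof -
          have "(2 / R\<^sup>2 + 2 / (real N * R)) * R * (3 * pi / 2 - pi / 2) = 2 * pi / R + 2 * pi / real N"
            using R N by (simp add: power2_eq_square field_simps)
          then show ?thesis using bC by (simp only:)
        qed
      qed
      also have "\<dots> = 2 * pi * (2 / R + 1 / real N + D * \<epsilon> / pi + E * real N powr (-\<epsilon>) * R / pi)"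
        by (simp add: field_simps)
      finally show ?thesis by simp
    qed
    have "(\<lambda>N. real N powr (-\<epsilon>)) \<longlonglongrightarrow> 0"
      using \<epsilon> by (intro tendsto_neg_powr filterlim_real_sequentially) auto
    then have "(\<lambda>N. E * real N powr (-\<epsilon>) * R / pi) \<longlonglongrightarrow> E * 0 * R / pi"
      by (intro tendsto_intros) auto
    then have ev1: "\<forall>\<^sub>F N in sequentially. E * real N powr (-\<epsilon>) * R / pi < e / 4"
      by (rule order_tendstoD) (use e in auto)
    have ev2: "\<forall>\<^sub>F N in sequentially. 1 / real N < e / 4"
      by (rule order_tendstoD(2)[OF lim_1_over_n]) (use e in auto)
    show ?thesis
      using ev1 ev2 eventually_gt_at_top[of "0::nat"]
    proof eventually_elim
      case (elim N)
      have "D * \<epsilon> / pi \<le> e / 4 / 1"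
        using \<epsilon> pi_ge_two e D by (intro frac_le) auto
      moreover have "2 / R = e / 4" by (simp add: R_def)
      ultimately show ?case using bound[of N] elim unfolding dist_norm by linarith
    qed
  qed
  then have "(\<lambda>N. S N 0) \<longlonglongrightarrow> g 0" by (simp add: tendsto_iff)
  then show ?thesis by (simp add: sums_def_le S0)
qed

section \<open>Dirichlet series: products, continuation, logarithmic derivatives\<close>

lemma has_sum_nat_iff_zero:
  assumes "f 0 = (0::'a::{comm_monoid_add,topological_space})"
  shows "(f has_sum S) {1..} \<longleftrightarrow> (f has_sum S) (UNIV :: nat set)"
proof (rule has_sum_cong_neutral)
  fix n :: nat assume "n \<in> UNIV - {1..}"
  then have "n = 0" by auto
  then show "f n = 0" using assms by simp
qed auto

text \<open>
  A double series over pairs \<open>(d, k)\<close> of positive integers may be grouped by the product \<open>n = d k\<close>.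
\<close>

lemma has_sum_divisors:
  fixes h :: "nat \<times> nat \<Rightarrow> 'a::{topological_comm_monoid_add,t3_space}"
  assumes "(h has_sum S) ({1..} \<times> {1..})"
  shows "((\<lambda>n. \<Sum>d | d dvd n. h (d, n div d)) has_sum S) {1..}"
proof -
  let ?N = "{1..} :: nat set"
  have bij: "bij_betw (\<lambda>(n, d). (d, n div d)) (Sigma ?N (\<lambda>n. {d. d dvd n})) (?N \<times> ?N)"
  proof (rule bij_betwI[where g = "\<lambda>(d, k). (d * k, d)"])
    show "(\<lambda>(n, d). (d, n div d)) \<in> Sigma ?N (\<lambda>n. {d. d dvd n}) \<rightarrow> ?N \<times> ?N"
      by (auto simp: Suc_le_eq div_greater_zero_iff dvd_imp_le intro: dvd_pos_nat)
  qed (auto simp: Suc_le_eq)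
  have "((\<lambda>x. h ((\<lambda>(n, d). (d, n div d)) x)) has_sum S) (Sigma ?N (\<lambda>n. {d. d dvd n}))"
    using assms unfolding has_sum_reindex_bij_betw[OF bij] .
  then show ?thesis
    by (rule has_sum_SigmaD) (auto intro!: has_sum_finiteI)
qed

lemma sums_divisor_convolution:
  fixes f g :: "nat \<Rightarrow> complex"
  assumes f: "summable (\<lambda>n. norm (f n))" "f sums F" "f 0 = 0"
    and g: "summable (\<lambda>n. norm (g n))" "g sums G" "g 0 = 0"
  shows "(\<lambda>n. \<Sum>d | d dvd n. f d * g (n div d)) sums (F * G)"
proof -
  let ?N = "{1..} :: nat set"
  let ?p = "\<lambda>(d, k). f d * g k"
  have f': "(f has_sum F) ?N" and g': "(g has_sum G) ?N"
    using norm_summable_imp_has_sum f g has_sum_nat_iff_zero by blast+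
  have fn: "(\<lambda>n. norm (f n)) summable_on ?N" and gn: "(\<lambda>n. norm (g n)) summable_on ?N"
    using f g has_sum_nat_iff_zero[of "\<lambda>n. norm (f n)"] has_sum_nat_iff_zero[of "\<lambda>n. norm (g n)"]
      norm_summable_imp_summable_on[of "\<lambda>n. norm (f n)"] norm_summable_imp_summable_on[of "\<lambda>n. norm (g n)"]
    by (auto simp: summable_on_def)
  have abs: "(\<lambda>x. norm (?p x)) summable_on (?N \<times> ?N)"
  proof (rule Infinite_Sum.abs_summable_on_Sigma_iff[THEN iffD2], intro conjI ballI)
    fix d
    show "(\<lambda>k. norm (?p (d, k))) summable_on ?N"
      using summable_on_cmult_right[OF gn, of "norm (f d)"] by (simp add: norm_mult)
    show "(\<lambda>d. norm (\<Sum>\<^sub>\<infinity>k\<in>?N. norm (?p (d, k)))) summable_on ?N"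
      using summable_on_cmult_left[OF fn, of "\<Sum>\<^sub>\<infinity>k\<in>?N. norm (g k)"]
      by (simp add: norm_mult infsum_cmult_right' abs_mult infsum_nonneg)
  qed
  obtain S where S: "(?p has_sum S) (?N \<times> ?N)"
    using abs_summable_summable[OF abs] summable_on_def by blast
  have "((\<lambda>d. f d * G) has_sum S) ?N"
    by (rule has_sum_SigmaD[OF S]) (simp only: prod.case has_sum_cmult_right[OF g'])
  moreover have "((\<lambda>d. f d * G) has_sum (F * G)) ?N"
    by (intro has_sum_cmult_left f')
  ultimately have "S = F * G" using has_sum_unique by blast
  have "((\<lambda>n. \<Sum>d | d dvd n. f d * g (n div d)) has_sum (F * G)) ?N"
    using has_sum_divisors[OF S] \<open>S = F * G\<close> by simp
  then have "((\<lambda>n. \<Sum>d | d dvd n. f d * g (n div d)) has_sum (F * G)) UNIV"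
    by (subst (asm) has_sum_nat_iff_zero) auto
  then show ?thesis by (rule has_sum_imp_sums)
qed

lemma norm_of_nat_powr: "norm (of_nat n powr s :: complex) = real n powr Re s"
  by (simp add: norm_powr_real_powr)

lemma of_nat_mult_powr: "(of_nat (m * n) powr s :: complex) = of_nat m powr s * of_nat n powr s"
  using powr_times_real[of "of_nat m" "of_nat n" s] by simp

lemma Dirichlet_series_mult:
  fixes a b :: "nat \<Rightarrow> real" and s :: complex
  assumes "summable (\<lambda>n. \<bar>a n\<bar> * real n powr (- Re s))" "(\<lambda>n. a n * of_nat n powr (-s)) sums A"
    and "summable (\<lambda>n. \<bar>b n\<bar> * real n powr (- Re s))" "(\<lambda>n. b n * of_nat n powr (-s)) sums B"
  shows "(\<lambda>n. (\<Sum>d | d dvd n. a d * b (n div d)) * of_nat n powr (-s)) sums (A * B)"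
proof -
  have "(\<lambda>n. \<Sum>d | d dvd n. (a d * of_nat d powr (-s)) * (b (n div d) * of_nat (n div d) powr (-s))) sums (A * B)"
    by (rule sums_divisor_convolution) (use assms in \<open>auto simp: norm_mult norm_of_nat_powr\<close>)
  also have "(\<lambda>n. \<Sum>d | d dvd n. (a d * of_nat d powr (-s)) * (b (n div d) * of_nat (n div d) powr (-s))) =
     (\<lambda>n. (\<Sum>d | d dvd n. a d * b (n div d)) * of_nat n powr (-s))"
  proof
    fix n
    show "(\<Sum>d | d dvd n. (a d * of_nat d powr (-s)) * (b (n div d) * of_nat (n div d) powr (-s))) =
      of_real (\<Sum>d | d dvd n. a d * b (n div d)) * of_nat n powr (-s)"
      unfolding of_real_sum sum_distrib_right
    proof (rule sum.cong)
      fix d assume "d \<in> {d. d dvd n}"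
      then have "n = d * (n div d)" by simp
      then have "(of_nat n powr (-s) :: complex) = of_nat d powr (-s) * of_nat (n div d) powr (-s)"
        by (metis of_nat_mult_powr)
      then show "(a d * of_nat d powr (-s)) * (b (n div d) * of_nat (n div d) powr (-s)) =
         of_real (a d * b (n div d)) * of_nat n powr (-s)"
        by simp
    qed auto
  qed
  finally show ?thesis .
qed

lemma norm_powr_diff_le:
  fixes s :: complex
  assumes n: "n > 0" and s: "Re s > -1"
  shows "norm (of_nat (Suc n) powr (-s) - of_nat n powr (-s)) \<le> norm s * real n powr (-1 - Re s)"
proof -
  have "norm (of_nat (Suc n) powr (-s) - (of_nat n :: complex) powr (-s)) \<le>
     norm s * real n powr (-1 - Re s) * norm (of_nat (Suc n) - of_nat n :: complex)"
  proof (rule field_differentiable_bound)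
    fix z :: complex assume "z \<in> closed_segment (of_nat n) (of_nat (Suc n))"
    then have "z \<in> of_real ` {real n..real n + 1}"
      using closed_segment_of_real[of "real n" "real n + 1", where ?'a = complex]
      by (simp add: closed_segment_eq_real_ivl add.commute)
    then obtain x where x: "z = of_real x" "real n \<le> x" by auto
    have x0: "x > 0" using x n by linarith
    then have "z \<notin> \<real>\<^sub>\<le>\<^sub>0" by (simp add: x)
    then show "((\<lambda>z. z powr (-s)) has_field_derivative (- s * z powr (-s-1))) (at z within closed_segment (of_nat n) (of_nat (Suc n)))"
      by (auto intro!: derivative_eq_intros)
    have "norm (- s * z powr (-s-1)) = norm s * x powr (-Re s - 1)"
      using x0 by (simp add: x norm_mult norm_powr_real_powr)
    also have "x powr (-Re s - 1) \<le> real n powr (-Re s - 1)"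
      using x n s by (intro powr_mono2') auto
    also have "-Re s - 1 = -1 - Re s" by simp
    finally show "norm (- s * z powr (-s-1)) \<le> norm s * real n powr (-1 - Re s)"
      by (simp add: mult_left_mono)
  qed auto
  then show ?thesis by simp
qed

text \<open>
  The term by which \<open>(s - 1) n\<^sup>-\<^sup>s\<close> differs from the telescoping difference
  \<open>n\<^sup>1\<^sup>-\<^sup>s - (n + 1)\<^sup>1\<^sup>-\<^sup>s\<close>. The mean value inequality is applied twice, since a first order bound would
  be as large as the terms of the zeta series themselves.
\<close>

lemma norm_powr_second_diff_le:
  fixes s :: complex
  assumes n: "n > 0" and s: "Re s > -1"
  shows "norm (of_nat (Suc n) powr (1-s) - of_nat n powr (1-s) - (1 - s) * of_nat n powr (-s))
           \<le> norm (1 - s) * norm s * real n powr (-1 - Re s)"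
proof -
  let ?f = "\<lambda>z. z powr (1-s) - (1 - s) * of_nat n powr (-s) * z :: complex"
  let ?S = "closed_segment (of_nat n) (of_nat (Suc n)) :: complex set"
  have seg: "\<exists>x. z = of_real x \<and> real n \<le> x \<and> x \<le> real n + 1" if "z \<in> ?S" for z
  proof -
    have "z \<in> of_real ` {real n..real n + 1}"
      using closed_segment_of_real[of "real n" "real n + 1", where ?'a = complex] that
      by (simp add: closed_segment_eq_real_ivl add.commute)
    then show ?thesis by auto
  qed
  have "norm (?f (of_nat (Suc n)) - ?f (of_nat n)) \<le>
     norm (1 - s) * (norm s * real n powr (-1 - Re s)) * norm (of_nat (Suc n) - of_nat n :: complex)"
  proof (rule field_differentiable_bound[where S = ?S])
    fix z assume z: "z \<in> ?S"
    then obtain x where x: "z = of_real x" "real n \<le> x" "x \<le> real n + 1" using seg by blast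
    have x0: "x > 0" using x n by linarith
    then have nz: "z \<notin> \<real>\<^sub>\<le>\<^sub>0" by (simp add: x)
    have "((\<lambda>z. z powr (1-s)) has_field_derivative (1 - s) * z powr (1 - s - 1)) (at z within ?S)"
      using nz by (auto intro!: derivative_eq_intros)
    from DERIV_diff[OF this DERIV_cmult_Id[of "(1 - s) * of_nat n powr (-s)"]]
    show "(?f has_field_derivative (1 - s) * (z powr (-s) - of_nat n powr (-s))) (at z within ?S)"
      by (simp add: right_diff_distrib)
    have "norm (z powr (-s) - of_nat n powr (-s)) \<le> norm s * real n powr (-1 - Re s) * norm (z - of_nat n)"
    proof (rule field_differentiable_bound[where S = ?S])
      fix w assume "w \<in> ?S"
      then obtain y where y: "w = of_real y" "real n \<le> y" using seg by blast
      have y0: "y > 0" using y n by linarith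
      then have "w \<notin> \<real>\<^sub>\<le>\<^sub>0" by (simp add: y)
      then show "((\<lambda>z. z powr (-s)) has_field_derivative (- s * w powr (-s-1))) (at w within ?S)"
        by (auto intro!: derivative_eq_intros)
      have "norm (- s * w powr (-s-1)) = norm s * y powr (-Re s - 1)"
        using y0 by (simp add: y norm_mult norm_powr_real_powr)
      also have "y powr (-Re s - 1) \<le> real n powr (-Re s - 1)"
        using y n s by (intro powr_mono2') auto
      also have "-Re s - 1 = -1 - Re s" by simp
      finally show "norm (- s * w powr (-s-1)) \<le> norm s * real n powr (-1 - Re s)"
        by (simp add: mult_left_mono)
    qed (use z in auto)
    also have "norm (z - of_nat n) \<le> 1"
    proof -
      have "z - of_nat n = of_real (x - real n)" using x by simp
      then have "norm (z - of_nat n) = \<bar>x - real n\<bar>" by (metis norm_of_real)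
      then show ?thesis using x by simp
    qed
    finally show "norm ((1 - s) * (z powr (-s) - of_nat n powr (-s))) \<le> norm (1 - s) * (norm s * real n powr (-1 - Re s))"
      by (simp add: norm_mult mult_left_mono)
  qed auto
  then show ?thesis by (simp add: algebra_simps)
qed

text \<open>
  The Weierstrass M-test in the form that both continuations below use: on a ball around \<open>s\<close> of
  radius \<open>Re s / 2\<close> the exponent stays below \<open>-1 - Re s / 2\<close>.
\<close>

lemma holomorphic_series_half_plane:
  fixes t :: "nat \<Rightarrow> complex \<Rightarrow> complex" and P :: "complex \<Rightarrow> real"
  assumes hol: "\<And>n. t n holomorphic_on {s. Re s > 0}"
    and P: "continuous_on UNIV P"
    and le: "\<And>n s. n > 0 \<Longrightarrow> Re s > 0 \<Longrightarrow> norm (t n s) \<le> P s * real n powr (-1 - Re s)"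
  obtains L where "L holomorphic_on {s. Re s > 0}" "\<And>s. Re s > 0 \<Longrightarrow> (\<lambda>n. t n s) sums L s"
proof -
  have op: "open {s::complex. Re s > 0}" by (simp add: open_halfspace_Re_gt)
  obtain L where L: "\<forall>s\<in>{s. Re s > 0}. ((\<lambda>n. t n s) sums L s) \<and> L field_differentiable (at s)"
  proof (rule series_differentiable_comparison_complex[OF op])
    show "t n field_differentiable at s" if "s \<in> {s. Re s > 0}" for n s
      using hol op that holomorphic_on_imp_differentiable_at by blast
    fix s :: complex assume s: "s \<in> {s. Re s > 0}"
    define \<sigma> where "\<sigma> = Re s / 2"
    have \<sigma>: "\<sigma> > 0" using s by (simp add: \<sigma>_def)
    have "compact (P ` cball s \<sigma>)"
      using P by (intro compact_continuous_image continuous_on_subset[OF P]) auto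
    then obtain B where B: "\<And>w. w \<in> cball s \<sigma> \<Longrightarrow> \<bar>P w\<bar> \<le> B" "B > 0"
      by (force dest!: compact_imp_bounded simp: bounded_pos)
    define h where "h = (\<lambda>n. of_real (B * real n powr (-1 - \<sigma>)) :: complex)"
    have "summable (\<lambda>n. B * real n powr (-1 - \<sigma>))"
      using \<sigma> by (intro summable_mult) (simp add: summable_real_powr_iff)
    then have "summable h" unfolding h_def by (rule summable_of_real)
    moreover have "range h \<subseteq> \<real>\<^sub>\<ge>\<^sub>0"
      using B by (auto simp: h_def intro!: mult_nonneg_nonneg)
    moreover have "\<forall>\<^sub>F n in sequentially. \<forall>w\<in>ball s \<sigma> \<inter> {s. Re s > 0}. norm (t n w) \<le> norm (h n)"
      using eventually_gt_at_top[of 0]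
    proof eventually_elim
      case (elim n)
      show ?case
      proof
        fix w assume w: "w \<in> ball s \<sigma> \<inter> {s. Re s > 0}"
        have "\<bar>Re (s - w)\<bar> \<le> norm (s - w)" by (rule abs_Re_le_cmod)
        also have "\<dots> < \<sigma>" using w by (simp add: dist_norm)
        finally have "Re w \<ge> \<sigma>" by (simp add: \<sigma>_def abs_if split: if_splits)
        then have "real n powr (-1 - Re w) \<le> real n powr (-1 - \<sigma>)"
          using elim by (intro powr_mono) auto
        moreover have "P w \<le> B" using B(1)[of w] w by auto
        ultimately have "P w * real n powr (-1 - Re w) \<le> B * real n powr (-1 - \<sigma>)"
          using B by (intro mult_mono) auto
        then show "norm (t n w) \<le> norm (h n)"
          using le[of n w] elim w B(2) by (simp add: h_def norm_mult)
      qed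
    qed
    ultimately show "\<exists>d (h :: nat \<Rightarrow> complex). 0 < d \<and> summable h \<and> range h \<subseteq> \<real>\<^sub>\<ge>\<^sub>0 \<and>
        (\<forall>\<^sub>F n in sequentially. \<forall>y\<in>ball s d \<inter> {s. Re s > 0}. norm (t n y) \<le> norm (h n))"
      using \<sigma> by (intro exI[of _ \<sigma>] exI[of _ h] conjI)
  qed (rule that)
  show ?thesis
  proof (rule that)
    show "L holomorphic_on {s. Re s > 0}"
      using L op by (simp add: holomorphic_on_open field_differentiable_def)
  qed (use L in auto)
qed

lemma of_nat_powr_tendsto_0:
  fixes s :: complex
  assumes "Re s < 0"
  shows "(\<lambda>n. of_nat n powr s) \<longlonglongrightarrow> (0 :: complex)"
proof -
  have "(\<lambda>n. real n powr Re s) \<longlonglongrightarrow> 0"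
    using assms by (intro tendsto_neg_powr filterlim_real_sequentially) auto
  then show ?thesis by (subst tendsto_norm_zero_iff[symmetric]) (simp add: norm_of_nat_powr)
qed

lemma holomorphic_on_of_nat_powr: "(\<lambda>s. of_nat n powr (c + d * s)) holomorphic_on A"
  by (cases "n = 0") (auto intro!: holomorphic_intros)

text \<open>
  Abel summation replaces the terms by \<open>A n (n\<^sup>-\<^sup>s - (n + 1)\<^sup>-\<^sup>s)\<close> with bounded \<open>A n\<close>, which decay like
  \<open>n powr (-1 - Re s)\<close>, so that their sum converges locally uniformly for \<open>Re s > 0\<close>.
\<close>

lemma Dirichlet_series_bounded_sums:
  fixes a :: "nat \<Rightarrow> real"
  assumes C: "\<And>n. \<bar>\<Sum>k=1..n. a k\<bar> \<le> C"
  obtains L where "L holomorphic_on {s. Re s > 0}"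
    "\<And>s::complex. Re s > 0 \<Longrightarrow> (\<lambda>n. a n * of_nat n powr (-s)) sums L s"
proof -
  define A where "A = (\<lambda>n. \<Sum>k=1..n. a k)"
  define t where "t = (\<lambda>n s. of_real (A n) * (of_nat n powr (-s) - of_nat (Suc n) powr (-s)) :: complex)"
  have C0: "C \<ge> 0" using C[of 0] by simp
  obtain L where L: "L holomorphic_on {s. Re s > 0}" "\<And>s. Re s > 0 \<Longrightarrow> (\<lambda>n. t n s) sums L s"
  proof (rule holomorphic_series_half_plane[of t "\<lambda>s. C * norm s"])
    show "t n holomorphic_on {s. Re s > 0}" for n
      using holomorphic_on_of_nat_powr[of n 0 "-1"] holomorphic_on_of_nat_powr[of "Suc n" 0 "-1"]
      unfolding t_def by (intro holomorphic_intros)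
    show "norm (t n s) \<le> C * norm s * real n powr (-1 - Re s)" if "n > 0" "Re s > 0" for n and s :: complex
    proof -
      have "norm (t n s) = \<bar>A n\<bar> * norm (of_nat (Suc n) powr (-s) - of_nat n powr (-s))"
        by (simp add: t_def norm_mult norm_minus_commute)
      also have "\<dots> \<le> C * (norm s * real n powr (-1 - Re s))"
        using C[of n] norm_powr_diff_le[of n s] that C0 by (intro mult_mono) (auto simp: A_def)
      finally show ?thesis by (simp add: mult_ac)
    qed
    show "continuous_on UNIV (\<lambda>s. C * norm (s::complex))" by (intro continuous_intros)
  qed (rule that)
  have "(\<lambda>n. a n * of_nat n powr (-s)) sums L s" if s: "Re s > 0" for s :: complex
  proof -
    have eq: "(\<Sum>n<Suc N. of_real (a n) * of_nat n powr (-s)) = (\<Sum>n<N. t n s) + of_real (A N) * of_nat N powr (-s)" for N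
      by (induction N) (simp_all add: t_def A_def algebra_simps)
    have "(\<lambda>N. of_real (A N) * of_nat N powr (-s)) \<longlonglongrightarrow> 0"
    proof (rule Lim_null_comparison)
      show "\<forall>\<^sub>F N in sequentially. norm (of_real (A N) * of_nat N powr (-s)) \<le> C * norm (of_nat N powr (-s) :: complex)"
        using C by (auto simp: norm_mult A_def simp del: of_real_sum intro!: mult_right_mono always_eventually)
      show "(\<lambda>N. C * norm (of_nat N powr (-s) :: complex)) \<longlonglongrightarrow> 0"
        by (intro tendsto_mult_right_zero tendsto_norm_zero of_nat_powr_tendsto_0) (use s in auto)
    qed
    with L(2)[OF s] have "(\<lambda>N. \<Sum>n<Suc N. of_real (a n) * of_nat n powr (-s)) \<longlonglongrightarrow> L s + 0"
      unfolding eq sums_def by (intro tendsto_add)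
    then show ?thesis
      unfolding sums_def using filterlim_sequentially_Suc[of "\<lambda>N. \<Sum>n<N. of_real (a n) * of_nat n powr (-s)"] by simp
  qed
  with L(1) that show ?thesis by blast
qed

text \<open>
  \<open>H s\<close> is \<open>(s - 1) \<zeta>(s)\<close>, continued as a sum of terms \<open>(s - 1) n\<^sup>-\<^sup>s\<close> corrected by a telescoping
  difference. The sum starts at \<open>0\<close>: as \<open>0 powr s = 0\<close>, its first term is \<open>1\<close>, which compensates the
  total \<open>-1\<close> of the telescoping part.
\<close>

lemma zeta_continuation:
  obtains H where "H holomorphic_on {s. Re s > 0}" "H 1 = (1 :: complex)"
    "\<And>s. Re s > 1 \<Longrightarrow> (\<lambda>n. of_nat n powr (-s)) sums (H s / (s - 1))"
proof -
  define t where "t = (\<lambda>n s. of_nat (Suc n) powr (1-s) - of_nat n powr (1-s) - (1 - s) * of_nat n powr (-s) :: complex)"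
  obtain H where H: "H holomorphic_on {s. Re s > 0}" "\<And>s. Re s > 0 \<Longrightarrow> (\<lambda>n. t n s) sums H s"
  proof (rule holomorphic_series_half_plane[of t "\<lambda>s. norm (1 - s) * norm s"])
    show "t n holomorphic_on {s. Re s > 0}" for n
      using holomorphic_on_of_nat_powr[of n 0 "-1"] holomorphic_on_of_nat_powr[of n 1 "-1"]
        holomorphic_on_of_nat_powr[of "Suc n" 1 "-1"]
      unfolding t_def by (intro holomorphic_intros)
    show "norm (t n s) \<le> norm (1 - s) * norm s * real n powr (-1 - Re s)" if "n > 0" "Re s > 0" for n and s :: complex
      unfolding t_def by (rule norm_powr_second_diff_le) (use that in auto)
    show "continuous_on UNIV (\<lambda>s. norm (1 - s) * norm (s::complex))" by (intro continuous_intros)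
  qed (rule that)
  show ?thesis
  proof (rule that)
    show "H holomorphic_on {s. Re s > 0}" by fact
    have "t n 1 = (if n = 0 then 1 else 0)" for n
      by (cases n) (simp_all add: t_def del: of_nat_Suc)
    then have "(\<lambda>n. t n 1) sums 1" using sums_single[of 0 "\<lambda>_. 1 :: complex"] by (simp add: eq_commute cong: if_cong)
    then show "H 1 = 1" using H(2)[of 1] sums_unique2 by auto
    fix s :: complex assume s: "Re s > 1"
    have eq: "(\<Sum>n<N. t n s) = of_nat N powr (1-s) - (1 - s) * (\<Sum>n<N. of_nat n powr (-s))" for N
      by (induction N) (simp_all add: t_def algebra_simps)
    have "1 - s \<noteq> 0" using s by auto
    have "(\<lambda>N. (of_nat N powr (1-s) - (\<Sum>n<N. t n s)) / (1 - s)) \<longlonglongrightarrow> (0 - H s) / (1 - s)"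
      using H(2)[of s] s unfolding sums_def
      by (intro tendsto_intros of_nat_powr_tendsto_0) auto
    moreover have "(\<lambda>N. (of_nat N powr (1-s) - (\<Sum>n<N. t n s)) / (1 - s)) = (\<lambda>N. \<Sum>n<N. of_nat n powr (-s))"
      unfolding eq using \<open>1 - s \<noteq> 0\<close> by simp
    moreover have "(0 - H s) / (1 - s) = H s / (s - 1)"
      by (simp add: minus_divide_divide[of "H s" "1 - s", symmetric])
    ultimately show "(\<lambda>n. of_nat n powr (-s)) sums (H s / (s - 1))"
      unfolding sums_def by simp
  qed
qed

lemma Dirichlet_series_deriv:
  fixes a :: "nat \<Rightarrow> real" and F :: "complex \<Rightarrow> complex" and s :: complex
  assumes a: "\<And>n. \<bar>a n\<bar> \<le> 1" and F: "\<And>s::complex. Re s > 1 \<Longrightarrow> (\<lambda>n. a n * of_nat n powr (-s)) sums F s"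
    and s: "Re s > 1"
  shows "(\<lambda>n. (a n * ln (real n)) * of_nat n powr (-s)) sums (- deriv F s)"
proof -
  let ?S = "{s. Re s > 1}"
  have op: "open ?S" by (simp add: open_halfspace_Re_gt)
  have ln: "ln (of_nat n :: complex) = of_real (ln (real n))" if "n > 0" for n
    using Ln_of_real[of "real n"] that by simp
  let ?f = "\<lambda>n (s::complex). of_real (a n) * of_nat n powr (-s)"
  let ?f' = "\<lambda>n (s::complex). - of_real (a n * ln (real n)) * of_nat n powr (-s)"
  have der: "(?f n has_field_derivative ?f' n z) (at z)" for n z
    by (cases "n = 0") (auto intro!: derivative_eq_intros simp: ln powr_def)
  have "\<exists>g g'. \<forall>x \<in> ?S. (\<lambda>n. ?f n x) sums g x \<and> (\<lambda>n. ?f' n x) sums g' x \<and> (g has_field_derivative g' x) (at x)"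
  proof (rule series_and_derivative_comparison_complex[OF op der])
    fix z assume z: "z \<in> ?S"
    define \<delta> where "\<delta> = (Re z - 1) / 2"
    have \<delta>: "\<delta> > 0" using z by (simp add: \<delta>_def)
    define h where "h = (\<lambda>n. of_real (real n powr (-1 - \<delta>)) :: complex)"
    have "summable (\<lambda>n. real n powr (-1 - \<delta>))" using \<delta> by (simp add: summable_real_powr_iff)
    then have "summable h" unfolding h_def by (rule summable_of_real)
    moreover have "range h \<subseteq> \<real>\<^sub>\<ge>\<^sub>0" by (auto simp: h_def)
    moreover have "\<forall>\<^sub>F n in sequentially. \<forall>w\<in>ball z \<delta> \<inter> ?S. norm (?f n w) \<le> norm (h n)"
      using eventually_gt_at_top[of 0]
    proof eventually_elim
      case (elim n)
      show ?case
      proof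
        fix w assume w: "w \<in> ball z \<delta> \<inter> ?S"
        have "\<bar>Re (z - w)\<bar> \<le> norm (z - w)" by (rule abs_Re_le_cmod)
        also have "\<dots> < \<delta>" using w by (simp add: dist_norm)
        finally have "Re w \<ge> 1 + \<delta>" by (simp add: \<delta>_def abs_if field_simps split: if_splits)
        then have "real n powr (- Re w) \<le> real n powr (-1 - \<delta>)"
          using elim by (intro powr_mono) auto
        moreover have "norm (?f n w) \<le> 1 * real n powr (- Re w)"
          unfolding norm_mult using a[of n] by (intro mult_mono) (auto simp: norm_of_nat_powr)
        ultimately show "norm (?f n w) \<le> norm (h n)" by (simp add: h_def)
      qed
    qed
    ultimately show "\<exists>d (h :: nat \<Rightarrow> complex). 0 < d \<and> summable h \<and> range h \<subseteq> \<real>\<^sub>\<ge>\<^sub>0 \<and>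
        (\<forall>\<^sub>F n in sequentially. \<forall>y\<in>ball z d \<inter> ?S. norm (?f n y) \<le> norm (h n))"
      using \<delta> by (intro exI[of _ \<delta>] exI[of _ h] conjI)
  qed
  then obtain g g' where g: "\<And>x. x \<in> ?S \<Longrightarrow> (\<lambda>n. ?f n x) sums g x"
    "\<And>x. x \<in> ?S \<Longrightarrow> (\<lambda>n. ?f' n x) sums g' x" "\<And>x. x \<in> ?S \<Longrightarrow> (g has_field_derivative g' x) (at x)"
    by blast
  have "g x = F x" if "x \<in> ?S" for x
    using g(1)[OF that] F[of x] that sums_unique2 by auto
  then have "(F has_field_derivative g' s) (at s)"
    using g(3)[of s] s op has_field_derivative_transform_within_open[of g "g' s" s ?S F] by auto
  then have "deriv F s = g' s" by (rule DERIV_imp_deriv)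
  then show ?thesis
    using sums_minus[OF g(2)[of s]] s by simp
qed

text \<open>
  Write \<open>f w = (w - z)\<^sup>k g w\<close> with \<open>g z \<noteq> 0\<close>: the logarithmic derivative is
  \<open>k / (w - z)\<close> plus that of \<open>g\<close>, which stays bounded near \<open>z\<close>.
\<close>

lemma log_deriv_tendsto_order:
  fixes f :: "complex \<Rightarrow> complex"
  assumes hol: "f holomorphic_on S" and S: "open S" "connected S" "z \<in> S"
    and nz: "\<exists>w\<in>S. f w \<noteq> 0"
  shows "\<exists>k::nat. (k = 0 \<longleftrightarrow> f z \<noteq> 0) \<and> ((\<lambda>w. (w - z) * deriv f w / f w) \<longlongrightarrow> of_nat k) (at z)"
proof (cases "f z = 0")
  case False
  have "continuous_on S f" "continuous_on S (deriv f)"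
    using hol S(1) holomorphic_deriv holomorphic_on_imp_continuous_on by blast+
  then have "isCont f z" "isCont (deriv f) z"
    using S continuous_on_eq_continuous_at by blast+
  then have "((\<lambda>w. (w - z) * deriv f w / f w) \<longlongrightarrow> (z - z) * deriv f z / f z) (at z)"
    using False unfolding isCont_def by (intro tendsto_intros) auto
  then show ?thesis using False by (intro exI[of _ 0]) auto
next
  case True
  have "\<not> f constant_on S" using True nz S(3) unfolding constant_on_def by metis
  then obtain g r n where g: "0 < n" "0 < r" "ball z r \<subseteq> S" "g holomorphic_on ball z r"
     "\<And>w. w \<in> ball z r \<Longrightarrow> f w = (w - z)^n * g w" "\<And>w. w \<in> ball z r \<Longrightarrow> g w \<noteq> 0"
    using holomorphic_factor_zero_nonconstant[OF hol S True] by metis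
  have "continuous_on (ball z r) g" "continuous_on (ball z r) (deriv g)"
    using g(4) holomorphic_deriv holomorphic_on_imp_continuous_on by blast+
  then have "isCont g z" "isCont (deriv g) z"
    using g(2) continuous_on_eq_continuous_at[OF open_ball] by (meson centre_in_ball)+
  then have lim: "((\<lambda>w. of_nat n + (w - z) * deriv g w / g w) \<longlongrightarrow> of_nat n + (z - z) * deriv g z / g z) (at z)"
    using g(2) g(6)[of z] unfolding isCont_def by (intro tendsto_intros) auto
  have eq: "of_nat n + (w - z) * deriv g w / g w = (w - z) * deriv f w / f w"
    if w: "w \<in> ball z r" "w \<noteq> z" for w
  proof -
    have "(g has_field_derivative deriv g w) (at w)"
      using holomorphic_derivI[OF g(4) open_ball w(1)] .
    then have "((\<lambda>w. (w - z)^n * g w) has_field_derivative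
        (of_nat n * (w - z)^(n-1) * g w + (w - z)^n * deriv g w)) (at w)"
      by (auto intro!: derivative_eq_intros)
    then have "(f has_field_derivative
        (of_nat n * (w - z)^(n-1) * g w + (w - z)^n * deriv g w)) (at w)"
      using has_field_derivative_transform_within_open[OF _ open_ball w(1)] g(5) by (metis (no_types, lifting))
    then have d: "deriv f w = of_nat n * (w - z)^(n-1) * g w + (w - z)^n * deriv g w"
      by (rule DERIV_imp_deriv)
    have p: "(w - z)^n = (w - z) * (w - z)^(n-1)" using g(1) by (cases n) auto
    show ?thesis
      unfolding d g(5)[OF w(1)] p using w g(6)[OF w(1)] by (simp add: field_simps)
  qed
  have "((\<lambda>w. (w - z) * deriv f w / f w) \<longlongrightarrow> of_nat n) (at z)"
  proof (rule Lim_transform_within[OF lim[simplified] g(2)])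
    fix w assume "0 < dist w z" "dist w z < r"
    then show "of_nat n + (w - z) * deriv g w / g w = (w - z) * deriv f w / f w"
      by (intro eq) (auto simp: dist_commute)
  qed
  then show ?thesis using True g(1) by (intro exI[of _ n]) auto
qed

section \<open>Non-vanishing on the line of real part one, away from the point one\<close>

definition moebius_mu :: "nat \<Rightarrow> real" where
  "moebius_mu n = (if squarefree n then (-1) ^ card (prime_factors n) else 0)"

lemma abs_moebius_mu_le: "\<bar>moebius_mu n\<bar> \<le> 1"
  by (simp add: moebius_mu_def)

lemma moebius_mu_prime_mult:
  fixes p d :: nat
  assumes "prime p" "d > 0"
  shows "moebius_mu (p * d) = (if p dvd d then 0 else - moebius_mu d)"
proof (cases "p dvd d")
  case True
  then have "p ^ 2 dvd p * d" by (simp add: power2_eq_square)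
  then have "\<not> squarefree (p * d)"
    using assms by (intro not_squarefreeI) auto
  then show ?thesis using True by (simp add: moebius_mu_def)
next
  case False
  have cop: "coprime p d" using False assms(1) by (simp add: prime_imp_coprime)
  have "squarefree (p * d) \<longleftrightarrow> squarefree d"
    using squarefree_mult_coprime[OF cop squarefree_prime[OF assms(1)]] squarefree_multD(2) by blast
  moreover have "prime_factors (p * d) = insert p (prime_factors d)"
    using assms by (simp add: prime_factors_product prime_prime_factors)
  moreover have "p \<notin> prime_factors d" using False by (auto simp: prime_factors_dvd)
  ultimately show ?thesis using False by (simp add: moebius_mu_def)
qed

text \<open>
  For a prime \<open>p\<close> dividing \<open>n\<close>, the divisors \<open>d\<close> prime to \<open>p\<close> cancel against \<open>p d\<close>, and the
  divisors divisible by \<open>p\<^sup>2\<close> contribute nothing.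
\<close>

lemma moebius_mu_sum_divisors:
  assumes "n > 0"
  shows "(\<Sum>d | d dvd n. moebius_mu d) = (if n = 1 then 1 else 0)"
proof (cases "n = 1")
  case True
  then show ?thesis by (simp add: moebius_mu_def)
next
  case False
  then obtain p where p: "prime p" "p dvd n" using prime_factor_nat by blast
  define m where "m = n div p"
  have n: "n = p * m" using p by (simp add: m_def)
  have m: "m > 0" using assms n by (cases m) auto
  have p0: "p > 0" using p(1) prime_gt_0_nat by blast
  have eq: "{d. d dvd n \<and> p dvd d} = (*) p ` {d. d dvd m}"
  proof (intro equalityI subsetI)
    fix d assume "d \<in> {d. d dvd n \<and> p dvd d}"
    then show "d \<in> (*) p ` {d. d dvd m}" using p0 by (auto simp: n elim!: dvdE)
  qed (auto simp: n)
  have fin: "finite {d. d dvd n}" "finite {d. d dvd m}" using assms m by auto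
  have "{d. d dvd m \<and> \<not> p dvd d} = {d. d dvd n \<and> \<not> p dvd d}"
  proof -
    have "d dvd p * m \<longleftrightarrow> d dvd m" if "\<not> p dvd d" for d
      using that p(1) by (metis coprime_commute coprime_dvd_mult_right_iff prime_imp_coprime)
    then show ?thesis unfolding n by blast
  qed
  have "(\<Sum>d | d dvd n \<and> p dvd d. moebius_mu d) = (\<Sum>d | d dvd m. moebius_mu (p * d))"
    unfolding eq using p0 by (subst sum.reindex) (auto simp: inj_on_def)
  also have "\<dots> = (\<Sum>d | d dvd m. if p dvd d then 0 else - moebius_mu d)"
  proof (intro sum.cong refl)
    fix d assume "d \<in> {d. d dvd m}"
    then have "d > 0" using m by (auto intro: dvd_pos_nat)
    then show "moebius_mu (p * d) = (if p dvd d then 0 else - moebius_mu d)"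
      by (rule moebius_mu_prime_mult[OF p(1)])
  qed
  also have "\<dots> = (\<Sum>d \<in> {d \<in> {d. d dvd m}. \<not> p dvd d}. - moebius_mu d)"
    by (subst sum.inter_filter[OF fin(2)]) (auto intro: sum.cong)
  also have "{d \<in> {d. d dvd m}. \<not> p dvd d} = {d. d dvd n \<and> \<not> p dvd d}"
    using \<open>{d. d dvd m \<and> \<not> p dvd d} = {d. d dvd n \<and> \<not> p dvd d}\<close> by simp
  finally have "(\<Sum>d | d dvd n \<and> p dvd d. moebius_mu d) = - (\<Sum>d | d dvd n \<and> \<not> p dvd d. moebius_mu d)"
    by (simp add: sum_negf)
  moreover have "(\<Sum>d | d dvd n. moebius_mu d) =
     (\<Sum>d | d dvd n \<and> p dvd d. moebius_mu d) + (\<Sum>d | d dvd n \<and> \<not> p dvd d. moebius_mu d)"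
    using fin(1) by (subst sum.union_disjoint[symmetric]) (auto intro!: sum.cong)
  ultimately show ?thesis using False by simp
qed

lemma mangoldt_le_ln:
  assumes "n > 0"
  shows "mangoldt n \<le> ln (real n)"
proof -
  have "mangoldt n \<le> (\<Sum>d | d dvd n. mangoldt d :: real)"
    using assms by (intro member_le_sum) (auto simp: mangoldt_nonneg)
  also have "\<dots> = ln (real n)" using mangoldt_sum[of n, where ?'a = real] assms by simp
  finally show ?thesis .
qed

lemma summable_le_powr:
  fixes a :: "nat \<Rightarrow> real"
  assumes "\<And>n. \<bar>a n\<bar> \<le> 1" "\<sigma> > 1"
  shows "summable (\<lambda>n. \<bar>a n\<bar> * real n powr (-\<sigma>))"
proof (rule summable_comparison_test')
  show "summable (\<lambda>n. real n powr (-\<sigma>))" using assms by (simp add: summable_real_powr_iff)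
  show "norm (\<bar>a n\<bar> * real n powr (-\<sigma>)) \<le> real n powr (-\<sigma>)" for n
    using assms(1)[of n] by (simp add: mult_left_le_one_le)
qed

lemma summable_le_ln_powr:
  fixes a :: "nat \<Rightarrow> real"
  assumes "\<And>n. n > 0 \<Longrightarrow> \<bar>a n\<bar> \<le> ln (real n)" "\<sigma> > 1"
  shows "summable (\<lambda>n. \<bar>a n\<bar> * real n powr (-\<sigma>))"
proof (rule summable_comparison_test')
  define \<delta> where "\<delta> = (\<sigma> - 1) / 2"
  have \<delta>: "\<delta> > 0" "\<delta> - \<sigma> < -1" using assms(2) by (auto simp: \<delta>_def field_simps)
  show "summable (\<lambda>n. real n powr (\<delta> - \<sigma>) / \<delta>)"
    using \<delta> by (intro summable_divide) (simp add: summable_real_powr_iff)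
  show "norm (\<bar>a n\<bar> * real n powr (-\<sigma>)) \<le> real n powr (\<delta> - \<sigma>) / \<delta>" if "n \<ge> 1" for n
  proof -
    have "\<bar>a n\<bar> \<le> real n powr \<delta> / \<delta>"
      using assms(1)[of n] ln_powr_bound[of "real n" \<delta>] that \<delta> by simp
    then have "\<bar>a n\<bar> * real n powr (-\<sigma>) \<le> real n powr \<delta> / \<delta> * real n powr (-\<sigma>)"
      by (intro mult_right_mono) auto
    also have "\<dots> = real n powr (\<delta> - \<sigma>) / \<delta>"
      by (simp add: powr_diff powr_minus field_simps)
    finally show ?thesis by simp
  qed
qed

locale completely_multiplicative =
  fixes f :: "nat \<Rightarrow> real"
  assumes mult: "f (m * n) = f m * f n" and one: "f 1 = 1" and abs_le: "\<bar>f n\<bar> \<le> 1"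
begin

lemma mult_div: "d dvd n \<Longrightarrow> f d * f (n div d) = f n"
  by (simp flip: mult)

lemma moebius_mu_twist: "(\<Sum>d | d dvd n. moebius_mu d * f d * f (n div d)) = (if n = 1 then 1 else 0)"
proof (cases "n = 0")
  case False
  have "(\<Sum>d | d dvd n. moebius_mu d * f d * f (n div d)) = (\<Sum>d | d dvd n. moebius_mu d * f n)"
    by (intro sum.cong) (auto simp: mult.assoc mult_div)
  also have "\<dots> = (if n = 1 then 1 else 0)"
    using False moebius_mu_sum_divisors[of n] one by (simp flip: sum_distrib_right)
  finally show ?thesis .
qed simp

lemma mangoldt_twist: "(\<Sum>d | d dvd n. mangoldt d * f d * f (n div d)) = f n * ln (real n)"
proof (cases "n = 0")
  case False
  have "(\<Sum>d | d dvd n. mangoldt d * f d * f (n div d)) = (\<Sum>d | d dvd n. mangoldt d * f n)"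
    by (intro sum.cong) (auto simp: mult.assoc mult_div)
  also have "\<dots> = f n * ln (real n)"
    using False mangoldt_sum[of n, where ?'a = real] by (simp flip: sum_distrib_right)
  finally show ?thesis .
qed simp

context
  fixes F :: "complex \<Rightarrow> complex"
  assumes F: "\<And>s::complex. Re s > 1 \<Longrightarrow> (\<lambda>n. of_real (f n) * of_nat n powr (-s)) sums F s"
begin

lemma inverse_series:
  assumes s: "Re s > 1"
  shows "F s \<noteq> 0" "(\<lambda>n. of_real (moebius_mu n * f n) * of_nat n powr (-s)) sums (1 / F s)"
proof -
  have le: "\<bar>moebius_mu n * f n\<bar> \<le> 1" for n
    using abs_le[of n] abs_moebius_mu_le[of n] by (simp add: abs_mult mult_le_one)
  have sm: "summable (\<lambda>n. \<bar>moebius_mu n * f n\<bar> * real n powr (- Re s))"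
    by (rule summable_le_powr[OF le s])
  then have "summable (\<lambda>n. of_real (moebius_mu n * f n) * of_nat n powr (-s) :: complex)"
    by (intro summable_norm_cancel[of "\<lambda>n. of_real (moebius_mu n * f n) * of_nat n powr (-s) :: complex"])
       (simp add: norm_mult norm_of_nat_powr abs_mult)
  then obtain M where M: "(\<lambda>n. of_real (moebius_mu n * f n) * of_nat n powr (-s)) sums M"
    by (auto simp: summable_def)
  have "(\<lambda>n. of_real (\<Sum>d | d dvd n. moebius_mu d * f d * f (n div d)) * of_nat n powr (-s)) sums (M * F s)"
    by (rule Dirichlet_series_mult[OF sm M summable_le_powr[OF abs_le s] F[OF s]])
  then have "(\<lambda>n. if n = 1 then 1 else 0) sums (M * F s)"
    unfolding moebius_mu_twist by (rule sums_cong[THEN iffD1, rotated]) auto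
  then have "M * F s = 1" using sums_single[of 1 "\<lambda>_. 1 :: complex"] sums_unique2 by force
  then show "F s \<noteq> 0" by auto
  with \<open>M * F s = 1\<close> have "M = 1 / F s" by (simp add: field_simps)
  with M show "(\<lambda>n. of_real (moebius_mu n * f n) * of_nat n powr (-s)) sums (1 / F s)" by simp
qed

lemma log_deriv_series:
  assumes s: "Re s > 1"
  shows "(\<lambda>n. of_real (mangoldt n * f n) * of_nat n powr (-s)) sums (- deriv F s / F s)"
proof -
  have le: "\<bar>mangoldt n * f n\<bar> \<le> ln (real n)" if "n > 0" for n
    using mult_mono[OF mangoldt_le_ln[OF that] abs_le[of n]] that by (simp add: abs_mult)
  have sm: "summable (\<lambda>n. \<bar>mangoldt n * f n\<bar> * real n powr (- Re s))"
    by (rule summable_le_ln_powr[OF le s])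
  then have "summable (\<lambda>n. of_real (mangoldt n * f n) * of_nat n powr (-s) :: complex)"
    by (intro summable_norm_cancel[of "\<lambda>n. of_real (mangoldt n * f n) * of_nat n powr (-s) :: complex"])
       (simp add: norm_mult norm_of_nat_powr abs_mult)
  then obtain M where M: "(\<lambda>n. of_real (mangoldt n * f n) * of_nat n powr (-s)) sums M"
    by (auto simp: summable_def)
  have "(\<lambda>n. of_real (\<Sum>d | d dvd n. mangoldt d * f d * f (n div d)) * of_nat n powr (-s)) sums (M * F s)"
    by (rule Dirichlet_series_mult[OF sm M summable_le_powr[OF abs_le s] F[OF s]])
  then have "(\<lambda>n. of_real (f n * ln (real n)) * of_nat n powr (-s)) sums (M * F s)"
    unfolding mangoldt_twist .
  then have "M * F s = - deriv F s"
    using Dirichlet_series_deriv[OF abs_le F s] sums_unique2 by blast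
  then have "M = - deriv F s / F s" using inverse_series(1)[OF s] by (metis nonzero_mult_div_cancel_right)
  with M show ?thesis by simp
qed

end

end

text \<open>
  The zeta function.
\<close>

interpretation const_one: completely_multiplicative "\<lambda>_. 1"
  by standard auto

lemma Re_of_nat_powr:
  assumes "n > 0"
  shows "Re (of_nat n powr (- Complex \<sigma> t)) = real n powr (-\<sigma>) * cos (t * ln (real n))"
proof -
  have "ln (of_nat n :: complex) = of_real (ln (real n))"
    using Ln_of_real[of "real n"] assms by simp
  then have "(of_nat n :: complex) powr (- Complex \<sigma> t) = exp (- Complex \<sigma> t * of_real (ln (real n)))"
    using assms by (simp add: powr_def)
  also have "Re \<dots> = real n powr (-\<sigma>) * cos (t * ln (real n))"
    using assms by (simp add: Re_exp powr_def)
  finally show ?thesis .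
qed

text \<open>
  The sum of the three logarithmic derivatives is a series with terms
  \<open>\<Lambda> n n\<^sup>-\<^sup>\<sigma> (3 + 4 f n cos \<theta> + cos 2\<theta>)\<close>, \<open>\<theta> = t ln n\<close>. The outer two series carry no factor \<open>f\<close>;
  the bracket equals \<open>2 ((cos \<theta> + f n)\<^sup>2 + 1 - (f n)\<^sup>2)\<close> and is nonnegative also where \<open>f n = 0\<close>.
\<close>

lemma (in completely_multiplicative) three_four_one:
  fixes Z L :: "complex \<Rightarrow> complex"
  assumes Z: "\<And>s::complex. Re s > 1 \<Longrightarrow> (\<lambda>n. of_nat n powr (-s)) sums Z s"
    and L: "\<And>s::complex. Re s > 1 \<Longrightarrow> (\<lambda>n. of_real (f n) * of_nat n powr (-s)) sums L s"
    and \<sigma>: "\<sigma> > 1"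
  shows "3 * Re (- deriv Z (Complex \<sigma> 0) / Z (Complex \<sigma> 0))
       + 4 * Re (- deriv L (Complex \<sigma> t) / L (Complex \<sigma> t))
       + Re (- deriv Z (Complex \<sigma> (2 * t)) / Z (Complex \<sigma> (2 * t))) \<ge> 0"
proof -
  have Z': "(\<lambda>n. mangoldt n * Re (of_nat n powr (- Complex \<sigma> u))) sums Re (- deriv Z (Complex \<sigma> u) / Z (Complex \<sigma> u))" for u
    using const_one.log_deriv_series[of Z "Complex \<sigma> u"] Z \<sigma> sums_Re by fastforce
  have L': "(\<lambda>n. mangoldt n * f n * Re (of_nat n powr (- Complex \<sigma> t))) sums Re (- deriv L (Complex \<sigma> t) / L (Complex \<sigma> t))"
    using sums_Re[OF log_deriv_series[of L "Complex \<sigma> t"]] L \<sigma> by simp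
  let ?r = "\<lambda>n u. Re (of_nat n powr (- Complex \<sigma> u))"
  have "(\<lambda>n. 3 * (mangoldt n * ?r n 0) + 4 * (mangoldt n * f n * ?r n t) + mangoldt n * ?r n (2 * t)) sums
     (3 * Re (- deriv Z (Complex \<sigma> 0) / Z (Complex \<sigma> 0))
       + 4 * Re (- deriv L (Complex \<sigma> t) / L (Complex \<sigma> t))
       + Re (- deriv Z (Complex \<sigma> (2 * t)) / Z (Complex \<sigma> (2 * t))))"
    by (intro sums_add sums_mult Z' L')
  moreover have "3 * (mangoldt n * ?r n 0) + 4 * (mangoldt n * f n * ?r n t) + mangoldt n * ?r n (2 * t) \<ge> 0" for n
  proof (cases "n = 0")
    case False
    then have n: "n > 0" by simp
    define c where "c = cos (t * ln (real n))"
    have "3 * (mangoldt n * ?r n 0) + 4 * (mangoldt n * f n * ?r n t) + mangoldt n * ?r n (2 * t)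
       = mangoldt n * real n powr (-\<sigma>) * (3 + 4 * f n * c + cos (2 * (t * ln (real n))))"
      unfolding Re_of_nat_powr[OF n] by (simp add: c_def algebra_simps)
    also have "cos (2 * (t * ln (real n))) = 2 * c\<^sup>2 - 1"
      unfolding c_def by (rule cos_double_cos)
    also have "3 + 4 * f n * c + (2 * c\<^sup>2 - 1) = 2 * ((c + f n)\<^sup>2 + (1 - (f n)\<^sup>2))"
      by (simp add: power2_eq_square algebra_simps)
    also have "mangoldt n * real n powr (-\<sigma>) * \<dots> \<ge> 0"
      using abs_le[of n] abs_le_square_iff[of "f n" 1]
      by (intro mult_nonneg_nonneg mangoldt_nonneg add_nonneg_nonneg) auto
    finally show ?thesis .
  qed simp
  ultimately show ?thesis by (rule sums_le[OF _ sums_zero, rotated])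
qed

lemma filterlim_Complex_at_right:
  "filterlim (\<lambda>\<sigma>. Complex \<sigma> t) (at (Complex 1 t)) (at_right 1)"
  unfolding filterlim_at
proof
  show "\<forall>\<^sub>F \<sigma> in at_right 1. Complex \<sigma> t \<in> UNIV \<and> Complex \<sigma> t \<noteq> Complex 1 t"
    by (auto simp: eventually_at_filter)
  show "((\<lambda>\<sigma>. Complex \<sigma> t) \<longlongrightarrow> Complex 1 t) (at_right 1)"
    by (intro tendsto_Complex tendsto_intros)
qed

lemma log_deriv_limit:
  assumes "F holomorphic_on {s. Re s > 0}" "\<exists>s. Re s > 0 \<and> F s \<noteq> 0"
  shows "\<exists>k::nat. (k = 0 \<longleftrightarrow> F (Complex 1 t) \<noteq> 0) \<and>
     ((\<lambda>\<sigma>. (\<sigma> - 1) * Re (deriv F (Complex \<sigma> t) / F (Complex \<sigma> t))) \<longlongrightarrow> real k) (at_right 1)"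
proof -
  obtain k :: nat where k: "k = 0 \<longleftrightarrow> F (Complex 1 t) \<noteq> 0"
    "((\<lambda>w. (w - Complex 1 t) * deriv F w / F w) \<longlongrightarrow> of_nat k) (at (Complex 1 t))"
    using log_deriv_tendsto_order[OF assms(1), of "Complex 1 t"] assms(2)
    by (auto simp: open_halfspace_Re_gt convex_halfspace_Re_gt convex_connected)
  have "((\<lambda>\<sigma>. Re ((Complex \<sigma> t - Complex 1 t) * deriv F (Complex \<sigma> t) / F (Complex \<sigma> t))) \<longlongrightarrow> Re (of_nat k)) (at_right 1)"
    by (intro tendsto_Re filterlim_compose[OF k(2) filterlim_Complex_at_right])
  moreover have "Re ((Complex \<sigma> t - Complex 1 t) * deriv F (Complex \<sigma> t) / F (Complex \<sigma> t)) =
     (\<sigma> - 1) * Re (deriv F (Complex \<sigma> t) / F (Complex \<sigma> t))" for \<sigma>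
  proof -
    have "Complex \<sigma> t - Complex 1 t = of_real (\<sigma> - 1)" by (simp add: complex_eq_iff)
    then show ?thesis
      by (simp only: times_divide_eq_right[symmetric] times_complex.sel Re_complex_of_real Im_complex_of_real mult_zero_left diff_zero)
  qed
  ultimately have "((\<lambda>\<sigma>. (\<sigma> - 1) * Re (deriv F (Complex \<sigma> t) / F (Complex \<sigma> t))) \<longlongrightarrow> real k) (at_right 1)"
    by (simp only: complex_Re_of_nat)
  then show ?thesis
    by (intro exI[of _ k] conjI k(1))
qed

text \<open>
  Multiply the inequality of \<open>three_four_one\<close> by \<open>\<sigma> - 1\<close> and let \<open>\<sigma>\<close> tend to \<open>1\<close>. Each logarithmic
  derivative contributes minus an order of vanishing; the pole of zeta at \<open>1\<close> contributes
  \<open>3\<close>, and at \<open>1 + 2 i t\<close> there is no pole because \<open>t \<noteq> 0\<close>. So \<open>3 - 4 k - k2 \<ge> 0\<close>, which forces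
  \<open>k = 0\<close>.
\<close>

lemma (in completely_multiplicative) nonzero_on_line:
  fixes L :: "complex \<Rightarrow> complex"
  assumes L: "L holomorphic_on {s. Re s > 0}"
      "\<And>s::complex. Re s > 1 \<Longrightarrow> (\<lambda>n. of_real (f n) * of_nat n powr (-s)) sums L s"
    and t: "t \<noteq> 0"
  shows "L (Complex 1 t) \<noteq> 0"
proof -
  obtain H where H: "H holomorphic_on {s. Re s > 0}" "H 1 = (1 :: complex)"
    "\<And>s. Re s > 1 \<Longrightarrow> (\<lambda>n. of_nat n powr (-s)) sums (H s / (s - 1))"
    using zeta_continuation by blast
  let ?Z = "\<lambda>s. H s / (s - 1)"
  have L2: "L 2 \<noteq> 0" using inverse_series(1)[of L 2] L by simp
  have Lnz: "\<exists>s. Re s > 0 \<and> L s \<noteq> 0" using L2 by (intro exI[of _ 2]) auto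
  obtain k :: nat where k: "k = 0 \<longleftrightarrow> L (Complex 1 t) \<noteq> 0"
    "((\<lambda>\<sigma>. (\<sigma> - 1) * Re (deriv L (Complex \<sigma> t) / L (Complex \<sigma> t))) \<longlongrightarrow> real k) (at_right 1)"
    using log_deriv_limit[OF L(1) Lnz, of t] by (elim exE conjE) (rule that; assumption)
  have Hnz: "\<exists>s. Re s > 0 \<and> H s \<noteq> 0" using H(2) by (intro exI[of _ 1]) auto
  obtain k0 :: nat where k0: "k0 = 0 \<longleftrightarrow> H (Complex 1 0) \<noteq> 0"
    "((\<lambda>\<sigma>. (\<sigma> - 1) * Re (deriv H (Complex \<sigma> 0) / H (Complex \<sigma> 0))) \<longlongrightarrow> real k0) (at_right 1)"
    using log_deriv_limit[OF H(1) Hnz, of 0] by (elim exE conjE) (rule that; assumption)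
  obtain k2 :: nat where k2:
    "((\<lambda>\<sigma>. (\<sigma> - 1) * Re (deriv H (Complex \<sigma> (2*t)) / H (Complex \<sigma> (2*t)))) \<longlongrightarrow> real k2) (at_right 1)"
    using log_deriv_limit[OF H(1) Hnz, of "2*t"] by (elim exE conjE) (rule that; assumption)
  have "Complex 1 0 = 1" by (simp add: complex_eq_iff)
  then have "k0 = 0" using k0(1) H(2) by simp
  have Z': "- deriv ?Z s / ?Z s = 1 / (s - 1) - deriv H s / H s" if s: "Re s > 1" for s
  proof -
    have "(H has_field_derivative deriv H s) (at s)"
      using holomorphic_derivI[OF H(1) open_halfspace_Re_gt, of s] s by auto
    moreover have s1: "s \<noteq> 1" using s by auto
    ultimately have "(?Z has_field_derivative (deriv H s * (s - 1) - H s) / (s - 1)\<^sup>2) (at s)"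
      by (auto intro!: derivative_eq_intros simp: power2_eq_square)
    then have d: "deriv ?Z s = (deriv H s * (s - 1) - H s) / (s - 1)\<^sup>2" by (rule DERIV_imp_deriv)
    have "H s \<noteq> 0" using const_one.inverse_series(1)[of ?Z s] H(3) s by auto
    moreover have "- ((h' * u - h) / u\<^sup>2) / (h / u) = 1 / u - h' / h" if "u \<noteq> 0" "h \<noteq> 0" for u h h' :: complex
      using that by (simp add: field_simps power2_eq_square)
    ultimately show ?thesis unfolding d using s1 by simp
  qed
  define E where "E = (\<lambda>\<sigma>. 3 * (1 - (\<sigma> - 1) * Re (deriv H (Complex \<sigma> 0) / H (Complex \<sigma> 0)))
     - 4 * ((\<sigma> - 1) * Re (deriv L (Complex \<sigma> t) / L (Complex \<sigma> t)))
     + ((\<sigma> - 1) * Re (1 / (Complex \<sigma> (2*t) - 1)) - (\<sigma> - 1) * Re (deriv H (Complex \<sigma> (2*t)) / H (Complex \<sigma> (2*t)))))"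
  have lim2: "((\<lambda>\<sigma>. Complex \<sigma> (2*t)) \<longlongrightarrow> Complex 1 (2*t)) (at_right 1)"
    by (intro tendsto_Complex tendsto_intros)
  have "Complex 1 (2 * t) - 1 \<noteq> 0" using t by (simp add: complex_eq_iff)
  then have "(E \<longlongrightarrow> 3 * (1 - real k0) - 4 * real k +
      ((1 - 1) * Re (1 / (Complex 1 (2*t) - 1)) - real k2)) (at_right 1)"
    unfolding E_def by (intro tendsto_intros k0(2) k(2) k2 lim2)
  moreover have "\<forall>\<^sub>F \<sigma> in at_right 1. E \<sigma> \<ge> 0"
    using eventually_at_right_less[of 1]
  proof eventually_elim
    case (elim \<sigma>)
    have "3 * Re (- deriv ?Z (Complex \<sigma> 0) / ?Z (Complex \<sigma> 0))
       + 4 * Re (- deriv L (Complex \<sigma> t) / L (Complex \<sigma> t))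
       + Re (- deriv ?Z (Complex \<sigma> (2 * t)) / ?Z (Complex \<sigma> (2 * t))) \<ge> 0"
      by (rule three_four_one[OF H(3) L(2) elim])
    moreover have "- deriv ?Z (Complex \<sigma> u) / ?Z (Complex \<sigma> u) =
        1 / (Complex \<sigma> u - 1) - deriv H (Complex \<sigma> u) / H (Complex \<sigma> u)" for u
      by (rule Z') (use elim in simp)
    ultimately have "0 \<le> 3 * Re (1 / (Complex \<sigma> 0 - 1) - deriv H (Complex \<sigma> 0) / H (Complex \<sigma> 0))
       + 4 * Re (- deriv L (Complex \<sigma> t) / L (Complex \<sigma> t))
       + Re (1 / (Complex \<sigma> (2 * t) - 1) - deriv H (Complex \<sigma> (2*t)) / H (Complex \<sigma> (2*t)))"
      by (simp only:)
    then have "0 \<le> (\<sigma> - 1) * (3 * Re (1 / (Complex \<sigma> 0 - 1) - deriv H (Complex \<sigma> 0) / H (Complex \<sigma> 0))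
       + 4 * Re (- deriv L (Complex \<sigma> t) / L (Complex \<sigma> t))
       + Re (1 / (Complex \<sigma> (2 * t) - 1) - deriv H (Complex \<sigma> (2*t)) / H (Complex \<sigma> (2*t))))"
      using elim by (intro mult_nonneg_nonneg) simp_all
    moreover have "1 / (Complex \<sigma> 0 - 1) = of_real (1 / (\<sigma> - 1))"
    proof -
      have "Complex \<sigma> 0 - 1 = of_real (\<sigma> - 1)" by (simp add: complex_eq_iff)
      then show ?thesis by (simp only: of_real_divide of_real_1)
    qed
    ultimately have "0 \<le> (\<sigma> - 1) * (3 * (1 / (\<sigma> - 1) - Re (deriv H (Complex \<sigma> 0) / H (Complex \<sigma> 0)))
       - 4 * Re (deriv L (Complex \<sigma> t) / L (Complex \<sigma> t))
       + (Re (1 / (Complex \<sigma> (2 * t) - 1)) - Re (deriv H (Complex \<sigma> (2*t)) / H (Complex \<sigma> (2*t)))))"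
      by (simp only: minus_complex.sel uminus_complex.sel minus_divide_left[symmetric] Re_complex_of_real) simp
    also have "\<dots> = E \<sigma>"
    proof -
      have "w * (3 * (1 / w - b) - 4 * c + (d - e)) = 3 * (1 - w * b) - 4 * (w * c) + (w * d - w * e)"
        if "w \<noteq> 0" for w b c d e :: real
        using that by (simp add: field_simps)
      then show ?thesis unfolding E_def using elim by simp
    qed
    finally show ?case .
  qed
  ultimately have "3 * (1 - real k0) - 4 * real k + ((1 - 1) * Re (1 / (Complex 1 (2*t) - 1)) - real k2) \<ge> 0"
    by (rule tendsto_lowerbound) auto
  then have "k = 0" using \<open>k0 = 0\<close> by simp
  then show ?thesis using k(1) by simp
qed

section \<open>Non-vanishing at the point one\<close>

lemma bij_betw_coprime_divisors:
  fixes a b :: nat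
  assumes "coprime a b"
  shows "bij_betw (\<lambda>(x, y). x * y) ({x. x dvd a} \<times> {y. y dvd b}) {d. d dvd a * b}"
proof (rule bij_betw_imageI)
  have cop: "coprime x y" if "x dvd a" "y dvd b" for x y
    using coprime_divisors[OF that assms] .
  have dvd: "x dvd x' \<and> y dvd y'"
    if "x dvd a" "x' dvd a" "y dvd b" "y' dvd b" "x * y = x' * y'" for x x' y y'
  proof
    have "x dvd x' * y'" using that(5) by (metis dvd_triv_left)
    then show "x dvd x'" using cop[of x y'] that coprime_dvd_mult_left_iff by blast
    have "y dvd x' * y'" using that(5) by (metis dvd_triv_right)
    then show "y dvd y'" using cop[of x' y] that by (metis coprime_commute coprime_dvd_mult_right_iff)
  qed
  show "inj_on (\<lambda>(x, y). x * y) ({x. x dvd a} \<times> {y. y dvd b})"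
  proof (rule inj_onI, clarify)
    fix x y x' y' assume "x dvd a" "x' dvd a" "y dvd b" "y' dvd b" "x * y = x' * y'"
    then show "x = x' \<and> y = y'" using dvd[of x x' y y'] dvd[of x' x y' y] dvd_antisym by metis
  qed
  show "(\<lambda>(x, y). x * y) ` ({x. x dvd a} \<times> {y. y dvd b}) = {d. d dvd a * b}"
  proof (intro equalityI subsetI)
    fix d assume "d \<in> {d. d dvd a * b}"
    then obtain x y where "d = x * y" "x dvd a" "y dvd b" using division_decomp[of d a b] by auto
    then show "d \<in> (\<lambda>(x, y). x * y) ` ({x. x dvd a} \<times> {y. y dvd b})" by auto
  qed (auto intro: mult_dvd_mono)
qed

lemma prime_power_decomposition:
  fixes n :: nat
  assumes "n > 1"
  obtains p k m where "prime p" "n = p ^ k * m" "\<not> p dvd m" "m < n" "m > 0"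
proof -
  obtain p where p: "prime p" "p dvd n" using assms prime_factor_nat[of n] by auto
  obtain m where m: "n = p ^ multiplicity p n * m" "\<not> p dvd m"
    using multiplicity_decompose'[of n p] assms p(1) by (metis not_prime_unit not_less_zero)
  have "m > 0" using m(1) assms by (cases m) auto
  have "m dvd n" using m(1) by (metis dvd_triv_right)
  moreover have "m \<noteq> n" using m(2) p(2) by auto
  ultimately have "m < n" using assms by (metis dvd_imp_le gr_implies_not_zero le_neq_implies_less neq0_conv)
  with p m \<open>m > 0\<close> that show ?thesis by blast
qed

text \<open>
  Bounded partial sums stand in for periodicity with mean zero: they are what the analytic
  arguments use.
\<close>

locale quadratic_character = completely_multiplicative chi for chi :: "nat \<Rightarrow> real" +
  fixes C :: real
  assumes vals: "chi n \<in> {-1, 0, 1}" and bounded_sums: "\<bar>\<Sum>k=1..n. chi k\<bar> \<le> C"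
begin

lemma C_nonneg: "C \<ge> 0"
  using bounded_sums[of 0] by simp

definition divisor_sum :: "nat \<Rightarrow> real" where "divisor_sum n = (\<Sum>d | d dvd n. chi d)"

lemma divisor_sum_mult_coprime:
  assumes "coprime a b"
  shows "divisor_sum (a * b) = divisor_sum a * divisor_sum b"
proof -
  have "divisor_sum (a * b) = (\<Sum>(x, y)\<in>{x. x dvd a} \<times> {y. y dvd b}. chi (x * y))"
    unfolding divisor_sum_def
    by (subst sum.reindex_bij_betw[OF bij_betw_coprime_divisors[OF assms], symmetric]) (simp add: case_prod_unfold)
  also have "\<dots> = divisor_sum a * divisor_sum b"
    by (simp add: divisor_sum_def mult sum_product sum.cartesian_product)
  finally show ?thesis .
qed

lemma chi_power: "chi (n ^ k) = chi n ^ k"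
  by (induction k) (use one in \<open>simp_all add: mult\<close>)

lemma divisor_sum_prime_power:
  assumes "prime p"
  shows "divisor_sum (p ^ k) = (\<Sum>i\<le>k. chi p ^ i)"
proof -
  have eq: "{d. d dvd p ^ k} = (\<lambda>i. p ^ i) ` {..k}"
    using assms divides_primepow[OF assms] by (auto intro: le_imp_power_dvd) (metis atMost_iff image_eqI normalize_nat_def id_apply)
  have "p > 1" using assms prime_gt_1_nat by blast
  then have "inj_on (\<lambda>i. p ^ i) {..k}" by (auto simp: inj_on_def)
  then show ?thesis unfolding divisor_sum_def eq by (subst sum.reindex) (auto simp: chi_power)
qed

lemma divisor_sum_prime_power_nonneg: "prime p \<Longrightarrow> divisor_sum (p ^ k) \<ge> 0"
  and divisor_sum_prime_even_power: "prime p \<Longrightarrow> divisor_sum (p ^ (2 * k)) \<ge> 1"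
proof -
  have alt: "(\<Sum>i\<le>k. (-1::real) ^ i) = (if even k then 1 else 0)" for k
    by (induction k) auto
  have zero: "(\<Sum>i\<le>k. (0::real) ^ i) = 1" for k
    by (induction k) auto
  assume p: "prime p"
  have *: "(\<Sum>i\<le>k. chi p ^ i) \<ge> (if even k then 1 else 0)" for k
    using vals[of p] by (auto simp: alt zero)
  show "divisor_sum (p ^ k) \<ge> 0" unfolding divisor_sum_prime_power[OF p] using *[of k] by (auto split: if_splits)
  show "divisor_sum (p ^ (2 * k)) \<ge> 1" unfolding divisor_sum_prime_power[OF p] using *[of "2 * k"] by simp
qed

text \<open>
  The divisor sums are the coefficients of \<open>\<zeta>(s) L(s)\<close>. They are multiplicative, nonnegative at
  prime powers because \<open>chi p\<close> is \<open>-1\<close>, \<open>0\<close> or \<open>1\<close>, and at least \<open>1\<close> at even powers.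
\<close>

lemma divisor_sum_nonneg: "divisor_sum n \<ge> 0"
proof (induction n rule: less_induct)
  case (less n)
  consider "n = 0" | "n = 1" | "n > 1" by linarith
  then show ?case
  proof cases
    case 3
    then obtain p k m where pk: "prime p" "n = p ^ k * m" "\<not> p dvd m" "m < n"
      by (rule prime_power_decomposition)
    then have "coprime (p ^ k) m" by (simp add: prime_imp_coprime)
    then have "divisor_sum n = divisor_sum (p ^ k) * divisor_sum m" unfolding pk(2) by (rule divisor_sum_mult_coprime)
    then show ?thesis using less.IH[OF pk(4)] divisor_sum_prime_power_nonneg[OF pk(1)] by simp
  qed (use one in \<open>simp_all add: divisor_sum_def\<close>)
qed

lemma divisor_sum_square: "q > 0 \<Longrightarrow> divisor_sum (q ^ 2) \<ge> 1"
proof (induction q rule: less_induct)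
  case (less q)
  consider "q = 1" | "q > 1" using less.prems by linarith
  then show ?case
  proof cases
    case 2
    then obtain p k m where pk: "prime p" "q = p ^ k * m" "\<not> p dvd m" "m < q" "m > 0"
      by (rule prime_power_decomposition)
    then have "coprime (p ^ (2 * k)) (m ^ 2)" by (simp add: prime_imp_coprime)
    moreover have "q ^ 2 = p ^ (2 * k) * m ^ 2"
      unfolding pk(2) by (simp add: power_mult_distrib power_mult[symmetric] mult.commute)
    ultimately have "divisor_sum (q ^ 2) = divisor_sum (p ^ (2 * k)) * divisor_sum (m ^ 2)" using divisor_sum_mult_coprime by simp
    also have "\<dots> \<ge> 1 * 1"
      using less.IH[OF pk(4,5)] divisor_sum_prime_even_power[OF pk(1), of k] by (intro mult_mono) auto
    finally show ?thesis by simp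
  qed (use one in \<open>simp_all add: divisor_sum_def\<close>)
qed

lemma summation_by_parts:
  "(\<Sum>k=1..Suc N. chi k * b k) =
     (\<Sum>k=1..N. (\<Sum>j=1..k. chi j) * (b k - b (Suc k))) + (\<Sum>j=1..Suc N. chi j) * b (Suc N)"
  for b :: "nat \<Rightarrow> real"
  by (induction N) (simp_all add: algebra_simps)

lemma weighted_sum_antimono_le:
  fixes b :: "nat \<Rightarrow> real"
  assumes anti: "\<And>k. k > 0 \<Longrightarrow> b (Suc k) \<le> b k" and nonneg: "\<And>k. k > 0 \<Longrightarrow> b k \<ge> 0"
  shows "\<bar>\<Sum>k=1..N. chi k * b k\<bar> \<le> C * b 1"
proof (cases N)
  case 0
  then show ?thesis using C_nonneg nonneg[of 1] by simp
next
  case (Suc M)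
  have "\<bar>\<Sum>k=1..N. chi k * b k\<bar> \<le>
     \<bar>\<Sum>k=1..M. (\<Sum>j=1..k. chi j) * (b k - b (Suc k))\<bar> + \<bar>(\<Sum>j=1..Suc M. chi j) * b (Suc M)\<bar>"
    unfolding Suc summation_by_parts by (rule abs_triangle_ineq)
  also have "\<dots> \<le> (\<Sum>k=1..M. C * (b k - b (Suc k))) + C * b (Suc M)"
  proof (intro add_mono order_trans[OF sum_abs] sum_mono)
    fix k assume "k \<in> {1..M}"
    then show "\<bar>(\<Sum>j=1..k. chi j) * (b k - b (Suc k))\<bar> \<le> C * (b k - b (Suc k))"
      using anti[of k] bounded_sums[of k] by (simp add: abs_mult mult_right_mono)
  next
    show "\<bar>(\<Sum>j=1..Suc M. chi j) * b (Suc M)\<bar> \<le> C * b (Suc M)"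
      using nonneg[of "Suc M"] bounded_sums[of "Suc M"] unfolding abs_mult by (intro mult_mono) auto
  qed
  also have "(\<Sum>k=1..M. C * (b k - b (Suc k))) = C * (b 1 - b (Suc M))"
    by (induction M) (simp_all add: algebra_simps)
  finally show ?thesis by (simp add: algebra_simps)
qed

lemma ln_weighted_sum_le:
  assumes "N > 0"
  shows "\<bar>\<Sum>k=1..N. chi k * ln (real k)\<bar> \<le> 2 * C * ln (real N)"
proof -
  obtain M where M: "N = Suc M" using assms by (cases N) auto
  have "\<bar>\<Sum>k=1..N. chi k * ln (real k)\<bar> \<le>
     \<bar>\<Sum>k=1..M. (\<Sum>j=1..k. chi j) * (ln (real k) - ln (real (Suc k)))\<bar> + \<bar>(\<Sum>j=1..Suc M. chi j) * ln (real (Suc M))\<bar>"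
    unfolding M summation_by_parts by (rule abs_triangle_ineq)
  also have "\<dots> \<le> (\<Sum>k=1..M. C * (ln (real (Suc k)) - ln (real k))) + C * ln (real (Suc M))"
  proof (intro add_mono order_trans[OF sum_abs] sum_mono)
    fix k assume "k \<in> {1..M}"
    then have "ln (real k) \<le> ln (real (Suc k))" by simp
    then show "\<bar>(\<Sum>j=1..k. chi j) * (ln (real k) - ln (real (Suc k)))\<bar> \<le> C * (ln (real (Suc k)) - ln (real k))"
      unfolding abs_mult using bounded_sums[of k] by (intro mult_mono) auto
  next
    show "\<bar>(\<Sum>j=1..Suc M. chi j) * ln (real (Suc M))\<bar> \<le> C * ln (real (Suc M))"
      using bounded_sums[of "Suc M"] unfolding abs_mult by (intro mult_mono) auto
  qed
  also have "(\<Sum>k=1..M. C * (ln (real (Suc k)) - ln (real k))) = C * ln (real (Suc M))"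
    by (induction M) (simp_all add: algebra_simps)
  finally show ?thesis by (simp add: M)
qed

end

text \<open>
  The arithmetic-geometric mean inequality for the terms \<open>i\<close> and \<open>n - 1 - i\<close>.
\<close>

lemma geometric_sum_ge:
  fixes y :: real
  assumes "y \<ge> 0"
  shows "real n * y ^ (n - 1) \<le> (\<Sum>i<n. y ^ (2 * i))"
proof -
  have "2 * (\<Sum>i<n. y ^ (2 * i)) = (\<Sum>i<n. y ^ (2 * i)) + (\<Sum>i<n. y ^ (2 * (n - Suc i)))"
    using sum.nat_diff_reindex[of "\<lambda>i. y ^ (2 * i)" n] by simp
  also have "\<dots> = (\<Sum>i<n. y ^ (2 * i) + y ^ (2 * (n - Suc i)))" by (simp add: sum.distrib)
  also have "\<dots> \<ge> (\<Sum>i<n. 2 * y ^ (n - 1))"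
  proof (rule sum_mono)
    fix i assume "i \<in> {..<n}"
    then have "2 * y ^ (n - 1) = 2 * y ^ i * y ^ (n - Suc i)" by (simp flip: power_add)
    also have "\<dots> \<le> (y ^ i)\<^sup>2 + (y ^ (n - Suc i))\<^sup>2" by (rule sum_squares_bound)
    also have "\<dots> = y ^ (2 * i) + y ^ (2 * (n - Suc i))"
      by (simp only: power_mult[symmetric] mult.commute)
    finally show "2 * y ^ (n - 1) \<le> y ^ (2 * i) + y ^ (2 * (n - Suc i))" .
  qed
  finally show ?thesis by simp
qed

text \<open>
  The difference between \<open>1 / (n (1 - x))\<close> and the Lambert coefficient \<open>x\<^sup>n / (1 - x\<^sup>n)\<close>, two
  quantities that agree to first order as \<open>x\<close> tends to \<open>1\<close>.
\<close>

definition Lambert_weight :: "real \<Rightarrow> nat \<Rightarrow> real" where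
  "Lambert_weight x n = 1 / (real n * (1 - x)) - x ^ n / (1 - x ^ n)"

text \<open>
  With \<open>g n = 1 + x + \<dots> + x\<^sup>n\<^sup>-\<^sup>1\<close>, monotonicity amounts to \<open>n (n + 1) x\<^sup>n \<le> g n g (n + 1)\<close>. The mean
  inequality in powers of \<open>y = sqrt x\<close> gives this with \<open>y\<^sup>2\<^sup>n\<^sup>-\<^sup>1\<close> in place of \<open>x\<^sup>n = y\<^sup>2\<^sup>n\<close>.
\<close>

lemma Lambert_weight_props:
  assumes x: "0 < x" "x < 1" and n: "n > 0"
  shows "Lambert_weight x (Suc n) \<le> Lambert_weight x n" "Lambert_weight x n \<ge> 0"
proof -
  define g where "g = (\<lambda>n. \<Sum>i<n. x ^ i)"
  have geo: "1 - x ^ n = (1 - x) * g n" for n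
    using sum_gp_strict[of x n] x by (simp add: g_def field_simps)
  have gpos: "g n > 0" if "n > 0" for n
    using that x unfolding g_def by (intro sum_pos) auto
  define y where "y = sqrt x"
  have y: "0 < y" "y < 1" "y ^ 2 = x" using x by (auto simp: y_def)
  have gge: "real n * y ^ (n - 1) \<le> g n" for n
    using geometric_sum_ge[of y n] y by (simp add: g_def power_mult)
  have "real n * real (Suc n) * x ^ n \<le> (real n * y ^ (n - 1)) * (real (Suc n) * y ^ (Suc n - 1))"
  proof -
    have "x ^ n = y ^ (2 * n)" using y by (simp add: power_mult)
    also have "\<dots> \<le> y ^ (n - 1 + n)" using y by (intro power_decreasing) auto
    finally have "real n * real (Suc n) * x ^ n \<le> real n * real (Suc n) * y ^ (n - 1 + n)"
      by (intro mult_left_mono) auto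
    then show ?thesis by (simp add: power_add mult_ac)
  qed
  also have "\<dots> \<le> g n * g (Suc n)"
    using y gpos[OF n] by (intro mult_mono gge) auto
  finally have main: "real n * real (Suc n) * x ^ n \<le> g n * g (Suc n)" .
  have "x ^ n / (1 - x ^ n) - x ^ Suc n / (1 - x ^ Suc n) = (x ^ n - x ^ Suc n) / ((1 - x ^ n) * (1 - x ^ Suc n))"
  proof -
    have "1 - x ^ n \<noteq> 0" "1 - x ^ Suc n \<noteq> 0"
      unfolding geo using gpos[OF n] gpos[of "Suc n"] x by auto
    then show ?thesis by (simp add: diff_frac_eq algebra_simps)
  qed
  also have "\<dots> = x ^ n / ((1 - x) * (g n * g (Suc n)))"
  proof -
    have "x ^ n - x ^ Suc n = (1 - x) * x ^ n" by (simp add: algebra_simps)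
    then show ?thesis unfolding geo using x by simp
  qed
  also have "\<dots> \<le> 1 / ((1 - x) * (real n * real (Suc n)))"
    using main x n gpos[of n] gpos[of "Suc n"]
    by (simp add: divide_simps mult_ac) 
  also have "\<dots> = 1 / (real n * (1 - x)) - 1 / (real (Suc n) * (1 - x))"
  proof -
    have "1 / (u * (a * (a + 1))) = 1 / (a * u) - 1 / ((a + 1) * u)" if "u > 0" "a > 0" for u a :: real
    proof -
      have "1 / (a * (a + 1)) = 1 / a - 1 / (a + 1)" using that by (simp add: field_simps)
      then have "1 / (a * (a + 1)) / u = (1 / a - 1 / (a + 1)) / u" by (simp only:)
      then show ?thesis by (simp add: diff_divide_distrib mult_ac)
    qed
    from this[of "1 - x" "real n"] show ?thesis using x n by (simp add: add.commute)
  qed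
  finally show "Lambert_weight x (Suc n) \<le> Lambert_weight x n"
    by (simp add: Lambert_weight_def)
  have "real n * x ^ n \<le> (\<Sum>i<n. x ^ i)"
  proof -
    have "(\<Sum>i<n. x ^ n) \<le> (\<Sum>i<n. x ^ i)"
      using x by (intro sum_mono power_decreasing) auto
    then show ?thesis by simp
  qed
  then have "real n * x ^ n \<le> g n" by (simp add: g_def)
  then have "x ^ n / (1 - x ^ n) \<le> 1 / (real n * (1 - x))"
    unfolding geo using x n gpos[OF n] by (simp add: divide_simps mult_ac)
  then show "Lambert_weight x n \<ge> 0" by (simp add: Lambert_weight_def)
qed

context quadratic_character
begin

text \<open>
  Expanding \<open>x\<^sup>n / (1 - x\<^sup>n)\<close> as a geometric series and collecting equal powers of \<open>x\<close>.
\<close>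

lemma Lambert_series:
  assumes x: "0 < x" "x < 1"
  shows "\<exists>S. (\<lambda>n. chi n * (x ^ n / (1 - x ^ n))) sums S \<and> (\<lambda>n. divisor_sum n * x ^ n) sums S"
proof -
  let ?N = "{1..} :: nat set"
  let ?h = "\<lambda>(d, k). chi d * x ^ (d * k)"
  have inner: "((\<lambda>k. x ^ (d * k)) has_sum (x ^ d / (1 - x ^ d))) ?N" if d: "d \<in> ?N" for d
  proof -
    have xd: "0 < x ^ d" "x ^ d < 1" using x d by (auto simp: power_less_one_iff)
    have "(\<lambda>k. (x ^ d) ^ k) sums (1 / (1 - x ^ d))" using xd by (intro geometric_sums) auto
    then have "(\<lambda>k. (x ^ d) ^ Suc k) sums (1 / (1 - x ^ d) - 1)"
      by (subst sums_Suc_iff) simp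
    moreover have "1 / (1 - x ^ d) - 1 = x ^ d / (1 - x ^ d)" using xd by (simp add: field_simps)
    ultimately have "(\<lambda>k. if k = 0 then 0 else x ^ (d * k)) sums (x ^ d / (1 - x ^ d))"
      using sums_Suc_iff[of "\<lambda>k. if k = 0 then 0 else x ^ (d * k)" "x ^ d / (1 - x ^ d)"]
      by (simp add: power_mult power_add)
    then have "((\<lambda>k. if k = 0 then 0 else x ^ (d * k)) has_sum (x ^ d / (1 - x ^ d))) UNIV"
      using x by (intro norm_summable_imp_has_sum) (auto simp: sums_iff cong: if_cong)
    then have "((\<lambda>k. if k = 0 then 0 else x ^ (d * k)) has_sum (x ^ d / (1 - x ^ d))) ?N"
      by (subst has_sum_nat_iff_zero) auto
    then show ?thesis by (rule has_sum_cong[THEN iffD1, rotated]) auto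
  qed
  have inner': "((\<lambda>k. ?h (d, k)) has_sum (chi d * (x ^ d / (1 - x ^ d)))) ?N" if "d \<in> ?N" for d
    using has_sum_cmult_right[OF inner[OF that], of "chi d"] by (simp only: prod.case)
  have inner_norm: "((\<lambda>k. norm (?h (d, k))) has_sum (\<bar>chi d\<bar> * (x ^ d / (1 - x ^ d)))) ?N" if "d \<in> ?N" for d
    using has_sum_cmult_right[OF inner[OF that], of "\<bar>chi d\<bar>"] x by (simp add: abs_mult)
  have outer: "(\<lambda>d. \<bar>chi d\<bar> * (x ^ d / (1 - x ^ d))) summable_on ?N"
  proof (rule summable_on_comparison_test)
    have "summable (\<lambda>d. x ^ d / (1 - x))" using x by (intro summable_divide summable_geometric) auto
    then have "(\<lambda>d. x ^ d / (1 - x)) summable_on UNIV"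
      using x by (intro norm_summable_imp_summable_on) simp
    then show "(\<lambda>d. x ^ d / (1 - x)) summable_on ?N" by (rule summable_on_subset_banach) auto
    fix d assume d: "d \<in> ?N"
    have xd: "x ^ d \<le> x ^ 1" using x d by (intro power_decreasing) auto
    then have "x ^ d / (1 - x ^ d) \<le> x ^ d / (1 - x)" using x by (intro divide_left_mono) auto
    then show "\<bar>chi d\<bar> * (x ^ d / (1 - x ^ d)) \<le> x ^ d / (1 - x)"
      using abs_le[of d] x xd by (intro order_trans[OF mult_left_le_one_le]) auto
    show "0 \<le> \<bar>chi d\<bar> * (x ^ d / (1 - x ^ d))" using x xd by auto
  qed
  have abs: "(\<lambda>p. norm (?h p)) summable_on (?N \<times> ?N)"
  proof (rule Infinite_Sum.abs_summable_on_Sigma_iff[THEN iffD2], intro conjI ballI)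
    fix d assume "d \<in> ?N"
    then show "(\<lambda>k. norm (?h (d, k))) summable_on ?N" using inner_norm summable_on_def by blast
  next
    have "infsum (\<lambda>k. norm (?h (d, k))) ?N = \<bar>chi d\<bar> * (x ^ d / (1 - x ^ d))" if "d \<in> ?N" for d
      using inner_norm[OF that] infsumI by blast
    then have "(\<lambda>d. norm (infsum (\<lambda>k. norm (?h (d, k))) ?N)) summable_on ?N \<longleftrightarrow>
       (\<lambda>d. norm (\<bar>chi d\<bar> * (x ^ d / (1 - x ^ d)))) summable_on ?N"
      by (intro summable_on_cong) (simp only:)
    moreover have "(\<lambda>d. norm (\<bar>chi d\<bar> * (x ^ d / (1 - x ^ d)))) summable_on ?N \<longleftrightarrow>
       (\<lambda>d. \<bar>chi d\<bar> * (x ^ d / (1 - x ^ d))) summable_on ?N"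
      by (intro summable_on_cong) (use x in \<open>auto simp: abs_mult power_le_one\<close>)
    ultimately show "(\<lambda>d. norm (infsum (\<lambda>k. norm (?h (d, k))) ?N)) summable_on ?N"
      using outer by (simp only:)
  qed
  obtain S where S: "(?h has_sum S) (?N \<times> ?N)"
    using abs_summable_summable[OF abs] summable_on_def by blast
  have "((\<lambda>d. chi d * (x ^ d / (1 - x ^ d))) has_sum S) ?N"
    by (rule has_sum_SigmaD[OF S inner'])
  then have 1: "((\<lambda>d. chi d * (x ^ d / (1 - x ^ d))) has_sum S) UNIV"
    by (subst (asm) has_sum_nat_iff_zero) auto
  have "((\<lambda>n. \<Sum>d | d dvd n. ?h (d, n div d)) has_sum S) ?N" by (rule has_sum_divisors[OF S])
  moreover have "(\<Sum>d | d dvd n. ?h (d, n div d)) = divisor_sum n * x ^ n" for n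
    by (auto simp: divisor_sum_def sum_distrib_right intro!: sum.cong)
  ultimately have "((\<lambda>n. divisor_sum n * x ^ n) has_sum S) ?N" by (simp only:)
  then have "((\<lambda>n. divisor_sum n * x ^ n) has_sum S) UNIV"
    by (subst (asm) has_sum_nat_iff_zero) (auto simp: divisor_sum_def)
  with 1 show ?thesis using has_sum_imp_sums by blast
qed

text \<open>
  Monsky's argument. If \<open>l = 0\<close>, the Lambert series equals minus the sum of \<open>chi n\<close> against the
  decreasing weights \<open>Lambert_weight x n\<close>, so it is bounded by \<open>C\<close> for all \<open>x < 1\<close>. As a power
  series it has nonnegative coefficients that are at least \<open>1\<close> at squares, so it is unbounded
  as \<open>x\<close> tends to \<open>1\<close>.
\<close>

theorem L_one_nonzero:
  assumes "(\<lambda>n. chi n / real n) sums l"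
  shows "l \<noteq> 0"
proof
  assume "l = 0"
  obtain K :: nat where K: "real K > 2 * C" "K > 0"
    using reals_Archimedean2[of "max 0 (2 * C)"] by (metis max_less_iff_conj of_nat_0_less_iff)
  \<comment> \<open>With this \<open>x\<close> each of the \<open>K\<close> squares up to \<open>K\<^sup>2\<close> contributes at least \<open>1 / 2\<close>.\<close>
  define x where "x = (1/2::real) powr (1 / real (K\<^sup>2))"
  have x0: "0 < x" by (simp add: x_def)
  have xK: "x ^ K\<^sup>2 = 1/2"
    unfolding x_def using K by (subst powr_realpow[symmetric]) (auto simp: powr_powr)
  have x1: "x < 1"
  proof (rule ccontr)
    assume "\<not> x < 1"
    then have "1 \<le> x ^ K\<^sup>2" by (intro one_le_power) auto
    with xK show False by simp
  qed
  obtain S where S: "(\<lambda>n. chi n * (x ^ n / (1 - x ^ n))) sums S" "(\<lambda>n. divisor_sum n * x ^ n) sums S"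
    using Lambert_series[OF x0 x1] by blast
  have "(\<lambda>n. chi n / real n / (1 - x) - chi n * (x ^ n / (1 - x ^ n))) sums (l / (1 - x) - S)"
    by (intro sums_diff sums_divide assms S(1))
  moreover have "chi n / real n / (1 - x) - chi n * (x ^ n / (1 - x ^ n)) = chi n * Lambert_weight x n" for n
    by (simp add: Lambert_weight_def right_diff_distrib)
  ultimately have "(\<lambda>n. chi n * Lambert_weight x n) sums (- S)" using \<open>l = 0\<close> by simp
  then have lim: "(\<lambda>N. \<Sum>n\<le>N. chi n * Lambert_weight x n) \<longlonglongrightarrow> - S" by (simp add: sums_def_le)
  have "(\<Sum>n\<le>N. chi n * Lambert_weight x n) = (\<Sum>n=1..N. chi n * Lambert_weight x n)" for N
    by (rule sum.mono_neutral_right) (auto simp: Lambert_weight_def not_le)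
  moreover have "\<bar>\<Sum>n=1..N. chi n * Lambert_weight x n\<bar> \<le> C * Lambert_weight x 1" for N
    by (intro weighted_sum_antimono_le Lambert_weight_props x0 x1)
  moreover have "Lambert_weight x 1 = 1" using x1 by (simp add: Lambert_weight_def diff_divide_distrib[symmetric])
  ultimately have le: "\<bar>\<Sum>n\<le>N. chi n * Lambert_weight x n\<bar> \<le> C" for N by simp
  have "- C \<le> - S"
    by (rule tendsto_lowerbound[OF lim]) (use le in \<open>auto intro!: always_eventually simp: abs_le_iff minus_le_iff\<close>)
  moreover have "real K / 2 \<le> S"
  proof -
    have "real K / 2 = (\<Sum>k=1..K. x ^ K\<^sup>2)" by (simp add: xK)
    also have "\<dots> \<le> (\<Sum>k=1..K. divisor_sum (k\<^sup>2) * x ^ k\<^sup>2)"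
    proof (rule sum_mono)
      fix k assume k: "k \<in> {1..K}"
      have "x ^ K\<^sup>2 \<le> x ^ k\<^sup>2" using k x0 x1 by (intro power_decreasing power_mono) auto
      also have "\<dots> \<le> divisor_sum (k\<^sup>2) * x ^ k\<^sup>2" using divisor_sum_square[of k] k x0 by simp
      finally show "x ^ K\<^sup>2 \<le> divisor_sum (k\<^sup>2) * x ^ k\<^sup>2" .
    qed
    also have "\<dots> = (\<Sum>n\<in>(\<lambda>k. k\<^sup>2) ` {1..K}. divisor_sum n * x ^ n)"
      by (subst sum.reindex) (auto simp: inj_on_def)
    also have "\<dots> \<le> (\<Sum>n. divisor_sum n * x ^ n)"
      using S(2) x0 divisor_sum_nonneg by (intro sum_le_suminf) (auto simp: sums_iff)
    also have "\<dots> = S" using S(2) by (simp add: sums_iff)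
    finally show ?thesis .
  qed
  ultimately show False using K by linarith
qed

text \<open>
  Newman's theorem applied to \<open>1 / L (1 + z)\<close>, the two non-vanishing results providing its
  holomorphy on a neighbourhood of the closed half-plane.
\<close>

theorem moebius_mu_series_summable: "summable (\<lambda>n. moebius_mu n * chi n / real n)"
proof -
  obtain L where L: "L holomorphic_on {s. Re s > 0}"
    "\<And>s::complex. Re s > 0 \<Longrightarrow> (\<lambda>n. of_real (chi n) * of_nat n powr (-s)) sums L s"
    using Dirichlet_series_bounded_sums[OF bounded_sums] by blast
  have L': "(\<lambda>n. of_real (chi n) * of_nat n powr (-s)) sums L s" if "Re s > 1" for s :: complex
    using L(2) that by simp
  have "L s \<noteq> 0" if s: "Re s \<ge> 1" for s
  proof -
    consider "Re s > 1" | "Re s = 1" "Im s \<noteq> 0" | "s = 1"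
      using s by (force simp: complex_eq_iff)
    then show ?thesis
    proof cases
      case 1
      then show ?thesis using inverse_series(1)[of L s] L' by simp
    next
      case 2
      then have "s = Complex 1 (Im s)" by (simp add: complex_eq_iff)
      then show ?thesis using nonzero_on_line[of L "Im s"] L(1) L' 2 by metis
    next
      case 3
      have "(\<lambda>n. of_real (chi n) * of_nat n powr (-1)) sums L 1" using L(2)[of 1] by simp
      moreover have "of_real (chi n) * of_nat n powr (-1) = (of_real (chi n / real n) :: complex)" for n
        by (cases "n = 0") (simp_all add: powr_minus_divide)
      ultimately have "(\<lambda>n. of_real (chi n / real n) :: complex) sums L 1" by (simp only:)
      then have *: "(\<lambda>n. chi n / real n) sums Re (L 1)" using sums_Re by fastforce
      have "Re (L 1) \<noteq> 0" by (rule L_one_nonzero[OF *])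
      then show ?thesis using 3 by auto
    qed
  qed
  define U where "U = {z. Re z > -1} \<inter> (\<lambda>z. L (1 + z)) -` (- {0})"
  have hol: "(\<lambda>z. L (1 + z)) holomorphic_on {z. Re z > -1}"
    by (rule holomorphic_on_compose_gen[of "\<lambda>z. 1 + z" _ L "{s. Re s > 0}", unfolded o_def])
       (auto intro!: holomorphic_intros L(1))
  have "open U" unfolding U_def
    by (intro continuous_open_preimage holomorphic_on_imp_continuous_on hol open_halfspace_Re_gt) auto
  moreover have "{z. Re z \<ge> 0} \<subseteq> U"
    using \<open>\<And>s. Re s \<ge> 1 \<Longrightarrow> L s \<noteq> 0\<close> by (auto simp: U_def)
  moreover have "(\<lambda>z. 1 / L (1 + z)) holomorphic_on U"
    using hol by (intro holomorphic_on_divide holomorphic_on_const) (auto simp: U_def intro: holomorphic_on_subset)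
  moreover have "(\<lambda>n. of_real (moebius_mu n * chi n) * of_nat n powr (-1-z)) sums (1 / L (1 + z))" if "Re z > 0" for z
    using inverse_series(2)[of L "1 + z"] L' that by simp
  moreover have "norm (of_real (moebius_mu n * chi n) :: complex) \<le> 1" for n
    using abs_le[of n] abs_moebius_mu_le[of n] by (simp add: norm_mult mult_le_one)
  ultimately have "(\<lambda>n. of_real (moebius_mu n * chi n) / of_nat n) sums (1 / L (1 + 0))"
    by (intro Newman_Dirichlet_series[of "\<lambda>n. of_real (moebius_mu n * chi n)" U "\<lambda>z. 1 / L (1 + z)"])
  then have "(\<lambda>n. of_real (moebius_mu n * chi n / real n) :: complex) sums (1 / L (1 + 0))" by simp
  then have "(\<lambda>n. Re (of_real (moebius_mu n * chi n / real n))) sums Re (1 / L (1 + 0))" by (rule sums_Re)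
  then show ?thesis by (simp add: sums_iff)
qed

end

section \<open>Mean values: from the Moebius function to the von Mangoldt function\<close>

lemma tendsto_partial_mean:
  fixes T :: "nat \<Rightarrow> real"
  assumes "T \<longlonglongrightarrow> l"
  shows "(\<lambda>N. (\<Sum>n<N. T n) / real N) \<longlonglongrightarrow> l"
proof (rule LIMSEQ_I)
  fix e :: real assume e: "e > 0"
  obtain n0 where n0: "\<And>n. n \<ge> n0 \<Longrightarrow> \<bar>T n - l\<bar> < e / 2"
    using LIMSEQ_D[OF assms, of "e / 2"] e by auto
  define B where "B = (\<Sum>n<n0. \<bar>T n - l\<bar>)"
  have B: "B \<ge> 0" by (simp add: B_def sum_nonneg)
  obtain N1 :: nat where N1: "real N1 > 2 * B / e" using reals_Archimedean2 by blast
  show "\<exists>no. \<forall>N\<ge>no. norm ((\<Sum>n<N. T n) / real N - l) < e"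
  proof (intro exI allI impI)
    fix N assume N: "N \<ge> max (Suc n0) (Suc N1)"
    have "\<bar>(\<Sum>n<N. T n) - real N * l\<bar> = \<bar>\<Sum>n<N. T n - l\<bar>" by (simp add: sum_subtractf)
    also have "\<dots> \<le> (\<Sum>n<N. \<bar>T n - l\<bar>)" by (rule sum_abs)
    also have "\<dots> = B + (\<Sum>n=n0..<N. \<bar>T n - l\<bar>)"
      unfolding B_def using N by (subst lessThan_atLeast0, subst sum.atLeastLessThan_concat[of 0 n0 N, symmetric]) (auto simp: lessThan_atLeast0)
    also have "(\<Sum>n=n0..<N. \<bar>T n - l\<bar>) \<le> (\<Sum>n=n0..<N. e / 2)"
      by (intro sum_mono less_imp_le[OF n0]) auto
    also have "\<dots> \<le> real N * (e / 2)" using e by (simp add: mult_right_mono)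
    finally have "\<bar>(\<Sum>n<N. T n) - real N * l\<bar> \<le> B + real N * (e / 2)" by simp
    also have "B < real N * (e / 2)"
    proof -
      have "2 * B / e < real N" using N1 N by linarith
      then show ?thesis using e by (simp add: field_simps)
    qed
    finally have "\<bar>(\<Sum>n<N. T n) - real N * l\<bar> < real N * e" by (simp add: mult.commute)
    moreover have "N > 0" using N by simp
    moreover have "(\<Sum>n<N. T n) / real N - l = ((\<Sum>n<N. T n) - real N * l) / real N"
      using \<open>N > 0\<close> by (simp add: field_simps)
    ultimately show "norm ((\<Sum>n<N. T n) / real N - l) < e"
      by (simp add: abs_divide divide_less_eq mult.commute)
  qed
qed

text \<open>
  If \<open>T N\<close> are the partial sums of \<open>\<Sum> b n / n\<close>, then \<open>\<Sum>\<^sub>n\<^sub>\<le>\<^sub>N b n = N T N - \<Sum>\<^sub>n\<^sub><\<^sub>N T n\<close>, and the mean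
  of \<open>T\<close> has the same limit as \<open>T\<close>.
\<close>

lemma Kronecker_mean:
  fixes b :: "nat \<Rightarrow> real"
  assumes "summable (\<lambda>n. b n / real n)"
  shows "(\<lambda>N. (\<Sum>n=1..N. b n) / real N) \<longlonglongrightarrow> 0"
proof -
  define T where "T = (\<lambda>N. \<Sum>n\<le>N. b n / real n)"
  obtain l where l: "T \<longlonglongrightarrow> l"
    using assms unfolding summable_def sums_def_le T_def by blast
  have eq: "(\<Sum>n=1..N. b n) = real N * T N - (\<Sum>n<N. T n)" for N
  proof (induction N)
    case (Suc N)
    have "real (Suc N) * T (Suc N) = real (Suc N) * T N + b (Suc N)"
      by (simp add: T_def distrib_left del: of_nat_Suc)
    then show ?case using Suc.IH by (simp add: algebra_simps)
  qed (simp add: T_def)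
  have "(\<lambda>N. T N - (\<Sum>n<N. T n) / real N) \<longlonglongrightarrow> l - l"
    by (intro tendsto_diff l tendsto_partial_mean)
  moreover have "\<forall>\<^sub>F N in sequentially. T N - (\<Sum>n<N. T n) / real N = (\<Sum>n=1..N. b n) / real N"
    using eventually_gt_at_top[of 0] by eventually_elim (unfold eq, simp add: field_simps)
  ultimately have "(\<lambda>N. (\<Sum>n=1..N. b n) / real N) \<longlonglongrightarrow> l - l"
    by (rule Lim_transform_eventually)
  then show ?thesis by simp
qed

lemma sum_divisors_upto:
  fixes g :: "nat \<Rightarrow> nat \<Rightarrow> real"
  shows "(\<Sum>n=1..N. \<Sum>d | d dvd n. g d (n div d)) = (\<Sum>d=1..N. \<Sum>k=1..N div d. g d k)"
proof -
  have "(\<Sum>n=1..N. \<Sum>d | d dvd n. g d (n div d)) = (\<Sum>(n, d)\<in>Sigma {1..N} (\<lambda>n. {d. d dvd n}). g d (n div d))"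
    by (rule sum.Sigma) auto
  also have "\<dots> = (\<Sum>(d, k)\<in>Sigma {1..N} (\<lambda>d. {1..N div d}). g d k)"
  proof (rule sum.reindex_bij_witness[of _ "\<lambda>(d, k). (d * k, d)" "\<lambda>(n, d). (d, n div d)"])
    fix x assume "x \<in> Sigma {1..N} (\<lambda>n. {d. d dvd n})"
    then obtain n d where x: "x = (n, d)" "1 \<le> n" "n \<le> N" "d dvd n" by auto
    then have "d > 0" "d \<le> n" using dvd_imp_le by (auto intro: dvd_pos_nat)
    then show "(case x of (n, d) \<Rightarrow> (d, n div d)) \<in> Sigma {1..N} (\<lambda>d. {1..N div d})"
      using x by (auto simp: div_le_mono Suc_le_eq div_greater_zero_iff)
  next
    fix x assume "x \<in> Sigma {1..N} (\<lambda>d. {1..N div d})"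
    then obtain d k where x: "x = (d, k)" "1 \<le> d" "d \<le> N" "1 \<le> k" "k \<le> N div d" by auto
    then have "k * d \<le> N" by (simp add: less_eq_div_iff_mult_less_eq)
    then show "(case x of (d, k) \<Rightarrow> (d * k, d)) \<in> Sigma {1..N} (\<lambda>n. {d. d dvd n})"
      using x by (auto simp: mult.commute)
  qed (auto simp: Suc_le_eq)
  also have "\<dots> = (\<Sum>d=1..N. \<Sum>k=1..N div d. g d k)"
    by (rule sum.Sigma[symmetric]) auto
  finally show ?thesis .
qed

lemma sum_divisors_swap:
  fixes g :: "nat \<Rightarrow> nat \<Rightarrow> real"
  assumes "n > 0"
  shows "(\<Sum>d | d dvd n. \<Sum>e | e dvd n div d. g d e) = (\<Sum>e | e dvd n. \<Sum>d | d dvd n div e. g d e)"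
proof -
  have fin: "finite {d. d dvd n div e}" if "e dvd n" for e
    using that assms by (auto elim!: dvdE)
  have iff: "d dvd n \<and> e dvd n div d \<longleftrightarrow> e dvd n \<and> d dvd n div e" for d e
    by (metis assms dvd_div_iff_mult dvd_mult_left dvd_mult_right gr_implies_not_zero mult.commute dvd_0_left_iff)
  have "(\<Sum>d | d dvd n. \<Sum>e | e dvd n div d. g d e) = (\<Sum>(d, e)\<in>Sigma {d. d dvd n} (\<lambda>d. {e. e dvd n div d}). g d e)"
    using assms fin by (intro sum.Sigma) auto
  also have "\<dots> = (\<Sum>(e, d)\<in>Sigma {e. e dvd n} (\<lambda>e. {d. d dvd n div e}). g d e)"
    by (rule sum.reindex_bij_witness[of _ "\<lambda>(e, d). (d, e)" "\<lambda>(d, e). (e, d)"])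
       (auto dest: iff[THEN iffD1, OF conjI])
  also have "\<dots> = (\<Sum>e | e dvd n. \<Sum>d | d dvd n div e. g d e)"
    using assms fin by (intro sum.Sigma[symmetric]) auto
  finally show ?thesis .
qed

text \<open>
  Moebius inversion of \<open>ln n = \<Sum>\<^sub>d\<^sub>|\<^sub>n \<Lambda> d\<close>.
\<close>

lemma moebius_mu_ln_sum:
  assumes n: "n > 0"
  shows "(\<Sum>d | d dvd n. moebius_mu d * ln (real (n div d))) = mangoldt n"
proof -
  have pos: "n div d > 0" if "d dvd n" for d using that n by (auto elim!: dvdE)
  have "(\<Sum>d | d dvd n. moebius_mu d * ln (real (n div d))) =
     (\<Sum>d | d dvd n. \<Sum>e | e dvd n div d. moebius_mu d * mangoldt e)"
  proof (intro sum.cong refl)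
    fix d assume "d \<in> {d. d dvd n}"
    then have "ln (real (n div d)) = (\<Sum>e | e dvd n div d. mangoldt e)"
      using mangoldt_sum[of "n div d", where ?'a = real] pos[of d] by simp
    then show "moebius_mu d * ln (real (n div d)) = (\<Sum>e | e dvd n div d. moebius_mu d * mangoldt e)"
      by (simp add: sum_distrib_left)
  qed
  also have "\<dots> = (\<Sum>e | e dvd n. \<Sum>d | d dvd n div e. moebius_mu d * mangoldt e)"
    by (rule sum_divisors_swap[OF n])
  also have "\<dots> = (\<Sum>e | e dvd n. if e = n then mangoldt e else 0)"
  proof (intro sum.cong refl)
    fix e assume e: "e \<in> {e. e dvd n}"
    have "(\<Sum>d | d dvd n div e. moebius_mu d * mangoldt e) = (if n div e = 1 then 1 else 0) * mangoldt e"
      using moebius_mu_sum_divisors[of "n div e"] pos[of e] e by (simp flip: sum_distrib_right)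
    also have "n div e = 1 \<longleftrightarrow> e = n" using e n by (auto elim!: dvdE)
    finally show "(\<Sum>d | d dvd n div e. moebius_mu d * mangoldt e) = (if e = n then mangoldt e else 0)" by simp
  qed
  also have "\<dots> = mangoldt n" using n by (subst sum.delta) auto
  finally show ?thesis .
qed

lemma ln_le_two_sqrt:
  assumes "x \<ge> 1"
  shows "ln x \<le> 2 * sqrt x"
  using ln_powr_bound[OF assms, of "1/2"] assms by (simp add: powr_half_sqrt)

lemma sum_sqrt_quotient_le:
  assumes "y \<ge> 0"
  shows "(\<Sum>d=1..D. sqrt (y / real d)) \<le> 3 * sqrt y * sqrt (real D)"
proof (cases "D = 0")
  case False
  have "(\<Sum>d=1..D. sqrt (y / real d)) = sqrt y * (\<Sum>d=1..D. real d powr (1/2 - 1))"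
    unfolding sum_distrib_left
  proof (intro sum.cong refl)
    fix d :: nat assume "d \<in> {1..D}"
    have "real d powr (1/2 - 1) = real d powr (- (1/2))" by simp
    also have "\<dots> = 1 / sqrt (real d)" by (simp add: powr_minus_divide powr_half_sqrt)
    finally show "sqrt (y / real d) = sqrt y * real d powr (1/2 - 1)" by (simp add: real_sqrt_divide)
  qed
  also have "\<dots> \<le> sqrt y * (real D powr (1/2) * (1 / (1/2) + 1 / real D))"
    using False by (intro mult_left_mono sum_powr_le) (use assms in auto)
  also have "\<dots> \<le> sqrt y * (sqrt (real D) * 3)"
  proof (intro mult_left_mono)
    show "real D powr (1/2) * (1 / (1/2) + 1 / real D) \<le> sqrt (real D) * 3"
      using False by (simp add: powr_half_sqrt) 
  qed (use assms in auto)
  finally show ?thesis by (simp add: mult_ac)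
qed simp

context quadratic_character
begin

definition moebius_twist_sum :: "nat \<Rightarrow> real" where
  "moebius_twist_sum n = (\<Sum>d=1..n. moebius_mu d * chi d)"

definition ln_twist_sum :: "nat \<Rightarrow> real" where
  "ln_twist_sum n = (\<Sum>k=1..n. chi k * ln (real k))"

lemma moebius_twist_sum_small: "(\<lambda>N. moebius_twist_sum N / real N) \<longlonglongrightarrow> 0"
  using Kronecker_mean[OF moebius_mu_series_summable] by (simp add: moebius_twist_sum_def)

lemma mangoldt_twist_sum_eq:
  "(\<Sum>n=1..N. chi n * mangoldt n) = (\<Sum>d=1..N. moebius_mu d * chi d * ln_twist_sum (N div d))"
proof -
  have "(\<Sum>n=1..N. chi n * mangoldt n) =
     (\<Sum>n=1..N. \<Sum>d | d dvd n. moebius_mu d * chi d * (chi (n div d) * ln (real (n div d))))"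
  proof (intro sum.cong refl)
    fix n assume "n \<in> {1..N}"
    then have "chi n * mangoldt n = (\<Sum>d | d dvd n. chi n * (moebius_mu d * ln (real (n div d))))"
      using moebius_mu_ln_sum[of n] by (simp flip: sum_distrib_left)
    also have "\<dots> = (\<Sum>d | d dvd n. moebius_mu d * chi d * (chi (n div d) * ln (real (n div d))))"
      by (intro sum.cong refl) (simp add: mult_div[symmetric])
    finally show "chi n * mangoldt n = (\<Sum>d | d dvd n. moebius_mu d * chi d * (chi (n div d) * ln (real (n div d))))" .
  qed
  also have "\<dots> = (\<Sum>d=1..N. \<Sum>k=1..N div d. moebius_mu d * chi d * (chi k * ln (real k)))"
    by (rule sum_divisors_upto)
  finally show ?thesis by (simp add: ln_twist_sum_def sum_distrib_left)
qed

text \<open>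
  The part \<open>k \<le> K\<close> of the sum over all pairs with \<open>d k \<le> N\<close>, summed over \<open>d\<close> first. For fixed \<open>K\<close> it
  involves the Moebius sums at finitely many arguments \<open>N div k\<close> of the size of \<open>N\<close>.
\<close>

lemma hyperbola_part:
  "(\<Sum>d=1..N. moebius_mu d * chi d * ln_twist_sum (min K (N div d)))
     = (\<Sum>k=1..K. chi k * ln (real k) * moebius_twist_sum (N div k))"
proof -
  have 1: "ln_twist_sum (min K m) = (\<Sum>k=1..K. if k \<le> m then chi k * ln (real k) else 0)" for m
  proof -
    have "(\<Sum>k=1..K. if k \<le> m then chi k * ln (real k) else 0) = (\<Sum>k \<in> {k\<in>{1..K}. k \<le> m}. chi k * ln (real k))"
      by (rule sum.inter_filter[symmetric]) simp
    also have "{k\<in>{1..K}. k \<le> m} = {1..min K m}" by auto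
    finally show ?thesis by (simp add: ln_twist_sum_def)
  qed
  have 2: "moebius_twist_sum (N div k) = (\<Sum>d=1..N. if k \<le> N div d then moebius_mu d * chi d else 0)"
    if k: "k \<in> {1..K}" for k
  proof -
    have "(\<Sum>d=1..N. if k \<le> N div d then moebius_mu d * chi d else 0) = (\<Sum>d \<in> {d\<in>{1..N}. k \<le> N div d}. moebius_mu d * chi d)"
      by (rule sum.inter_filter[symmetric]) simp
    also have "{d\<in>{1..N}. k \<le> N div d} = {1..N div k}"
    proof -
      have "k \<le> N div d \<longleftrightarrow> d \<le> N div k" if "d \<ge> 1" for d
        using that k by (simp add: less_eq_div_iff_mult_less_eq mult.commute)
      moreover have "d \<le> N" if "d \<le> N div k" for d
        using that div_le_dividend[of N k] by (rule order_trans)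
      ultimately have "d \<in> {d\<in>{1..N}. k \<le> N div d} \<longleftrightarrow> d \<in> {1..N div k}" for d
        by (metis (no_types, lifting) atLeastAtMost_iff mem_Collect_eq)
      then show ?thesis by (rule Set.set_eqI)
    qed
    finally show ?thesis by (simp add: moebius_twist_sum_def)
  qed
  have "(\<Sum>d=1..N. moebius_mu d * chi d * ln_twist_sum (min K (N div d))) =
     (\<Sum>d=1..N. \<Sum>k=1..K. chi k * ln (real k) * (if k \<le> N div d then moebius_mu d * chi d else 0))"
    unfolding 1 sum_distrib_left by (intro sum.cong refl) auto
  also have "\<dots> = (\<Sum>k=1..K. \<Sum>d=1..N. chi k * ln (real k) * (if k \<le> N div d then moebius_mu d * chi d else 0))"
    by (rule sum.swap)
  also have "\<dots> = (\<Sum>k=1..K. chi k * ln (real k) * moebius_twist_sum (N div k))"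
    by (intro sum.cong refl) (simp only: 2 sum_distrib_left)
  finally show ?thesis .
qed

text \<open>
  The part \<open>k > K\<close>, where only \<open>d \<le> N / (K + 1)\<close> occurs. There the sums of \<open>chi k ln k\<close> are
  \<open>O(ln (N / d))\<close>, and \<open>ln x \<le> 2 sqrt x\<close> keeps the sum over \<open>d\<close> elementary.
\<close>

lemma hyperbola_remainder:
  assumes K: "K > 0"
  shows "\<bar>\<Sum>d=1..N. moebius_mu d * chi d * (ln_twist_sum (N div d) - ln_twist_sum (min K (N div d)))\<bar>
           \<le> 24 * C * real N / sqrt (real (Suc K))"
proof -
  define D where "D = N div Suc K"
  have "\<bar>\<Sum>d=1..N. moebius_mu d * chi d * (ln_twist_sum (N div d) - ln_twist_sum (min K (N div d)))\<bar>
     \<le> (\<Sum>d=1..N. \<bar>moebius_mu d * chi d * (ln_twist_sum (N div d) - ln_twist_sum (min K (N div d)))\<bar>)"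
    by (rule sum_abs)
  also have "\<dots> \<le> (\<Sum>d=1..N. if d \<le> D then 8 * C * sqrt (real N / real d) else 0)"
  proof (rule sum_mono)
    fix d assume d: "d \<in> {1..N}"
    show "\<bar>moebius_mu d * chi d * (ln_twist_sum (N div d) - ln_twist_sum (min K (N div d)))\<bar>
       \<le> (if d \<le> D then 8 * C * sqrt (real N / real d) else 0)"
    proof (cases "N div d \<le> K")
      case True
      then show ?thesis using C_nonneg by (simp add: min_def)
    next
      case False
      then have "Suc K \<le> N div d" by simp
      then have "d \<le> D" using d by (simp add: D_def less_eq_div_iff_mult_less_eq mult.commute del: mult_Suc mult_Suc_right)
      have m: "\<bar>moebius_mu d * chi d\<bar> \<le> 1"
        using abs_le[of d] abs_moebius_mu_le[of d] by (simp add: abs_mult mult_le_one)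
      have "1 \<le> real N / real d" using d by simp
      have "\<bar>ln_twist_sum (N div d) - ln_twist_sum K\<bar> \<le> 2 * C * ln (real (N div d)) + 2 * C * ln (real K)"
        using ln_weighted_sum_le[of "N div d"] ln_weighted_sum_le[of K] K False
        unfolding ln_twist_sum_def by linarith
      also have "\<dots> \<le> 2 * C * ln (real N / real d) + 2 * C * ln (real N / real d)"
      proof (intro add_mono mult_left_mono)
        have le: "real (N div d) \<le> real N / real d" by (rule of_nat_div_le_of_nat)
        have "N div d > 0" using False by simp
        then show "ln (real (N div d)) \<le> ln (real N / real d)" using le by simp
        have "real K \<le> real N / real d" using le False by linarith
        then show "ln (real K) \<le> ln (real N / real d)" using K by simp
      qed (use C_nonneg in auto)
      also have "\<dots> = 4 * C * ln (real N / real d)" by simp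
      also have "\<dots> \<le> 4 * C * (2 * sqrt (real N / real d))"
        using C_nonneg \<open>1 \<le> real N / real d\<close> by (intro mult_left_mono ln_le_two_sqrt) auto
      finally have "\<bar>ln_twist_sum (N div d) - ln_twist_sum K\<bar> \<le> 8 * C * sqrt (real N / real d)" by simp
      then have "\<bar>moebius_mu d * chi d\<bar> * \<bar>ln_twist_sum (N div d) - ln_twist_sum K\<bar> \<le> 1 * (8 * C * sqrt (real N / real d))"
        using m by (intro mult_mono) auto
      then show ?thesis using \<open>d \<le> D\<close> False by (simp add: min_def abs_mult)
    qed
  qed
  also have "\<dots> = (\<Sum>d\<in>{d\<in>{1..N}. d \<le> D}. 8 * C * sqrt (real N / real d))"
    by (rule sum.inter_filter[symmetric]) simp
  also have "{d\<in>{1..N}. d \<le> D} = {1..D}"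
  proof -
    have "D \<le> N" unfolding D_def by (rule div_le_dividend)
    then show ?thesis by auto
  qed
  also have "(\<Sum>d=1..D. 8 * C * sqrt (real N / real d)) \<le> 8 * C * (3 * sqrt (real N) * sqrt (real D))"
    unfolding sum_distrib_left[symmetric] using C_nonneg by (intro mult_left_mono sum_sqrt_quotient_le) auto
  also have "\<dots> \<le> 8 * C * (3 * sqrt (real N) * sqrt (real N / real (Suc K)))"
  proof (intro mult_left_mono real_sqrt_le_mono)
    show "real D \<le> real N / real (Suc K)" unfolding D_def by (rule of_nat_div_le_of_nat)
  qed (use C_nonneg in auto)
  also have "\<dots> = 24 * C * real N / sqrt (real (Suc K))"
    by (simp add: real_sqrt_divide)
  finally show ?thesis .
qed

text \<open>
  First \<open>K\<close> is chosen to make the remainder small compared to \<open>N\<close>, then \<open>N\<close> is taken large.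
\<close>

theorem mangoldt_twist_sum_small: "(\<lambda>N. (\<Sum>n=1..N. chi n * mangoldt n) / real N) \<longlonglongrightarrow> 0"
proof (rule LIMSEQ_I)
  fix e :: real assume e: "e > 0"
  have "(\<lambda>K. 24 * C / sqrt (real (Suc K))) \<longlonglongrightarrow> 0" by real_asymp
  then have "\<forall>\<^sub>F K in sequentially. 24 * C / sqrt (real (Suc K)) < e / 2"
    by (rule order_tendstoD) (use e in auto)
  then have "\<forall>\<^sub>F K in sequentially. 24 * C / sqrt (real (Suc K)) < e / 2 \<and> K > 0"
    using eventually_gt_at_top[of 0] by eventually_elim auto
  then obtain K where K: "24 * C / sqrt (real (Suc K)) < e / 2" "K > 0"
    by (auto simp: eventually_sequentially)
  have "(\<lambda>N. \<Sum>k=1..K. chi k * ln (real k) * (moebius_twist_sum (N div k) / real N)) \<longlonglongrightarrow> (\<Sum>k=1..K. chi k * ln (real k) * 0)"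
  proof (intro tendsto_sum tendsto_mult tendsto_const)
    fix k assume k: "k \<in> {1..K}"
    have "filterlim (\<lambda>N. N div k) at_top sequentially"
      using k by (intro filterlim_at_top_div_const_nat) auto
    from filterlim_compose[OF moebius_twist_sum_small this]
    have lim: "(\<lambda>N. moebius_twist_sum (N div k) / real (N div k)) \<longlonglongrightarrow> 0" .
    show "(\<lambda>N. moebius_twist_sum (N div k) / real N) \<longlonglongrightarrow> 0"
    proof (rule Lim_null_comparison[OF _ tendsto_norm_zero[OF lim]])
      show "\<forall>\<^sub>F N in sequentially. norm (moebius_twist_sum (N div k) / real N) \<le> norm (moebius_twist_sum (N div k) / real (N div k))"
        using eventually_ge_at_top[of k]
      proof eventually_elim
        case (elim N)
        then have "N div k > 0" "N > 0" using k by (auto simp: div_greater_zero_iff)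
        then show ?case by (auto simp: abs_divide intro!: divide_left_mono mult_pos_pos)
      qed
    qed
  qed
  then have "(\<lambda>N. (\<Sum>k=1..K. chi k * ln (real k) * moebius_twist_sum (N div k)) / real N) \<longlonglongrightarrow> 0"
    by (simp add: sum_divide_distrib)
  from LIMSEQ_D[OF this, of "e / 2"] e obtain N0 where
    N0: "\<And>N. N \<ge> N0 \<Longrightarrow> \<bar>(\<Sum>k=1..K. chi k * ln (real k) * moebius_twist_sum (N div k)) / real N\<bar> < e / 2"
    by auto
  show "\<exists>no. \<forall>N\<ge>no. norm ((\<Sum>n=1..N. chi n * mangoldt n) / real N - 0) < e"
  proof (intro exI allI impI)
    fix N assume N: "N \<ge> max 1 N0"
    let ?R = "\<Sum>d=1..N. moebius_mu d * chi d * (ln_twist_sum (N div d) - ln_twist_sum (min K (N div d)))"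
    have eq: "(\<Sum>n=1..N. chi n * mangoldt n) = ?R + (\<Sum>k=1..K. chi k * ln (real k) * moebius_twist_sum (N div k))"
      unfolding mangoldt_twist_sum_eq hyperbola_part[symmetric] sum.distrib[symmetric]
      by (intro sum.cong refl) (simp add: algebra_simps)
    have "\<bar>?R / real N\<bar> \<le> 24 * C / sqrt (real (Suc K))"
    proof -
      have "\<bar>?R\<bar> \<le> 24 * C / sqrt (real (Suc K)) * real N" using hyperbola_remainder[OF K(2), of N] by simp
      then show ?thesis using N by (simp add: abs_divide pos_divide_le_eq)
    qed
    then show "norm ((\<Sum>n=1..N. chi n * mangoldt n) / real N - 0) < e"
      using N0[of N] N K(1) unfolding eq add_divide_distrib by (simp only: real_norm_def diff_0_right) linarith
  qed
qed

end

section \<open>Chebyshev bounds and the density of primes with a given character value\<close>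

definition chebyshev_psi :: "nat \<Rightarrow> real" where "chebyshev_psi N = (\<Sum>n=1..N. mangoldt n)"

lemma chebyshev_psi_mono: "M \<le> N \<Longrightarrow> chebyshev_psi M \<le> chebyshev_psi N"
  unfolding chebyshev_psi_def by (intro sum_mono2) (auto simp: mangoldt_nonneg)

lemma ln_fact_eq: "ln (fact N) = (\<Sum>d=1..N. mangoldt d * real (N div d))"
proof -
  have "ln (fact N :: real) = (\<Sum>n=1..N. ln (real n))"
    by (induction N) (simp_all add: ln_mult add.commute)
  also have "\<dots> = (\<Sum>n=1..N. \<Sum>d | d dvd n. mangoldt d)"
    by (intro sum.cong refl) (use mangoldt_sum[where ?'a = real] in auto)
  also have "\<dots> = (\<Sum>d=1..N. \<Sum>k=1..N div d. mangoldt d)"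
    by (rule sum_divisors_upto)
  finally show ?thesis by (simp add: mult.commute)
qed

text \<open>
  Chebyshev's identity. The weights \<open>2 n div d - 2 (n div d)\<close> are \<open>0\<close> or \<open>1\<close>, and \<open>1\<close> for
  \<open>n < d \<le> 2 n\<close>, so the binomial coefficient bounds the Chebyshev function from both sides.
\<close>

lemma ln_central_binomial:
  "ln (real ((2 * n) choose n)) = (\<Sum>d=1..2*n. mangoldt d * (real (2 * n div d) - 2 * real (n div d)))"
proof -
  have "(\<Sum>d=1..2*n. mangoldt d * real (n div d)) = (\<Sum>d=1..n. mangoldt d * real (n div d))"
    by (rule sum.mono_neutral_right) auto
  then have "(\<Sum>d=1..2*n. mangoldt d * (real (2 * n div d) - 2 * real (n div d))) = ln (fact (2 * n)) - 2 * ln (fact n)"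
    unfolding ln_fact_eq right_diff_distrib sum_subtractf mult.left_commute[of _ 2] sum_distrib_left[symmetric]
    by (simp only:)
  moreover have "real ((2 * n) choose n) = fact (2 * n) / (fact n * fact n)"
    using binomial_fact[of n "2 * n", where ?'a = real] by simp
  ultimately show ?thesis by (simp add: ln_div ln_mult)
qed

lemma double_div_bounds:
  fixes n d :: nat
  assumes "d > 0"
  shows "2 * (n div d) \<le> 2 * n div d" "2 * n div d \<le> 2 * (n div d) + 1"
proof -
  have "n div d * d \<le> n" by simp
  then show "2 * (n div d) \<le> 2 * n div d" using assms by (simp add: less_eq_div_iff_mult_less_eq)
  have "n < (n div d + 1) * d" using assms by (metis Suc_eq_plus1 dividend_less_div_times mult.commute mult_Suc)
  then have "2 * n < (2 * (n div d) + 2) * d" by (simp add: algebra_simps)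
  then have "2 * n div d < 2 * (n div d) + 2" using assms by (simp add: div_less_iff_less_mult)
  then show "2 * n div d \<le> 2 * (n div d) + 1" by simp
qed

lemma chebyshev_psi_double_le: "chebyshev_psi (2 * n) \<le> chebyshev_psi n + real n * ln 4"
proof -
  have "chebyshev_psi (2 * n) - chebyshev_psi n = (\<Sum>d=Suc n..2*n. mangoldt d)"
    unfolding chebyshev_psi_def using sum.ub_add_nat[of 1 n "mangoldt :: nat \<Rightarrow> real" n] by (simp add: mult_2)
  also have "\<dots> = (\<Sum>d=Suc n..2*n. mangoldt d * (real (2 * n div d) - 2 * real (n div d)))"
  proof (intro sum.cong refl)
    fix d assume d: "d \<in> {Suc n..2*n}"
    then have "n div d = 0" by simp
    moreover have "2 * n div d = 1"
      using d double_div_bounds(2)[of d n] \<open>n div d = 0\<close> div_greater_zero_iff[of "2 * n" d] by auto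
    ultimately show "mangoldt d = mangoldt d * (real (2 * n div d) - 2 * real (n div d))" by simp
  qed
  also have "\<dots> \<le> (\<Sum>d=1..2*n. mangoldt d * (real (2 * n div d) - 2 * real (n div d)))"
  proof (intro sum_mono2)
    fix d assume "d \<in> {1..2*n} - {Suc n..2*n}"
    then have "real (2 * (n div d)) \<le> real (2 * n div d)"
      using double_div_bounds(1)[of d n] by (intro of_nat_mono) auto
    then show "0 \<le> mangoldt d * (real (2 * n div d) - 2 * real (n div d))"
      by (simp add: mangoldt_nonneg)
  qed auto
  also have "\<dots> = ln (real ((2 * n) choose n))" by (rule ln_central_binomial[symmetric])
  also have "\<dots> \<le> ln (2 ^ (2 * n))"
  proof -
    have "real ((2 * n) choose n) \<le> real (2 ^ (2 * n))" by (intro of_nat_mono binomial_le_pow2)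
    moreover have "real ((2 * n) choose n) > 0" by simp
    ultimately show ?thesis by simp
  qed
  also have "\<dots> = real n * ln 4" by (simp add: power_mult ln_realpow)
  finally show ?thesis by simp
qed

lemma chebyshev_psi_upper: "chebyshev_psi N \<le> 2 * ln 4 * real N"
proof (induction N rule: less_induct)
  case (less N)
  have l: "ln (4::real) > 0" by simp
  consider "N = 0" | "N = 1" | n where "N = 2 * n" "n \<ge> 1" | n where "N = 2 * n + 1" "n \<ge> 1"
  proof -
    obtain n where "N = 2 * n \<or> N = 2 * n + 1" by (metis evenE oddE)
    then show ?thesis using that by (cases "n = 0") auto
  qed
  then show ?case
  proof cases
    case (3 n)
    have "chebyshev_psi N \<le> 2 * ln 4 * real n + real n * ln 4"
    proof -
      have "n < N" using 3 by simp
      from less.IH[OF this] chebyshev_psi_double_le[of n] show ?thesis unfolding 3(1) by linarith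
    qed
    also have "\<dots> \<le> 2 * ln 4 * real N" using l 3 by (simp add: mult_ac)
    finally show ?thesis .
  next
    case (4 n)
    have "chebyshev_psi N \<le> chebyshev_psi (2 * (n + 1))" using 4 by (intro chebyshev_psi_mono) auto
    also have "\<dots> \<le> 2 * ln 4 * real (n + 1) + real (n + 1) * ln 4"
    proof -
      have "n + 1 < N" using 4 by simp
      from less.IH[OF this] chebyshev_psi_double_le[of "n + 1"] show ?thesis by linarith
    qed
    also have "\<dots> = ln 4 * (3 * real n + 3)" by (simp add: algebra_simps)
    also have "\<dots> \<le> ln 4 * (4 * real n + 2)" using 4 l by (intro mult_left_mono) auto
    also have "\<dots> = 2 * ln 4 * real N" using 4 by (simp add: algebra_simps)
    finally show ?thesis .
  qed (auto simp: chebyshev_psi_def)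
qed

lemma chebyshev_psi_lower:
  assumes "n > 0"
  shows "chebyshev_psi (2 * n) \<ge> real n * ln 4 - ln (2 * real n)"
proof -
  have "real n * ln 4 - ln (2 * real n) = ln (4 ^ n / (2 * real n))"
    using assms by (simp add: ln_div ln_realpow)
  also have "\<dots> \<le> ln (real ((2 * n) choose n))"
    using central_binomial_lower_bound[OF assms] assms by (subst ln_le_cancel_iff) auto
  also have "\<dots> \<le> (\<Sum>d=1..2*n. mangoldt d * 1)"
    unfolding ln_central_binomial
  proof (intro sum_mono mult_left_mono mangoldt_nonneg)
    fix d assume "d \<in> {1..2*n}"
    then have "real (2 * n div d) \<le> real (2 * (n div d) + 1)"
      using double_div_bounds(2)[of d n] by (intro of_nat_mono) auto
    then show "real (2 * n div d) - 2 * real (n div d) \<le> 1" by simp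
  qed
  finally show ?thesis by (simp add: chebyshev_psi_def)
qed

definition primes_upto :: "nat \<Rightarrow> nat set" where "primes_upto N = {p. prime p \<and> p \<le> N}"

lemma finite_primes_upto [simp]: "finite (primes_upto N)"
  unfolding primes_upto_def by (rule finite_subset[of _ "{..N}"]) auto

definition proper_power_sum :: "nat \<Rightarrow> real" where
  "proper_power_sum N = (\<Sum>n | n \<in> {1..N} \<and> \<not> prime n. mangoldt n)"

text \<open>
  A proper prime power \<open>p\<^sup>k \<le> N\<close> has \<open>p \<le> sqrt N\<close> and \<open>k \<le> ln N / ln 2\<close>; each one contributes at
  most \<open>ln N\<close>.
\<close>

lemma proper_power_sum_le:
  assumes "N > 1"
  shows "proper_power_sum N \<le> sqrt (real N) * (ln (real N) / ln 2) * ln (real N)"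
proof -
  define E where "E = {n. n \<in> {1..N} \<and> \<not> prime n \<and> mangoldt n \<noteq> (0::real)}"
  define A where "A = {1..nat \<lfloor>sqrt (real N)\<rfloor>}"
  define B where "B = {1..nat \<lfloor>ln (real N) / ln 2\<rfloor>}"
  have sub: "E \<subseteq> (\<lambda>(p, k). p ^ k) ` (A \<times> B)"
  proof
    fix n assume n: "n \<in> E"
    then have "primepow n" by (auto simp: E_def mangoldt_def split: if_splits)
    then obtain p k where pk: "prime p" "k > 0" "n = p ^ k" by (auto simp: primepow_def)
    have "k \<noteq> 1" using n pk by (auto simp: E_def)
    then have k: "k \<ge> 2" using pk(2) by simp
    have p: "p \<ge> 2" using pk(1) prime_ge_2_nat by blast
    have "p ^ 2 \<le> p ^ k" using p k by (intro power_increasing) auto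
    also have "\<dots> \<le> N" using n pk by (simp add: E_def)
    finally have "real p ^ 2 \<le> real N" by (metis of_nat_le_iff of_nat_power)
    then have "real p \<le> sqrt (real N)" by (rule real_le_rsqrt)
    then have "p \<in> A" using p by (simp add: A_def le_nat_floor)
    have "2 ^ k \<le> p ^ k" using p by (intro power_mono) auto
    also have "\<dots> \<le> N" using n pk by (simp add: E_def)
    finally have "(2::real) ^ k \<le> real N" by (metis of_nat_le_iff of_nat_power of_nat_numeral)
    then have "ln ((2::real) ^ k) \<le> ln (real N)" using assms by (subst ln_le_cancel_iff) auto
    then have "real k \<le> ln (real N) / ln 2" by (simp add: ln_realpow pos_le_divide_eq)
    then have "k \<in> B" using pk(2) by (simp add: B_def le_nat_floor)
    with \<open>p \<in> A\<close> show "n \<in> (\<lambda>(p, k). p ^ k) ` (A \<times> B)" using pk(3) by auto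
  qed
  have fin: "finite (A \<times> B)" by (simp add: A_def B_def)
  have "card E \<le> card ((\<lambda>(p, k). p ^ k) ` (A \<times> B))"
    using sub fin by (intro card_mono) auto
  also have "\<dots> \<le> card (A \<times> B)" using fin by (rule card_image_le)
  also have "\<dots> = nat \<lfloor>sqrt (real N)\<rfloor> * nat \<lfloor>ln (real N) / ln 2\<rfloor>"
    by (simp add: A_def B_def card_cartesian_product)
  finally have "real (card E) \<le> real (nat \<lfloor>sqrt (real N)\<rfloor>) * real (nat \<lfloor>ln (real N) / ln 2\<rfloor>)"
    by (metis of_nat_le_iff of_nat_mult)
  also have "\<dots> \<le> sqrt (real N) * (ln (real N) / ln 2)"
    using assms by (intro mult_mono) auto
  finally have card: "real (card E) \<le> sqrt (real N) * (ln (real N) / ln 2)" .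
  have "proper_power_sum N = sum mangoldt E"
    unfolding proper_power_sum_def E_def by (intro sum.mono_neutral_right) auto
  also have "\<dots> \<le> (\<Sum>n\<in>E. ln (real N))"
  proof (rule sum_mono)
    fix n assume "n \<in> E"
    then have "n > 0" "n \<le> N" by (auto simp: E_def)
    then have "ln (real n) \<le> ln (real N)" by simp
    with mangoldt_le_ln[OF \<open>n > 0\<close>] show "mangoldt n \<le> ln (real N)" by (rule order_trans)
  qed
  also have "\<dots> = real (card E) * ln (real N)" by simp
  also have "\<dots> \<le> sqrt (real N) * (ln (real N) / ln 2) * ln (real N)"
    using card assms by (intro mult_right_mono) auto
  finally show ?thesis .
qed

lemma mangoldt_weighted_sum_split:
  fixes w :: "nat \<Rightarrow> real"
  shows "(\<Sum>n=1..N. w n * mangoldt n) =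
    (\<Sum>p\<in>primes_upto N. w p * ln (real p)) + (\<Sum>n | n \<in> {1..N} \<and> \<not> prime n. w n * mangoldt n)"
proof -
  have "{1..N} = primes_upto N \<union> {n. n \<in> {1..N} \<and> \<not> prime n}"
    by (auto simp: primes_upto_def Suc_le_eq prime_gt_0_nat)
  then have "(\<Sum>n=1..N. w n * mangoldt n) =
    (\<Sum>p\<in>primes_upto N. w p * mangoldt p) + (\<Sum>n | n \<in> {1..N} \<and> \<not> prime n. w n * mangoldt n)"
    by (metis (no_types, lifting) sum.union_disjoint[of "primes_upto N" "{n. n \<in> {1..N} \<and> \<not> prime n}"] finite_primes_upto
       finite_atLeastAtMost finite_Un disjoint_iff mem_Collect_eq primes_upto_def)
  also have "(\<Sum>p\<in>primes_upto N. w p * mangoldt p) = (\<Sum>p\<in>primes_upto N. w p * ln (real p))"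
    by (intro sum.cong refl) (auto simp: primes_upto_def)
  finally show ?thesis .
qed

lemma prime_log_sum_le_chebyshev_psi: "(\<Sum>p\<in>primes_upto N. ln (real p)) \<le> chebyshev_psi N"
proof -
  have "0 \<le> (\<Sum>n | n \<in> {1..N} \<and> \<not> prime n. mangoldt n :: real)"
    by (intro sum_nonneg mangoldt_nonneg)
  then show ?thesis
    using mangoldt_weighted_sum_split[of "\<lambda>_. 1" N] by (simp add: chebyshev_psi_def)
qed

text \<open>
  Primes above \<open>sqrt N\<close> each contribute at least \<open>ln N / 2\<close> to the Chebyshev function.
\<close>

lemma card_primes_upto_upper:
  assumes "N > 1"
  shows "real (card (primes_upto N)) \<le> sqrt (real N) + 4 * ln 4 * real N / ln (real N)"
proof -
  define S where "S = {p \<in> primes_upto N. real p \<le> sqrt (real N)}"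
  define T where "T = {p \<in> primes_upto N. real p > sqrt (real N)}"
  have fin: "finite S" "finite T" by (auto simp: S_def T_def)
  have "card (primes_upto N) = card (S \<union> T)" by (rule arg_cong[of _ _ card]) (auto simp: S_def T_def)
  also have "\<dots> \<le> card S + card T" by (rule card_Un_le)
  finally have 1: "real (card (primes_upto N)) \<le> real (card S) + real (card T)" by linarith
  have "S \<subseteq> {1..nat \<lfloor>sqrt (real N)\<rfloor>}"
    by (auto simp: S_def primes_upto_def Suc_le_eq prime_gt_0_nat le_nat_floor)
  then have "card S \<le> nat \<lfloor>sqrt (real N)\<rfloor>" using card_mono[of "{1..nat \<lfloor>sqrt (real N)\<rfloor>}" S] by simp
  then have "real (card S) \<le> real (nat \<lfloor>sqrt (real N)\<rfloor>)" by (rule of_nat_mono)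
  also have "\<dots> \<le> sqrt (real N)" by (rule of_nat_floor) simp
  finally have 2: "real (card S) \<le> sqrt (real N)" .
  have lnN: "ln (real N) > 0" using assms by simp
  have "real (card T) * (ln (real N) / 2) = (\<Sum>p\<in>T. ln (sqrt (real N)))"
    using assms by (simp add: ln_sqrt)
  also have "\<dots> \<le> (\<Sum>p\<in>T. ln (real p))"
  proof (rule sum_mono)
    fix p assume "p \<in> T"
    then have "sqrt (real N) < real p" by (simp add: T_def)
    moreover have "0 < sqrt (real N)" using assms by simp
    ultimately show "ln (sqrt (real N)) \<le> ln (real p)" by (subst ln_le_cancel_iff) linarith+
  qed
  also have "\<dots> \<le> (\<Sum>p\<in>primes_upto N. ln (real p))"
    by (intro sum_mono2) (auto simp: T_def primes_upto_def Suc_le_eq prime_gt_0_nat)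
  also have "\<dots> \<le> 2 * ln 4 * real N" using prime_log_sum_le_chebyshev_psi chebyshev_psi_upper order_trans by blast
  finally have "real (card T) \<le> 4 * ln 4 * real N / ln (real N)"
    using lnN by (simp add: field_simps)
  with 1 2 show ?thesis by linarith
qed

lemma card_primes_upto_lower:
  assumes "N > 1"
  shows "real (card (primes_upto N)) * ln (real N) \<ge>
     (real N - 1) / 2 * ln 4 - ln (real N) - sqrt (real N) * (ln (real N) / ln 2) * ln (real N)"
proof -
  define n where "n = N div 2"
  have n: "n > 0" "2 * n \<le> N" "real N - 1 \<le> 2 * real n" using assms by (auto simp: n_def)
  have "(real N - 1) / 2 * ln 4 - ln (real N) \<le> real n * ln 4 - ln (2 * real n)"
  proof (intro diff_mono mult_right_mono)
    show "ln (2 * real n) \<le> ln (real N)" using n by simp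
  qed (use n in auto)
  also have "\<dots> \<le> chebyshev_psi (2 * n)" by (rule chebyshev_psi_lower[OF n(1)])
  also have "\<dots> \<le> chebyshev_psi N" by (rule chebyshev_psi_mono[OF n(2)])
  also have "\<dots> = (\<Sum>p\<in>primes_upto N. ln (real p)) + proper_power_sum N"
    using mangoldt_weighted_sum_split[of "\<lambda>_. 1" N] by (simp add: chebyshev_psi_def proper_power_sum_def)
  also have "(\<Sum>p\<in>primes_upto N. ln (real p)) \<le> (\<Sum>p\<in>primes_upto N. ln (real N))"
    by (intro sum_mono) (auto simp: primes_upto_def dest: prime_gt_0_nat)
  also have "\<dots> = real (card (primes_upto N)) * ln (real N)" by simp
  finally show ?thesis using proper_power_sum_le[OF assms] by linarith
qed

text \<open>
  Primes below \<open>N / K\<close> are estimated as if all integers were prime; above \<open>N / K\<close> the logarithm is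
  at most \<open>ln K\<close>.
\<close>

lemma ln_quotient_sum_le:
  assumes "N > 0" "K > 0"
  shows "(\<Sum>p\<in>primes_upto N. ln (real N / real p)) \<le> 6 * real N / sqrt (real K) + real (card (primes_upto N)) * ln (real K)"
proof -
  define D where "D = N div K"
  have "(\<Sum>p\<in>primes_upto N. ln (real N / real p)) \<le>
     (\<Sum>p\<in>primes_upto N. (if p \<le> D then 2 * sqrt (real N / real p) else 0) + ln (real K))"
  proof (rule sum_mono)
    fix p assume "p \<in> primes_upto N"
    then have p: "p > 0" "p \<le> N" by (auto simp: primes_upto_def prime_gt_0_nat)
    show "ln (real N / real p) \<le> (if p \<le> D then 2 * sqrt (real N / real p) else 0) + ln (real K)"
    proof (cases "p \<le> D")
      case True
      have "ln (real N / real p) \<le> 2 * sqrt (real N / real p)" using p by (intro ln_le_two_sqrt) simp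
      moreover have "ln (real K) \<ge> 0" using assms by simp
      ultimately show ?thesis using True by simp
    next
      case False
      then have "N < K * p" using assms by (simp add: D_def not_le div_less_iff_less_mult mult.commute)
      then have "real N \<le> real K * real p" by (metis less_imp_le of_nat_le_iff of_nat_mult)
      then have "real N / real p \<le> real K" using p by (simp add: pos_divide_le_eq)
      then show ?thesis using False p assms by simp
    qed
  qed
  also have "\<dots> = (\<Sum>p\<in>primes_upto N. if p \<le> D then 2 * sqrt (real N / real p) else 0) + real (card (primes_upto N)) * ln (real K)"
    by (simp add: sum.distrib)
  also have "(\<Sum>p\<in>primes_upto N. if p \<le> D then 2 * sqrt (real N / real p) else 0) =
      (\<Sum>p\<in>{p\<in>primes_upto N. p \<le> D}. 2 * sqrt (real N / real p))"
    by (rule sum.inter_filter[symmetric]) simp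
  also have "\<dots> \<le> (\<Sum>p=1..D. 2 * sqrt (real N / real p))"
    by (rule sum_mono2) (auto simp: primes_upto_def Suc_le_eq prime_gt_0_nat)
  also have "\<dots> \<le> 2 * (3 * sqrt (real N) * sqrt (real D))"
    unfolding sum_distrib_left[symmetric] by (intro mult_left_mono sum_sqrt_quotient_le) auto
  also have "\<dots> \<le> 2 * (3 * sqrt (real N) * sqrt (real N / real K))"
  proof (intro mult_left_mono real_sqrt_le_mono)
    show "real D \<le> real N / real K" unfolding D_def by (rule of_nat_div_le_of_nat)
  qed auto
  also have "\<dots> = 6 * real N / sqrt (real K)" by (simp add: real_sqrt_divide)
  finally show ?thesis by simp
qed

lemma ln_quotient_sum_small: "(\<lambda>N. (\<Sum>p\<in>primes_upto N. ln (real N / real p)) / real N) \<longlonglongrightarrow> 0"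
proof (rule LIMSEQ_I)
  fix e :: real assume e: "e > 0"
  have "(\<lambda>K. 6 / sqrt (real K)) \<longlonglongrightarrow> 0" by real_asymp
  then have "\<forall>\<^sub>F K in sequentially. 6 / sqrt (real K) < e / 2"
    by (rule order_tendstoD) (use e in auto)
  then have "\<forall>\<^sub>F K in sequentially. 6 / sqrt (real K) < e / 2 \<and> K > 0"
    using eventually_gt_at_top[of 0] by eventually_elim auto
  then obtain K where K: "6 / sqrt (real K) < e / 2" "K > 0"
    by (auto simp: eventually_sequentially)
  have "(\<lambda>N. (sqrt (real N) + 4 * ln 4 * real N / ln (real N)) * ln (real K) / real N) \<longlonglongrightarrow> 0" by real_asymp
  then have "\<forall>\<^sub>F N in sequentially. (sqrt (real N) + 4 * ln 4 * real N / ln (real N)) * ln (real K) / real N < e / 2"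
    by (rule order_tendstoD) (use e in auto)
  then have "\<forall>\<^sub>F N in sequentially. norm ((\<Sum>p\<in>primes_upto N. ln (real N / real p)) / real N - 0) < e"
    using eventually_gt_at_top[of 1]
  proof eventually_elim
    case (elim N)
    have N: "N > 0" using elim by simp
    have nonneg: "0 \<le> (\<Sum>p\<in>primes_upto N. ln (real N / real p))"
      by (intro sum_nonneg ln_ge_zero) (auto simp: primes_upto_def prime_gt_0_nat)
    have "(\<Sum>p\<in>primes_upto N. ln (real N / real p)) \<le>
       6 * real N / sqrt (real K) + (sqrt (real N) + 4 * ln 4 * real N / ln (real N)) * ln (real K)"
      using ln_quotient_sum_le[OF N K(2)] mult_right_mono[OF card_primes_upto_upper[OF elim(2)], of "ln (real K)"] K(2)
      by simp
    then have "(\<Sum>p\<in>primes_upto N. ln (real N / real p)) / real N \<le>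
       (6 * real N / sqrt (real K) + (sqrt (real N) + 4 * ln 4 * real N / ln (real N)) * ln (real K)) / real N"
      by (rule divide_right_mono) simp
    also have "\<dots> = 6 / sqrt (real K) + (sqrt (real N) + 4 * ln 4 * real N / ln (real N)) * ln (real K) / real N"
      using N by (simp add: add_divide_distrib)
    also have "\<dots> < e" using elim K(1) by linarith
    finally show ?case using nonneg by simp
  qed
  then show "\<exists>no. \<forall>N\<ge>no. norm ((\<Sum>p\<in>primes_upto N. ln (real N / real p)) / real N - 0) < e"
    by (simp add: eventually_sequentially)
qed

text \<open>
  Replacing \<open>ln p\<close> by \<open>ln N\<close> in the sum of \<open>chi p ln p\<close> changes it by at most the sum of
  \<open>ln (N / p)\<close>, which is \<open>o(N)\<close>, and \<open>\<pi>(N) ln N\<close> is at least a constant times \<open>N\<close>. In the proof \<open>U N\<close>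
  and \<open>V N\<close> are these bounds for numerator and denominator, divided by \<open>N\<close>.
\<close>

lemma (in quadratic_character) prime_sum_small:
  "(\<lambda>N. (\<Sum>p\<in>primes_upto N. chi p) / real (card (primes_upto N))) \<longlonglongrightarrow> 0"
proof -
  define P where "P = (\<lambda>N. \<Sum>p\<in>primes_upto N. chi p)"
  define U where "U = (\<lambda>N. \<bar>\<Sum>n=1..N. chi n * mangoldt n\<bar> / real N
     + sqrt (real N) * (ln (real N) / ln 2) * ln (real N) / real N
     + (\<Sum>p\<in>primes_upto N. ln (real N / real p)) / real N)"
  define V where "V = (\<lambda>N. ((real N - 1) / 2 * ln 4 - ln (real N) - sqrt (real N) * (ln (real N) / ln 2) * ln (real N)) / real N)"
  have "(\<lambda>N. sqrt (real N) * (ln (real N) / ln 2) * ln (real N) / real N) \<longlonglongrightarrow> 0" by real_asymp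
  moreover have "(\<lambda>N. \<bar>\<Sum>n=1..N. chi n * mangoldt n\<bar> / real N) \<longlonglongrightarrow> 0"
    using tendsto_rabs_zero[OF mangoldt_twist_sum_small] by (simp add: abs_divide)
  ultimately have U: "U \<longlonglongrightarrow> 0 + 0 + 0"
    unfolding U_def by (intro tendsto_add ln_quotient_sum_small)
  have V: "V \<longlonglongrightarrow> ln 4 / 2" unfolding V_def by real_asymp
  have "(\<lambda>N. U N / V N) \<longlonglongrightarrow> (0 + 0 + 0) / (ln 4 / 2)"
    by (intro tendsto_divide U V) auto
  then have lim: "(\<lambda>N. U N / V N) \<longlonglongrightarrow> 0" by simp
  have "\<forall>\<^sub>F N in sequentially. V N > 0"
    by (rule order_tendstoD(1)[OF V]) auto
  then have "\<forall>\<^sub>F N in sequentially. norm (P N / real (card (primes_upto N))) \<le> U N / V N"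
    using eventually_gt_at_top[of 1]
  proof eventually_elim
    case (elim N)
    have N: "real N > 0" "ln (real N) > 0" using elim by auto
    have "(\<Sum>n=1..N. chi n * mangoldt n) = (\<Sum>p\<in>primes_upto N. chi p * ln (real p)) +
        (\<Sum>n | n \<in> {1..N} \<and> \<not> prime n. chi n * mangoldt n)"
      by (rule mangoldt_weighted_sum_split)
    moreover have "\<bar>\<Sum>n | n \<in> {1..N} \<and> \<not> prime n. chi n * mangoldt n\<bar> \<le> proper_power_sum N"
      unfolding proper_power_sum_def
    proof (rule order_trans[OF sum_abs sum_mono])
      fix n
      show "\<bar>chi n * mangoldt n\<bar> \<le> mangoldt n"
        using mult_right_mono[OF abs_le[of n] mangoldt_nonneg[of n]] by (simp add: abs_mult)
    qed
    moreover have "proper_power_sum N \<le> sqrt (real N) * (ln (real N) / ln 2) * ln (real N)"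
      by (rule proper_power_sum_le[OF elim(2)])
    ultimately have 1: "\<bar>\<Sum>p\<in>primes_upto N. chi p * ln (real p)\<bar> \<le>
       \<bar>\<Sum>n=1..N. chi n * mangoldt n\<bar> + sqrt (real N) * (ln (real N) / ln 2) * ln (real N)" by linarith
    have "P N * ln (real N) - (\<Sum>p\<in>primes_upto N. chi p * ln (real p)) = (\<Sum>p\<in>primes_upto N. chi p * ln (real N / real p))"
      unfolding P_def sum_distrib_right sum_subtractf[symmetric]
    proof (intro sum.cong refl)
      fix p assume "p \<in> primes_upto N"
      then have "p > 0" by (auto simp: primes_upto_def prime_gt_0_nat)
      then show "chi p * ln (real N) - chi p * ln (real p) = chi p * ln (real N / real p)"
        using N by (simp add: ln_div right_diff_distrib)
    qed
    moreover have "\<bar>\<Sum>p\<in>primes_upto N. chi p * ln (real N / real p)\<bar> \<le> (\<Sum>p\<in>primes_upto N. ln (real N / real p))"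
    proof (rule order_trans[OF sum_abs sum_mono])
      fix p assume "p \<in> primes_upto N"
      then have "ln (real N / real p) \<ge> 0" by (intro ln_ge_zero) (auto simp: primes_upto_def prime_gt_0_nat)
      then show "\<bar>chi p * ln (real N / real p)\<bar> \<le> ln (real N / real p)"
        using mult_right_mono[OF abs_le[of p]] by (simp add: abs_mult)
    qed
    ultimately have "\<bar>P N * ln (real N)\<bar> \<le> \<bar>\<Sum>n=1..N. chi n * mangoldt n\<bar>
       + sqrt (real N) * (ln (real N) / ln 2) * ln (real N) + (\<Sum>p\<in>primes_upto N. ln (real N / real p))"
      using 1 by linarith
    also have "\<dots> = U N * real N" using N by (simp add: U_def field_simps)
    finally have num: "\<bar>P N * ln (real N)\<bar> \<le> U N * real N" .
    have den: "V N * real N \<le> real (card (primes_upto N)) * ln (real N)"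
      using card_primes_upto_lower[OF elim(2)] N by (simp add: V_def)
    have "V N * real N > 0" using elim N by simp
    have "norm (P N / real (card (primes_upto N))) = \<bar>P N * ln (real N)\<bar> / (real (card (primes_upto N)) * ln (real N))"
      using N by (simp add: abs_divide abs_mult)
    also have "\<dots> \<le> (U N * real N) / (V N * real N)"
      using num den \<open>V N * real N > 0\<close> by (intro frac_le) auto
    also have "\<dots> = U N / V N" using N by simp
    finally show ?case .
  qed
  from Lim_null_comparison[OF this lim] show ?thesis by (simp add: P_def)
qed

text \<open>
  Primes with \<open>chi p = 1\<close> are counted twice in \<open>\<Sum> (1 + chi p)\<close>, whose terms are nonnegative.
\<close>

theorem (in quadratic_character) upper_density_le_half:
  assumes A: "\<And>p. prime p \<Longrightarrow> p \<in> A \<Longrightarrow> p \<notin> B \<Longrightarrow> chi p = 1" and B: "finite B"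
  shows "upper_prime_density A \<le> 1 / 2"
proof -
  define \<pi> where "\<pi> = (\<lambda>N. real (card (primes_upto N)))"
  define u where "u = (\<lambda>N. 1/2 + (\<Sum>p\<in>primes_upto N. chi p) / \<pi> N / 2 + real (card B) / \<pi> N)"
  have \<pi>_top: "filterlim \<pi> at_top sequentially"
  proof (rule filterlim_at_top_mono)
    show "filterlim (\<lambda>N. ((real N - 1) / 2 * ln 4 - ln (real N) - sqrt (real N) * (ln (real N) / ln 2) * ln (real N)) / ln (real N)) at_top sequentially"
      by real_asymp
    show "\<forall>\<^sub>F N in sequentially. ((real N - 1) / 2 * ln 4 - ln (real N) - sqrt (real N) * (ln (real N) / ln 2) * ln (real N)) / ln (real N) \<le> \<pi> N"
      using eventually_gt_at_top[of 1]
      by eventually_elim (use card_primes_upto_lower in \<open>simp add: \<pi>_def pos_divide_le_eq\<close>)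
  qed
  have small: "(\<lambda>N. (\<Sum>p\<in>primes_upto N. chi p) / \<pi> N) \<longlonglongrightarrow> 0"
    using prime_sum_small by (simp add: \<pi>_def)
  have "u \<longlonglongrightarrow> 1/2 + 0 / 2 + 0"
    unfolding u_def
    by (intro tendsto_intros tendsto_divide_0[OF tendsto_const] filterlim_at_top_imp_at_infinity[OF \<pi>_top]
        small) auto
  then have u: "u \<longlonglongrightarrow> 1/2" by simp
  have count: "real (card {p. prime p \<and> p \<in> A \<and> p \<le> N}) / \<pi> N \<le> u N" for N
  proof (cases "\<pi> N = 0")
    case False
    then have pos: "\<pi> N > 0" by (simp add: \<pi>_def card_gt_0_iff)
    define G where "G = {p \<in> primes_upto N. chi p = 1}"
    have "{p. prime p \<and> p \<in> A \<and> p \<le> N} \<subseteq> G \<union> B"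
      using A by (auto simp: G_def primes_upto_def)
    then have "card {p. prime p \<and> p \<in> A \<and> p \<le> N} \<le> card (G \<union> B)"
      using B by (intro card_mono) (auto simp: G_def)
    also have "\<dots> \<le> card G + card B" by (rule card_Un_le)
    finally have 1: "real (card {p. prime p \<and> p \<in> A \<and> p \<le> N}) \<le> real (card G) + real (card B)" by linarith
    have "2 * real (card G) = (\<Sum>p\<in>G. 1 + chi p)" by (simp add: G_def)
    also have "\<dots> \<le> (\<Sum>p\<in>primes_upto N. 1 + chi p)"
    proof (rule sum_mono2)
      fix p
      show "0 \<le> 1 + chi p" using vals[of p] by auto
    qed (auto simp: G_def)
    also have "\<dots> = \<pi> N + (\<Sum>p\<in>primes_upto N. chi p)" by (simp add: \<pi>_def sum.distrib)
    finally have "real (card G) \<le> (\<pi> N + (\<Sum>p\<in>primes_upto N. chi p)) / 2" by simp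
    from add_right_mono[OF this, of "real (card B)"]
    have "real (card {p. prime p \<and> p \<in> A \<and> p \<le> N}) \<le> (\<pi> N + (\<Sum>p\<in>primes_upto N. chi p)) / 2 + real (card B)"
      by (rule order_trans[OF 1])
    then have "real (card {p. prime p \<and> p \<in> A \<and> p \<le> N}) / \<pi> N \<le> ((\<pi> N + (\<Sum>p\<in>primes_upto N. chi p)) / 2 + real (card B)) / \<pi> N"
      using pos by (intro divide_right_mono) auto
    also have "\<dots> = u N" using pos by (simp add: u_def field_simps)
    finally show ?thesis .
  qed (simp add: u_def)
  have nat_floor: "filterlim (\<lambda>x::real. nat \<lfloor>x\<rfloor>) sequentially at_top"
    by (intro filterlim_compose[OF filterlim_nat_sequentially] filterlim_floor_sequentially)
  have "((\<lambda>x::real. ereal (u (nat \<lfloor>x\<rfloor>))) \<longlongrightarrow> ereal (1/2)) at_top"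
    using filterlim_compose[OF u nat_floor] by simp
  then have lim: "Limsup at_top (\<lambda>x::real. ereal (u (nat \<lfloor>x\<rfloor>))) = ereal (1/2)"
    by (intro lim_imp_Limsup) auto
  have "upper_prime_density A \<le> Limsup at_top (\<lambda>x::real. ereal (u (nat \<lfloor>x\<rfloor>)))"
    unfolding upper_prime_density_def
  proof (rule Limsup_mono)
    show "\<forall>\<^sub>F x in at_top. ereal (real (card {p. prime p \<and> p \<in> A \<and> real p \<le> x}) / real (card {p::nat. prime p \<and> real p \<le> x}))
       \<le> ereal (u (nat \<lfloor>x\<rfloor>))"
      using eventually_ge_at_top[of 0]
    proof eventually_elim
      case (elim x)
      have "real p \<le> x \<longleftrightarrow> p \<le> nat \<lfloor>x\<rfloor>" for p
        using elim by (simp add: le_nat_iff le_floor_iff)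
      then show ?case using count[of "nat \<lfloor>x\<rfloor>"] by (simp add: \<pi>_def primes_upto_def)
    qed
  qed
  also have "\<dots> = 1 / 2" unfolding lim by (simp add: one_ereal_def numeral_eq_ereal)
  finally show ?thesis .
qed

section \<open>The quadratic character attached to an integer\<close>

lemma Legendre_values: "Legendre a p \<in> {-1, 0, 1}"
  by (simp add: Legendre_def)

lemma Legendre_cong:
  assumes "[a = b] (mod p)"
  shows "Legendre a p = Legendre b p"
proof -
  have "[a = 0] (mod p) \<longleftrightarrow> [b = 0] (mod p)" using assms cong_sym cong_trans by blast
  moreover have "QuadRes p a \<longleftrightarrow> QuadRes p b"
    unfolding QuadRes_def using assms cong_sym cong_trans by blast
  ultimately show ?thesis by (simp add: Legendre_def)
qed

lemma sign_cong_imp_eq: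
  fixes x y :: int
  assumes "x \<in> {-1, 0, 1}" "y \<in> {-1, 0, 1}" "[x = y] (mod int p)" "p > 2"
  shows "x = y"
proof (rule ccontr)
  assume "x \<noteq> y"
  have "int p dvd x - y" using assms(3) by (simp add: cong_iff_dvd_diff)
  then have "int p \<le> \<bar>x - y\<bar>" using \<open>x \<noteq> y\<close> by (intro zdvd_imp_le[of "int p" "\<bar>x - y\<bar>"]) auto
  moreover have "\<bar>x - y\<bar> \<le> 2" using assms(1,2) by auto
  ultimately show False using assms(4) by simp
qed

lemma Legendre_mult:
  fixes p :: nat
  assumes p: "prime p" "p > 2"
  shows "Legendre (a * b) p = Legendre a p * Legendre b p"
proof (rule sign_cong_imp_eq[OF _ _ _ p(2)])
  show "Legendre (a * b) p \<in> {-1, 0, 1}" by (rule Legendre_values)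
  show "Legendre a p * Legendre b p \<in> {-1, 0, 1}"
    using Legendre_values[of a p] Legendre_values[of b p] by auto
  have "[Legendre (a * b) p = (a * b) ^ ((p - 1) div 2)] (mod int p)" by (rule euler_criterion[OF p])
  also have "(a * b) ^ ((p - 1) div 2) = a ^ ((p - 1) div 2) * b ^ ((p - 1) div 2)" by (rule power_mult_distrib)
  also have "[\<dots> = Legendre a p * Legendre b p] (mod int p)"
    using euler_criterion[OF p, of a] euler_criterion[OF p, of b] by (intro cong_mult) (auto simp: cong_sym)
  finally show "[Legendre (a * b) p = Legendre a p * Legendre b p] (mod int p)" .
qed

lemma Legendre_minus_one:
  fixes p :: nat
  assumes p: "prime p" "p > 2"
  shows "Legendre (-1) p = (-1) ^ ((p - 1) div 2)"
proof (rule sign_cong_imp_eq[OF _ _ _ p(2)])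
  show "(-1::int) ^ ((p - 1) div 2) \<in> {-1, 0, 1}" by (cases "even ((p - 1) div 2)") auto
qed (use euler_criterion[OF p] Legendre_values in auto)

text \<open>
  The second supplementary law. In Gauss's lemma for \<open>a = 2\<close> the numbers \<open>2, 4, \<dots>, p - 1\<close> are
  already reduced, so with \<open>h = (p - 1) / 2\<close> the exponent counts the \<open>x \<le> h\<close> with \<open>2 x > h\<close>.
\<close>

lemma Legendre_two:
  fixes p :: nat
  assumes p: "prime p" "p > 2"
  shows "Legendre 2 p = (if p mod 8 = 1 \<or> p mod 8 = 7 then 1 else -1)"
proof -
  have odd: "odd p" using p prime_odd_nat by auto
  interpret GAUSS p 2
    using p by unfold_locales (auto simp: cong_0_iff dest: zdvd_imp_le)
  define h where "h = (int p - 1) div 2"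
  have h: "int p = 2 * h + 1" using odd by (auto simp: h_def elim!: oddE)
  have "C = (\<lambda>x. 2 * x) ` {0<..h}"
  proof -
    have "(\<lambda>x. x mod int p) ` (\<lambda>x. x * 2) ` {0<..h} = (\<lambda>x. 2 * x) ` {0<..h}"
      unfolding image_image by (intro image_cong refl) (use h in \<open>auto simp: mult.commute\<close>)
    then show ?thesis by (simp add: C_def B_def A_def h_def)
  qed
  then have "E = (\<lambda>x. 2 * x) ` {h div 2<..h}"
    unfolding E_def h_def[symmetric] by auto
  then have "card E = nat (h - h div 2)" by (simp add: card_image inj_on_def)
  moreover have "even (nat (h - h div 2)) \<longleftrightarrow> p mod 8 = 1 \<or> p mod 8 = 7"
  proof -
    have "h \<ge> 0" using h by simp
    then have "even (nat (h - h div 2)) \<longleftrightarrow> even (h - h div 2)" by (simp add: even_nat_iff)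
    also have "\<dots> \<longleftrightarrow> int p mod 8 = 1 \<or> int p mod 8 = 7"
    proof -
      define j where "j = h div 4"
      define r where "r = h mod 4"
      have hj: "h = 4 * j + r" by (simp add: j_def r_def)
      have "0 \<le> r" "r < 4" by (simp_all add: r_def)
      then consider "r = 0" | "r = 1" | "r = 2" | "r = 3" by linarith
      then show ?thesis
      proof cases
        case 1
        have "h div 2 = 2 * j" "int p = 1 + 8 * j" using h hj 1 by auto
        then show ?thesis using hj 1 by (simp add: mod_mult_self2)
      next
        case 2
        have "h div 2 = 2 * j" "int p = 3 + 8 * j" using h hj 2 by auto
        then show ?thesis using hj 2 by (simp add: mod_mult_self2)
      next
        case 3
        have "h div 2 = 2 * j + 1" "int p = 5 + 8 * j" using h hj 3 by auto
        then show ?thesis using hj 3 by (simp add: mod_mult_self2)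
      next
        case 4
        have "h div 2 = 2 * j + 1" "int p = 7 + 8 * j" using h hj 4 by auto
        then show ?thesis using hj 4 by (simp add: mod_mult_self2)
      qed
    qed
    also have "\<dots> \<longleftrightarrow> p mod 8 = 1 \<or> p mod 8 = 7"
      using zmod_int[of p 8] by auto
    finally show ?thesis .
  qed
  ultimately show ?thesis using gauss_lemma by (simp add: uminus_power_if)
qed

text \<open>
  A completely multiplicative function of period \<open>m\<close> that interpolates the Legendre symbols of \<open>a\<close>.
  The condition on the primes dividing \<open>m\<close> allows the Chinese remainder theorem to separate an odd
  prime from the rest of \<open>a\<close>, and \<open>8 dvd m\<close> lets a congruence modulo \<open>m\<close> fix the factors at \<open>-1\<close>
  and \<open>2\<close>. Values at numbers not prime to \<open>2 a\<close> are left open.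
\<close>

definition residue_character :: "int \<Rightarrow> (nat \<Rightarrow> int) \<Rightarrow> nat \<Rightarrow> bool" where
  "residue_character a f m \<longleftrightarrow> m > 0 \<and> 8 dvd m \<and> (\<forall>p. prime p \<and> p dvd m \<longrightarrow> p = 2 \<or> int p dvd a) \<and>
     (\<forall>n k. f (n * k) = f n * f k) \<and> f 1 = 1 \<and> (\<forall>n. f n \<in> {-1, 0, 1}) \<and> (\<forall>n. f (n + m) = f n) \<and>
     (\<forall>p. prime p \<and> odd p \<and> \<not> int p dvd a \<longrightarrow> f p = Legendre a p)"

lemma residue_character_periodic:
  assumes "residue_character a f m"
  shows "f (n + m * k) = f n"
proof (induction k)
  case (Suc k)
  have "f (n + m * Suc k) = f ((n + m * k) + m)" by (simp add: algebra_simps)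
  also have "\<dots> = f (n + m * k)" using assms unfolding residue_character_def by blast
  finally show ?case using Suc by simp
qed simp

lemma residue_character_cong:
  assumes "residue_character a f m" "[n = k] (mod m)"
  shows "f n = f k"
proof -
  have "f n = f (n mod m)" for n
    using residue_character_periodic[OF assms(1), of "n mod m" "n div m"] by (simp add: mult.commute)
  then show ?thesis using assms(2) by (metis cong_def)
qed

lemma odd_prime_gt_2: "prime p \<Longrightarrow> odd p \<Longrightarrow> (2::nat) < p"
  using prime_ge_2_nat[of p] by (cases "p = 2") auto

lemma residue_character_mult:
  assumes f: "residue_character a f m" and g: "residue_character b g k"
  shows "residue_character (a * b) (\<lambda>n. f n * g n) (m * k)"
  unfolding residue_character_def
proof (intro conjI allI impI)
  show "m * k > 0" "8 dvd m * k" "f 1 * g 1 = 1" using f g by (auto simp: residue_character_def)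
  show "p = 2 \<or> int p dvd a * b" if "prime p \<and> p dvd m * k" for p
    using that f g unfolding residue_character_def by (metis dvd_mult dvd_mult2 prime_dvd_mult_iff)
  show "f (n * l) * g (n * l) = f n * g n * (f l * g l)" for n l
    using f g unfolding residue_character_def by (simp add: mult_ac)
  show "f n * g n \<in> {-1, 0, 1}" for n
  proof -
    have "f n \<in> {-1, 0, 1}" "g n \<in> {-1, 0, 1}" using f g unfolding residue_character_def by blast+
    then show ?thesis by auto
  qed
  show "f (n + m * k) * g (n + m * k) = f n * g n" for n
    using residue_character_periodic[OF f, of n k] residue_character_periodic[OF g, of n m] by (simp add: mult.commute)
  show "f p * g p = Legendre (a * b) (int p)" if p: "prime p \<and> odd p \<and> \<not> int p dvd a * b" for p
  proof -
    have "\<not> int p dvd a" "\<not> int p dvd b" using p by auto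
    then have "f p = Legendre a p" "g p = Legendre b p" using f g p unfolding residue_character_def by blast+
    then show ?thesis using p odd_prime_gt_2 by (simp add: Legendre_mult)
  qed
qed

definition chi4 :: "nat \<Rightarrow> int" where
  "chi4 n = (if n mod 4 = 1 then 1 else if n mod 4 = 3 then -1 else 0)"

definition chi8 :: "nat \<Rightarrow> int" where
  "chi8 n = (if n mod 8 = 1 \<or> n mod 8 = 7 then 1 else if n mod 8 = 3 \<or> n mod 8 = 5 then -1 else 0)"

lemma less_numeral_cases:
  "(n::nat) < 4 \<Longrightarrow> n \<in> {0, 1, 2, 3}" "(n::nat) < 8 \<Longrightarrow> n \<in> {0, 1, 2, 3, 4, 5, 6, 7}"
  by auto

lemma chi4_mult: "chi4 (m * n) = chi4 m * chi4 n"
proof -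
  have red: "chi4 (n mod 4) = chi4 n" for n by (simp add: chi4_def)
  have "\<forall>a\<in>{0, 1, 2, 3}. \<forall>b\<in>{0, 1, 2, 3}. chi4 (a * b) = chi4 a * chi4 b"
    by code_simp
  moreover have "n mod 4 \<in> {0, 1, 2, 3}" for n :: nat
    by (rule less_numeral_cases) simp
  ultimately have "chi4 ((m mod 4) * (n mod 4)) = chi4 (m mod 4) * chi4 (n mod 4)" by blast
  moreover have "chi4 ((m mod 4) * (n mod 4)) = chi4 (m * n)"
    using red[of "(m mod 4) * (n mod 4)"] red[of "m * n"] by (simp only: mod_mult_eq)
  ultimately show ?thesis by (simp only: red)
qed

lemma chi8_mult: "chi8 (m * n) = chi8 m * chi8 n"
proof -
  have red: "chi8 (n mod 8) = chi8 n" for n by (simp add: chi8_def)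
  have "\<forall>a\<in>{0, 1, 2, 3, 4, 5, 6, 7}. \<forall>b\<in>{0, 1, 2, 3, 4, 5, 6, 7}. chi8 (a * b) = chi8 a * chi8 b"
    by code_simp
  moreover have "n mod 8 \<in> {0, 1, 2, 3, 4, 5, 6, 7}" for n :: nat
    by (rule less_numeral_cases) simp
  ultimately have "chi8 ((m mod 8) * (n mod 8)) = chi8 (m mod 8) * chi8 (n mod 8)" by blast
  moreover have "chi8 ((m mod 8) * (n mod 8)) = chi8 (m * n)"
    using red[of "(m mod 8) * (n mod 8)"] red[of "m * n"] by (simp only: mod_mult_eq)
  ultimately show ?thesis by (simp only: red)
qed

lemma chi4_eq_power: "odd p \<Longrightarrow> chi4 p = (-1) ^ ((p - 1) div 2)"
proof -
  assume "odd p"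
  then have "p mod 4 = 1 \<or> p mod 4 = 3" by presburger
  moreover have "even ((p - 1) div 2) \<longleftrightarrow> p mod 4 = 1" using \<open>odd p\<close> by presburger
  ultimately show ?thesis by (auto simp: chi4_def uminus_power_if)
qed

lemma even_prime_eq_2: "prime p \<Longrightarrow> even p \<Longrightarrow> p = (2::nat)"
  using primes_dvd_imp_eq[OF two_is_prime_nat, of p] by blast

lemma prime_dvd_8:
  fixes p :: nat
  assumes "prime p" "p dvd 8"
  shows "p = 2"
proof -
  have "p dvd 2 ^ 3" using assms(2) by simp
  then have "p dvd 2" using assms(1) prime_dvd_power by blast
  then show ?thesis using assms(1) primes_dvd_imp_eq two_is_prime_nat by blast
qed

lemma residue_character_one: "residue_character 1 (\<lambda>_. 1) 8"
proof -
  have "Legendre 1 (int p) = 1" if "prime p" for p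
  proof -
    have "p \<noteq> 1" using that by auto
    then have "\<not> [1 = 0] (mod int p)" by (simp add: cong_0_iff)
    moreover have "QuadRes (int p) 1" unfolding QuadRes_def by (intro exI[of _ 1]) simp
    ultimately show ?thesis by (simp add: Legendre_def)
  qed
  then show ?thesis using prime_dvd_8 by (auto simp: residue_character_def)
qed

lemma residue_character_minus_one: "residue_character (-1) chi4 8"
proof -
  have "\<forall>p. prime p \<and> p dvd 8 \<longrightarrow> p = 2 \<or> int p dvd - 1"
    using prime_dvd_8 by blast
  moreover have "chi4 p = Legendre (-1) (int p)" if "prime p" "odd p" for p
    using that chi4_eq_power Legendre_minus_one odd_prime_gt_2 by simp
  moreover have "chi4 (n + 8) = chi4 n" for n
  proof -
    have "(n + 8) mod 4 = n mod 4" using mod_mult_self1[of n 2 4] by simp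
    then show ?thesis by (simp add: chi4_def)
  qed
  moreover have "chi4 n \<in> {-1, 0, 1}" for n by (simp add: chi4_def)
  moreover have "chi4 1 = 1" by (simp add: chi4_def)
  ultimately show ?thesis unfolding residue_character_def using chi4_mult by simp
qed

lemma residue_character_two: "residue_character 2 chi8 8"
proof -
  have "p = 2" if "prime p" "p dvd 8" for p :: nat
    using prime_dvd_8 that by blast
  moreover have "chi8 p = Legendre 2 (int p)" if "prime p" "odd p" for p
  proof -
    have "p mod 8 = 1 \<or> p mod 8 = 3 \<or> p mod 8 = 5 \<or> p mod 8 = 7"
    proof -
      have "even (p mod 8) \<longleftrightarrow> even p" by (rule dvd_mod_iff) simp
      then have "odd (p mod 8)" using that(2) by blast
      moreover have "p mod 8 \<in> {0, 1, 2, 3, 4, 5, 6, 7}" by (rule less_numeral_cases) simp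
      ultimately show ?thesis by auto
    qed
   
    then show ?thesis using Legendre_two[of p] that odd_prime_gt_2 by (auto simp: chi8_def)
  qed
  moreover have "chi8 (n + 8) = chi8 n" for n by (simp add: chi8_def)
  moreover have "chi8 n \<in> {-1, 0, 1}" for n by (simp add: chi8_def)
  moreover have "chi8 1 = 1" by (simp add: chi8_def)
  ultimately show ?thesis unfolding residue_character_def using chi8_mult by simp
qed

text \<open>
  Reciprocity turns \<open>(q / p)\<close> into \<open>(p / q)\<close>, up to the sign \<open>chi4 p\<close> when \<open>q\<close> is \<open>3\<close> modulo \<open>4\<close>.
\<close>

definition odd_prime_character :: "nat \<Rightarrow> nat \<Rightarrow> int" where
  "odd_prime_character q n = Legendre (int n) (int q) * (if q mod 4 = 1 then 1 else chi4 n)"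

lemma residue_character_odd_prime:
  assumes q: "prime q" "odd q"
  shows "residue_character (int q) (odd_prime_character q) (8 * q)"
  unfolding residue_character_def
proof (intro conjI allI impI)
  have q2: "q > 2" using q odd_prime_gt_2 by blast
  show "8 * q > 0" "8 dvd 8 * q" using q2 by auto
  show "p = 2 \<or> int p dvd int q" if "prime p \<and> p dvd 8 * q" for p
    using that prime_dvd_8 by (auto simp: prime_dvd_mult_iff)
  show "odd_prime_character q (n * k) = odd_prime_character q n * odd_prime_character q k" for n k
    using Legendre_mult[OF q(1) q2] by (simp add: odd_prime_character_def chi4_mult mult_ac)
  show "odd_prime_character q 1 = 1"
  proof -
    have "\<not> [1 = 0] (mod int q)" using q2 by (simp add: cong_0_iff)
    moreover have "QuadRes (int q) 1" unfolding QuadRes_def by (intro exI[of _ 1]) simp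
    ultimately show ?thesis by (simp add: Legendre_def odd_prime_character_def chi4_def)
  qed
  show "odd_prime_character q n \<in> {-1, 0, 1}" for n
    using Legendre_values[of "int n" "int q"] by (auto simp: odd_prime_character_def chi4_def)
  show "odd_prime_character q (n + 8 * q) = odd_prime_character q n" for n
  proof -
    have "[int (n + 8 * q) = int n] (mod int q)" by (simp add: cong_iff_dvd_diff)
    then have "Legendre (int (n + 8 * q)) (int q) = Legendre (int n) (int q)" by (rule Legendre_cong)
    moreover have "(n + 8 * q) mod 4 = n mod 4" using mod_mult_self1[of n "2 * q" 4] by simp
    then have "chi4 (n + 8 * q) = chi4 n" by (simp add: chi4_def)
    ultimately show ?thesis by (simp add: odd_prime_character_def)
  qed
  show "odd_prime_character q p = Legendre (int q) (int p)" if p: "prime p \<and> odd p \<and> \<not> int p dvd int q" for p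
  proof -
    have p2: "p > 2" "p \<noteq> q" using p odd_prime_gt_2 by auto
    have "\<not> [int q = 0] (mod int p)" using p by (simp add: cong_0_iff)
    then have sq: "Legendre (int q) (int p) * Legendre (int q) (int p) = 1" by (simp add: Legendre_def)
    have qr: "Legendre (int p) (int q) * Legendre (int q) (int p) = (-1) ^ ((p - 1) div 2 * ((q - 1) div 2))"
      using Quadratic_Reciprocity[of p q] p p2 q q2 by blast
    have "Legendre (int p) (int q) = Legendre (int p) (int q) * (Legendre (int q) (int p) * Legendre (int q) (int p))"
      unfolding sq by simp
    also have "\<dots> = (-1) ^ ((p - 1) div 2 * ((q - 1) div 2)) * Legendre (int q) (int p)"
      unfolding mult.assoc[symmetric] qr ..
    also have "(-1::int) ^ ((p - 1) div 2 * ((q - 1) div 2)) = (if q mod 4 = 1 then 1 else chi4 p)"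
    proof (cases "q mod 4 = 1")
      case True
      then have "even ((q - 1) div 2)" by presburger
      then show ?thesis using True by (simp add: uminus_power_if)
    next
      case False
      then have "odd ((q - 1) div 2)" using q(2) by presburger
      then show ?thesis using False p chi4_eq_power[of p] by (simp add: uminus_power_if)
    qed
    finally have L: "Legendre (int p) (int q) = (if q mod 4 = 1 then 1 else chi4 p) * Legendre (int q) (int p)" .
    have "chi4 p * chi4 p = 1" using p chi4_eq_power[of p] by (simp add: power_add[symmetric])
    then show ?thesis unfolding odd_prime_character_def L by simp
  qed
qed

text \<open>
  Multiply the characters of the prime factors and of the sign.
\<close>

lemma residue_character_exists:
  fixes a :: int
  assumes "a \<noteq> 0"
  shows "\<exists>f m. residue_character a f m"
  using assms
proof (induction a rule: prime_divisors_induct)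
  case (unit x)
  then have "x = 1 \<or> x = -1" by (auto simp: zdvd1_eq)
  then show ?case using residue_character_one residue_character_minus_one by blast
next
  case (factor p x)
  then obtain f m where f: "residue_character x f m" by auto
  have "prime (nat p)" using factor(1) prime_int_nat_transfer by blast
  have "p = int (nat p)" using factor(1) prime_ge_0_int[of p] by simp
  have "\<exists>g k. residue_character p g k"
  proof (cases "even (nat p)")
    case True
    then have "nat p = 2" using even_prime_eq_2 \<open>prime (nat p)\<close> by blast
    then have "p = 2" by simp
    then show ?thesis using residue_character_two by blast
  next
    case False
    then show ?thesis using residue_character_odd_prime[OF \<open>prime (nat p)\<close>] \<open>p = int (nat p)\<close> by metis
  qed
  then obtain g k where "residue_character p g k" by blast
  from residue_character_mult[OF this f] show ?case by (intro exI)
qed simp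

lemma prime_three_five: "prime (3::nat)" "prime (5::nat)"
proof -
  have "m = 1 \<or> m = 3" if "m dvd 3" for m :: nat
  proof -
    have "m \<le> 3" using that by (rule dvd_imp_le) simp
    then consider "m = 0" | "m = 1" | "m = 2" | "m = 3" by linarith
    then show ?thesis using that by cases auto
  qed
  then show "prime (3::nat)" by (simp only: prime_nat_iff) simp
  have "m = 1 \<or> m = 5" if "m dvd 5" for m :: nat
  proof -
    have "m \<le> 5" using that by (rule dvd_imp_le) simp
    then consider "m = 0" | "m = 1" | "m = 2" | "m = 3" | "m = 4" | "m = 5" by linarith
    then show ?thesis using that by cases auto
  qed
  then show "prime (5::nat)" by (simp only: prime_nat_iff) simp
qed

text \<open>
  Squaring is not injective on the nonzero residues, as \<open>1\<close> and \<open>q - 1\<close> have the same square, hence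
  not surjective.
\<close>

lemma quadratic_nonresidue_exists:
  fixes q :: nat
  assumes q: "prime q" "q > 2"
  shows "\<exists>x\<in>{1..int q - 1}. \<not> QuadRes (int q) x"
proof (rule ccontr)
  assume "\<not> ?thesis"
  then have all: "QuadRes (int q) x" if "x \<in> {1..int q - 1}" for x using that by blast
  let ?sq = "\<lambda>y. y\<^sup>2 mod int q"
  have "{1..int q - 1} \<subseteq> ?sq ` {1..int q - 1}"
  proof
    fix x assume x: "x \<in> {1..int q - 1}"
    then obtain y where y: "[y\<^sup>2 = x] (mod int q)" using all by (auto simp: QuadRes_def)
    have sq: "?sq (y mod int q) = x" using y x by (simp add: cong_def power_mod)
    moreover have "y mod int q \<noteq> 0" using sq x by auto
    moreover have "0 \<le> y mod int q" "y mod int q < int q" using q by auto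
    ultimately have "y mod int q \<in> {1..int q - 1}" by auto
    with sq show "x \<in> ?sq ` {1..int q - 1}" by force
  qed
  then have inj: "inj_on ?sq {1..int q - 1}"
    by (intro finite_surj_inj) auto
  have "?sq (int q - 1) = ?sq 1"
  proof -
    have "(int q - 1)\<^sup>2 = 1 + int q * (int q - 2)" by (simp add: power2_eq_square algebra_simps)
    then show ?thesis by simp
  qed
  then have "int q - 1 = 1" using inj_onD[OF inj, of "int q - 1" 1] q by simp
  then show False using q by simp
qed

text \<open>
  If an odd prime \<open>q\<close> divides \<open>e = q e'\<close>, choose \<open>n\<close> to be a non-residue modulo \<open>q\<close> and \<open>1\<close> modulo the
  period of a character of \<open>e'\<close>. That period is divisible by \<open>8\<close>, so the factor \<open>chi4 n\<close> is \<open>1\<close> and the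
  sign of the product comes from \<open>(n / q)\<close> alone. Otherwise \<open>e\<close> is \<open>-1\<close>, \<open>2\<close> or \<open>-2\<close>, and the prime \<open>3\<close> or
  \<open>5\<close> is a witness.
\<close>

lemma residue_character_nonprincipal:
  fixes e :: int
  assumes sf: "squarefree e" and e: "e \<noteq> 1"
  shows "\<exists>f m n. residue_character e f m \<and> coprime n m \<and> f n = -1"
proof (cases "\<exists>q. prime q \<and> odd q \<and> int q dvd e")
  case True
  then obtain q where q: "prime q" "odd q" "int q dvd e" by blast
  have q2: "q > 2" using q odd_prime_gt_2 by blast
  obtain e' where e': "e = int q * e'" using q(3) by blast
  have nd: "\<not> int q dvd e'"
  proof
    assume "int q dvd e'"
    then have "int q ^ 2 dvd e" unfolding e' by (simp add: power2_eq_square mult_dvd_mono)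
    then have "is_unit (int q)" using sf squarefreeD by blast
    then show False using q2 by simp
  qed
  have "e' \<noteq> 0" using sf e' by auto
  then obtain f m where f: "residue_character e' f m" using residue_character_exists by blast
  have "\<not> q dvd m"
    using f q nd q2 unfolding residue_character_def by (metis less_irrefl)
  then have cop: "coprime q m" using q(1) by (simp add: prime_imp_coprime)
  obtain r where r: "Legendre (int r) (int q) = -1"
  proof -
    obtain x where x: "x \<in> {1..int q - 1}" "\<not> QuadRes (int q) x"
      using quadratic_nonresidue_exists[OF q(1) q2] by blast
    then have "Legendre (int (nat x)) (int q) = -1" by (auto simp: Legendre_def cong_0_iff dest: zdvd_imp_le)
    then show ?thesis using that by blast
  qed
  obtain n where n: "[n = r] (mod q)" "[n = 1] (mod m)"
    using binary_chinese_remainder_nat[OF cop] by blast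
  have fq: "residue_character (int q) (odd_prime_character q) (8 * q)"
    by (rule residue_character_odd_prime[OF q(1,2)])
  have rc: "residue_character e (\<lambda>n. odd_prime_character q n * f n) (8 * q * m)"
    unfolding e' by (rule residue_character_mult[OF fq f])
  have "f n = 1" using residue_character_cong[OF f n(2)] f by (simp add: residue_character_def)
  have "8 dvd m" using f by (simp add: residue_character_def)
  have n8: "[n = 1] (mod 8)" by (rule cong_dvd_modulus_nat[OF n(2) \<open>8 dvd m\<close>])
  then have "n mod 4 = 1" unfolding cong_def using mod_mod_cancel[of 4 8 n] by simp
  then have "chi4 n = 1" by (simp add: chi4_def)
  moreover have "Legendre (int n) (int q) = -1"
    using Legendre_cong[of "int n" "int r" "int q"] n(1) r by (simp add: cong_int_iff)
  ultimately have "odd_prime_character q n * f n = -1"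
    using \<open>f n = 1\<close> by (simp add: odd_prime_character_def)
  moreover have "coprime n (8 * q * m)"
  proof -
    have "coprime n m" by (rule cong_imp_coprime[OF cong_sym[OF n(2)]]) simp
    moreover have "coprime n 8" by (rule cong_imp_coprime[OF cong_sym[OF n8]]) simp
    moreover have "coprime n q"
    proof -
      have "\<not> [int r = 0] (mod int q)" using r by (auto simp: Legendre_def)
      then have "\<not> q dvd r" by (simp add: cong_0_iff)
      then have "\<not> q dvd n" using n(1) cong_dvd_iff by blast
      then have "coprime q n" using q(1) by (simp add: prime_imp_coprime)
      then show ?thesis by (simp add: coprime_commute)
    qed
    ultimately show ?thesis by simp
  qed
  ultimately show ?thesis using rc by blast
next
  case False
  have dvd2: "p = 2" if "prime p" "p dvd e" for p
  proof -
    have "prime (nat p)" using that(1) prime_int_nat_transfer by blast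
    have "p = int (nat p)" using prime_ge_0_int[OF that(1)] by simp
    then have "even (nat p)" using False that(2) \<open>prime (nat p)\<close> by metis
    then have "nat p = 2" using even_prime_eq_2 \<open>prime (nat p)\<close> by blast
    then show ?thesis by simp
  qed
  have "e \<in> {-1, 2, -2}"
  proof (cases "even e")
    case True
    then obtain e' where e': "e = 2 * e'" by blast
    have "is_unit e'"
    proof (rule ccontr)
      assume "\<not> is_unit e'"
      then obtain p where p: "prime p" "p dvd e'" by (metis prime_divisorE sf e' mult_zero_right not_squarefree_0)
      then have "p = 2" using dvd2[of p] e' by simp
      then have "2 * 2 dvd 2 * e'" using p(2) by (intro mult_dvd_mono) auto
      then have "2 ^ 2 dvd e" unfolding e' power2_eq_square .
      then have "is_unit (2::int)" using sf squarefreeD by blast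
      then show False by simp
    qed
    then show ?thesis using e' by (auto simp: zdvd1_eq)
  next
    case odd: False
    have "is_unit e"
    proof (rule ccontr)
      assume "\<not> is_unit e"
      then obtain p where p: "prime p" "p dvd e" by (metis prime_divisorE sf not_squarefree_0)
      then show False using dvd2[of p] odd by simp
    qed
    then show ?thesis using e by (auto simp: zdvd1_eq)
  qed
  have q3: "y\<^sup>2 mod 3 \<noteq> 2" for y :: int
  proof -
    have "y mod 3 = 0 \<or> y mod 3 = 1 \<or> y mod 3 = 2" by presburger
    then show ?thesis using power_mod[of y 3 2, symmetric] by (elim disjE) simp_all
  qed
  have q5: "y\<^sup>2 mod 5 \<noteq> 3" for y :: int
  proof -
    have "y mod 5 = 0 \<or> y mod 5 = 1 \<or> y mod 5 = 2 \<or> y mod 5 = 3 \<or> y mod 5 = 4" by presburger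
    then show ?thesis using power_mod[of y 5 2, symmetric] by (elim disjE) simp_all
  qed
  obtain p :: nat where p: "prime p" "odd p" "\<not> int p dvd e" "Legendre e (int p) = -1"
  proof -
    have "Legendre (-1) 3 = -1" "Legendre 2 3 = -1" "Legendre (-2) 5 = -1"
      using q3 q5 by (auto simp: Legendre_def QuadRes_def cong_def)
    then show ?thesis
      using \<open>e \<in> {-1, 2, -2}\<close> that[of 3] that[of 5] prime_three_five by auto
  qed
  obtain f m where f: "residue_character e f m"
    using residue_character_exists[of e] sf by (metis not_squarefree_0)
  have "f p = -1" using f p unfolding residue_character_def by metis
  moreover have "\<not> p dvd m" using f p unfolding residue_character_def by (metis dvd_refl)
  then have "coprime p m" using p(1) by (simp add: prime_imp_coprime)
  ultimately show ?thesis using f by blast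
qed

text \<open>
  Multiplication by \<open>n0\<close> permutes the residues and changes the sign of the sum.
\<close>

lemma residue_character_period_sum:
  assumes f: "residue_character e f m" and n0: "coprime n0 m" "f n0 = -1"
  shows "(\<Sum>k<m. f k) = 0"
proof -
  have m: "m > 0" using f by (simp add: residue_character_def)
  have inj: "inj_on (\<lambda>k. n0 * k mod m) {..<m}"
  proof (rule inj_onI)
    fix x y assume xy: "x \<in> {..<m}" "y \<in> {..<m}" "n0 * x mod m = n0 * y mod m"
    then have "[n0 * x = n0 * y] (mod m)" by (simp add: cong_def)
    then have "[x = y] (mod m)" using n0(1) by (simp add: cong_mult_lcancel_nat)
    then show "x = y" using xy by (simp add: cong_def)
  qed
  have "(\<lambda>k. n0 * k mod m) ` {..<m} = {..<m}"
    by (rule endo_inj_surj[OF _ _ inj]) (use m in auto)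
  then have "(\<Sum>k<m. f k) = (\<Sum>k<m. f (n0 * k mod m))"
    using sum.reindex[OF inj, of f] by simp
  also have "\<dots> = (\<Sum>k<m. f n0 * f k)"
  proof (intro sum.cong refl)
    fix k
    have "f (n0 * k mod m) = f (n0 * k)" by (rule residue_character_cong[OF f]) (simp add: cong_def)
    then show "f (n0 * k mod m) = f n0 * f k" using f by (simp add: residue_character_def)
  qed
  also have "\<dots> = - (\<Sum>k<m. f k)" using n0(2) by (simp add: sum_negf)
  finally show ?thesis by simp
qed

lemma residue_character_bounded_sums:
  assumes f: "residue_character e f m" and n0: "coprime n0 m" "f n0 = -1"
  shows "\<bar>\<Sum>k=1..n. real_of_int (f k)\<bar> \<le> real m"
proof (induction n rule: less_induct)
  case (less n)
  have m: "m > 0" using f by (simp add: residue_character_def)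
  have ab: "\<bar>real_of_int (f k)\<bar> \<le> 1" for k
  proof -
    have "f k \<in> {-1, 0, 1}" using f unfolding residue_character_def by blast
    then show ?thesis by auto
  qed
  show ?case
  proof (cases "n \<le> m")
    case True
    have "\<bar>\<Sum>k=1..n. real_of_int (f k)\<bar> \<le> (\<Sum>k=1..n. \<bar>real_of_int (f k)\<bar>)" by (rule sum_abs)
    also have "\<dots> \<le> (\<Sum>k=1..n. 1)" by (intro sum_mono ab)
    also have "\<dots> \<le> real m" using True by simp
    finally show ?thesis .
  next
    case False
    then obtain l where l: "n = l + m" by (metis add.commute le_add_diff_inverse nat_le_linear)
    have per: "f (k + m) = f k" for k using f unfolding residue_character_def by blast
    have "(\<Sum>k=1..m. f k) = (\<Sum>k<m. f (Suc k))"
      by (rule sum.reindex_bij_witness[of _ Suc "\<lambda>k. k - 1"]) auto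
    also have "\<dots> = (\<Sum>k<m. f k) - f 0 + f m"
      by (induction m) auto
    also have "\<dots> = 0" using residue_character_period_sum[OF f n0] per[of 0] by simp
    finally have z: "(\<Sum>k=1..m. f k) = 0" .
    have "(\<Sum>k=1..n. f k) = (\<Sum>k=1..m. f k) + (\<Sum>k=Suc m..m + l. f k)"
      unfolding l using sum.ub_add_nat[of 1 m f l] by (simp add: add.commute)
    also have "(\<Sum>k=Suc m..m + l. f k) = (\<Sum>k=1..l. f (k + m))"
      using sum.shift_bounds_cl_nat_ivl[of f 1 m l] by (simp add: add.commute)
    finally have "(\<Sum>k=1..n. f k) = (\<Sum>k=1..l. f k)" using z by (simp add: per)
    then have "(\<Sum>k=1..n. real_of_int (f k)) = (\<Sum>k=1..l. real_of_int (f k))"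
      by (simp flip: of_int_sum)
    then show ?thesis using less.IH[of l] l m by simp
  qed
qed

text \<open>
  The character depends only on the squarefree part of \<open>d\<close>, which differs from \<open>1\<close> because \<open>d\<close> is not
  a square.
\<close>

theorem quadratic_character_exists:
  fixes d :: int
  assumes d: "\<nexists>k. d = k\<^sup>2"
  shows "\<exists>chi C. quadratic_character chi C \<and>
     (\<forall>p. prime p \<and> odd p \<and> \<not> int p dvd d \<longrightarrow> chi p = real_of_int (Legendre d (int p)))"
proof -
  define e where "e = squarefree_part d"
  define k where "k = square_part d"
  have dk: "d = e * k\<^sup>2" unfolding e_def k_def by (rule squarefree_decompose)
  have "e \<noteq> 1" using d dk by auto
  then obtain f m n0 where f: "residue_character e f m" and n0: "coprime n0 m" "f n0 = -1"
    using residue_character_nonprincipal[of e] squarefree_squarefree_part[of d] unfolding e_def by blast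
  have "quadratic_character (\<lambda>n. real_of_int (f n)) (real m)"
  proof
    show "real_of_int (f (a * b)) = real_of_int (f a) * real_of_int (f b)" for a b
      using f by (simp add: residue_character_def)
    show "real_of_int (f 1) = 1" using f by (simp add: residue_character_def)
    fix n
    have "f n \<in> {-1, 0, 1}" using f unfolding residue_character_def by blast
    then show "\<bar>real_of_int (f n)\<bar> \<le> 1" "real_of_int (f n) \<in> {-1, 0, 1}" by auto
    show "\<bar>\<Sum>k=1..n. real_of_int (f k)\<bar> \<le> real m"
      by (rule residue_character_bounded_sums[OF f n0])
  qed
  moreover have "real_of_int (f p) = real_of_int (Legendre d (int p))"
    if p: "prime p \<and> odd p \<and> \<not> int p dvd d" for p
  proof -
    have p2: "p > 2" using p odd_prime_gt_2 by blast
    have nd: "\<not> int p dvd e" "\<not> int p dvd k" using p dk by (auto simp: power2_eq_square)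
    have "\<not> [k = 0] (mod int p)" using nd by (simp add: cong_0_iff)
    then have "Legendre k (int p) * Legendre k (int p) = 1" by (simp add: Legendre_def)
    then have "Legendre d (int p) = Legendre e (int p)"
      using p p2 unfolding dk power2_eq_square by (simp add: Legendre_mult)
    then show ?thesis using f p nd by (simp add: residue_character_def)
  qed
  ultimately show ?thesis by blast
qed

section \<open>The sequence modulo a prime\<close>

text \<open>
  Any fraction with denominator prime to \<open>p\<close> is admitted, reduced or not, which makes closure
  under ring operations immediate.
\<close>

definition p_integral :: "nat \<Rightarrow> rat \<Rightarrow> bool" where
  "p_integral p r \<longleftrightarrow> (\<exists>a b :: int. \<not> int p dvd b \<and> r = of_int a / of_int b)"

lemma quotient_of_cross:
  fixes a b :: int
  assumes "b \<noteq> 0" "r = of_int a / of_int b"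
  shows "fst (quotient_of r) * b = a * snd (quotient_of r)" "snd (quotient_of r) dvd b"
proof -
  obtain n m where nm: "quotient_of r = (n, m)" by fastforce
  have m: "m > 0" "coprime n m" "r = of_int n / of_int m"
    using nm quotient_of_denom_pos quotient_of_coprime quotient_of_div by auto
  have "(of_int n :: rat) * of_int b = of_int a * of_int m"
    using assms m by (simp add: field_simps)
  then have eq: "n * b = a * m" by (simp flip: of_int_mult)
  show "fst (quotient_of r) * b = a * snd (quotient_of r)" using eq nm by simp
  have "m dvd n * b" unfolding eq by simp
  then have "m dvd b" using m(2) by (simp add: coprime_commute coprime_dvd_mult_right_iff)
  then show "snd (quotient_of r) dvd b" using nm by simp
qed

lemma quotient_of_parts: "r = of_int (fst (quotient_of r)) / of_int (snd (quotient_of r))"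
  by (metis prod.collapse quotient_of_div)

lemma p_integral_iff:
  assumes "prime p"
  shows "p_integral p r \<longleftrightarrow> coprime (int p) (snd (quotient_of r))"
proof
  assume "p_integral p r"
  then obtain a b where ab: "\<not> int p dvd b" "r = of_int a / of_int b" unfolding p_integral_def by blast
  then have "b \<noteq> 0" by auto
  then have "snd (quotient_of r) dvd b" using quotient_of_cross(2) ab(2) by blast
  then have "\<not> int p dvd snd (quotient_of r)" using ab(1) dvd_trans by blast
  then show "coprime (int p) (snd (quotient_of r))" using assms by (simp add: prime_imp_coprime)
next
  assume "coprime (int p) (snd (quotient_of r))"
  then have "\<not> int p dvd snd (quotient_of r)"
    using assms by (metis coprime_absorb_left not_prime_unit prime_nat_int_transfer)
  then show "p_integral p r" unfolding p_integral_def using quotient_of_parts by blast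
qed

lemma zero_mod_iff:
  assumes "prime p"
  shows "zero_mod p r \<longleftrightarrow> (\<exists>a b :: int. \<not> int p dvd b \<and> int p dvd a \<and> r = of_int a / of_int b)"
proof
  assume r: "zero_mod p r"
  then have "\<not> int p dvd snd (quotient_of r)"
    using assms unfolding zero_mod_def by (metis coprime_absorb_left not_prime_unit prime_nat_int_transfer)
  then show "\<exists>a b :: int. \<not> int p dvd b \<and> int p dvd a \<and> r = of_int a / of_int b"
    using r quotient_of_parts unfolding zero_mod_def by blast
next
  assume "\<exists>a b :: int. \<not> int p dvd b \<and> int p dvd a \<and> r = of_int a / of_int b"
  then obtain a b where ab: "\<not> int p dvd b" "int p dvd a" "r = of_int a / of_int b" by blast
  then have "b \<noteq> 0" by auto
  have "p_integral p r" using ab unfolding p_integral_def by blast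
  then have "coprime (int p) (snd (quotient_of r))" using p_integral_iff[OF assms] by blast
  moreover have "int p dvd fst (quotient_of r) * b"
    unfolding quotient_of_cross(1)[OF \<open>b \<noteq> 0\<close> ab(3)] using ab(2) by simp
  then have "int p dvd fst (quotient_of r)" using assms ab(1) by (simp add: prime_dvd_mult_iff)
  ultimately show "zero_mod p r" unfolding zero_mod_def by blast
qed

context
  fixes p :: nat
  assumes p: "prime p"
begin

lemma not_dvd_mult: "\<not> int p dvd b \<Longrightarrow> \<not> int p dvd b' \<Longrightarrow> \<not> int p dvd b * b'"
  using p by (simp add: prime_dvd_mult_iff)

lemma p_integral_of_int: "p_integral p (of_int k)"
  unfolding p_integral_def using p by (intro exI[of _ k] exI[of _ 1]) (auto dest: zdvd_imp_le simp: prime_gt_1_nat)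

lemma p_integral_mult: "p_integral p r \<Longrightarrow> p_integral p s \<Longrightarrow> p_integral p (r * s)"
proof -
  assume "p_integral p r" "p_integral p s"
  then obtain a b a' b' where "\<not> int p dvd b" "r = of_int a / of_int b" "\<not> int p dvd b'" "s = of_int a' / of_int b'"
    unfolding p_integral_def by blast
  then show ?thesis unfolding p_integral_def
    by (intro exI[of _ "a * a'"] exI[of _ "b * b'"]) (auto simp: not_dvd_mult)
qed

lemma p_integral_diff: "p_integral p r \<Longrightarrow> p_integral p s \<Longrightarrow> p_integral p (r - s)"
proof -
  assume "p_integral p r" "p_integral p s"
  then obtain a b a' b' where ab: "\<not> int p dvd b" "r = of_int a / of_int b" "\<not> int p dvd b'" "s = of_int a' / of_int b'"
    unfolding p_integral_def by blast
  then have "b \<noteq> 0" "b' \<noteq> 0" by auto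
  then have "r - s = of_int (a * b' - a' * b) / of_int (b * b')" by (simp add: ab field_simps)
  then show ?thesis unfolding p_integral_def using ab(1,3) not_dvd_mult by blast
qed

lemma p_integral_add: "p_integral p r \<Longrightarrow> p_integral p s \<Longrightarrow> p_integral p (r + s)"
  using p_integral_diff[of r "0 - s"] p_integral_diff[of 0 s] p_integral_of_int[of 0] by simp

lemma zero_mod_mult: "zero_mod p r \<Longrightarrow> p_integral p s \<Longrightarrow> zero_mod p (r * s)"
proof -
  assume "zero_mod p r" "p_integral p s"
  then obtain a b a' b' where "\<not> int p dvd b" "int p dvd a" "r = of_int a / of_int b" "\<not> int p dvd b'" "s = of_int a' / of_int b'"
    unfolding p_integral_def zero_mod_iff[OF p] by blast
  then show ?thesis unfolding zero_mod_iff[OF p]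
    by (intro exI[of _ "a * a'"] exI[of _ "b * b'"]) (auto simp: not_dvd_mult)
qed

lemma zero_mod_add: "zero_mod p r \<Longrightarrow> zero_mod p s \<Longrightarrow> zero_mod p (r + s)"
proof -
  assume "zero_mod p r" "zero_mod p s"
  then obtain a b a' b' where ab: "\<not> int p dvd b" "int p dvd a" "r = of_int a / of_int b"
     "\<not> int p dvd b'" "int p dvd a'" "s = of_int a' / of_int b'"
    unfolding zero_mod_iff[OF p] by blast
  then have "b \<noteq> 0" "b' \<noteq> 0" by auto
  then have "r + s = of_int (a * b' + a' * b) / of_int (b * b')" by (simp add: ab field_simps)
  moreover have "int p dvd a * b' + a' * b" using ab by simp
  ultimately show ?thesis unfolding zero_mod_iff[OF p] using ab(1,4) not_dvd_mult by blast
qed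

lemma integer_residue_exists:
  assumes "p_integral p r"
  shows "\<exists>m :: int. zero_mod p (r - of_int m)"
proof -
  obtain a b where ab: "\<not> int p dvd b" "r = of_int a / of_int b"
    using assms unfolding p_integral_def by blast
  have "coprime (int p) b" using ab(1) p by (simp add: prime_imp_coprime)
  then have "coprime b (int p)" by (simp add: coprime_commute)
  then obtain c where c: "[b * c = 1] (mod int p)" using cong_solve_coprime_int by blast
  have "b \<noteq> 0" using ab(1) by auto
  then have "r - of_int (a * c) = of_int (a * (1 - b * c)) / of_int b"
    by (simp add: ab(2) field_simps)
  moreover have "int p dvd a * (1 - b * c)"
    using c by (metis cong_iff_dvd_diff cong_sym dvd_mult)
  ultimately show ?thesis unfolding zero_mod_iff[OF p] using ab(1) by blast
qed

end

text \<open>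
  The determinant is invariant because shifting the sequence is multiplication by \<open>D_mat t\<close>, whose
  determinant is \<open>1\<close>. The recurrence gives the same by direct computation.
\<close>

lemma seq_term_norm_invariant:
  "(seq_term t X (n + 1))\<^sup>2 - t * seq_term t X n * seq_term t X (n + 1) + (seq_term t X n)\<^sup>2
     = (X $ 2 $ 2)\<^sup>2 - t * (X $ 2 $ 1) * (X $ 2 $ 2) + (X $ 2 $ 1)\<^sup>2" (is "?q n = ?D")
proof -
  have step: "?q n = ?q (n - 1)" for n
  proof -
    have "w\<^sup>2 - t * v * w + v\<^sup>2 = v\<^sup>2 - t * u * v + u\<^sup>2" if "w = t * v - u" for u v w :: rat
      unfolding that by (simp add: power2_eq_square algebra_simps)
    from this[OF seq_term_rec[of t X n]] show ?thesis by simp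
  qed
  show ?thesis
  proof (induction n rule: int_induct[of _ 0])
    case base
    have "seq_term t X 0 = X $ 2 $ 1" "seq_term t X 1 = X $ 2 $ 2" by (simp_all add: seq_term_def)
    then show ?case by simp
  next
    case (step1 n)
    then show ?case using step[of "n + 1"] by simp
  next
    case (step2 n)
    then show ?case using step[of n] by simp
  qed
qed

lemma p_integral_seq_term:
  fixes X :: "rat^2^2"
  assumes p: "prime p" and t: "p_integral p t"
    and X: "p_integral p (X $ 2 $ 1)" "p_integral p (X $ 2 $ 2)"
  shows "p_integral p (seq_term t X n)"
proof -
  have "p_integral p (seq_term t X n) \<and> p_integral p (seq_term t X (n + 1))"
  proof (induction n rule: int_induct[of _ 0])
    case base
    show ?case using X by (simp add: seq_term_def)
  next
    case (step1 n)
    have "seq_term t X (n + 1 + 1) = t * seq_term t X (n + 1) - seq_term t X n"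
      using seq_term_rec[of t X "n + 1"] by simp
    then show ?case using step1 p_integral_diff[OF p] p_integral_mult[OF p] t by simp
  next
    case (step2 n)
    have "seq_term t X (n - 1) = t * seq_term t X n - seq_term t X (n + 1)"
      using seq_term_rec[of t X n] by simp
    then show ?case using step2 p_integral_diff[OF p] p_integral_mult[OF p] t by simp
  qed
  then show ?thesis by blast
qed

text \<open>
  If \<open>x\<close> is the vanishing term and \<open>y\<close> the next one, the determinant is \<open>y\<^sup>2 + x (x - t y)\<close>, and \<open>y\<close> may
  be replaced by an integer \<open>m\<close> in its residue class.
\<close>

lemma Gamma_primes_det_square:
  assumes X: "X \<in> R_ring t" "det X \<noteq> 0" and p: "p \<in> Gamma_primes t X"
  shows "p \<in> Pi_primes t" "square_mod p (det (reduced_rep t X))"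
proof -
  define Y where "Y = reduced_rep t X"
  show Pi: "p \<in> Pi_primes t" using p by (simp add: Gamma_primes_def)
  have pr: "prime p" and t: "\<not> prime_in_rat p t" using Pi by (auto simp: Pi_primes_def)
  obtain n where n: "zero_mod p (seq_term t Y n)" using p by (auto simp: Gamma_primes_def Y_def)
  have "\<not> int p dvd snd (quotient_of t)" using t by (simp add: prime_in_rat_def)
  then have tint: "p_integral p t"
    using pr by (simp add: p_integral_iff[OF pr] prime_imp_coprime)
  have "is_reduced_rep t X Y" unfolding Y_def by (rule is_reduced_rep_reduced_rep[OF X])
  then obtain a b :: int where Y: "Y = bracket t (of_int a) (of_int b)" unfolding is_reduced_rep_def by blast
  have Yc: "Y $ 2 $ 1 = of_int a" "Y $ 2 $ 2 = of_int b" by (simp_all add: Y bracket_def)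
  define x y where "x = seq_term t Y n" and "y = seq_term t Y (n + 1)"
  have int: "p_integral p x" "p_integral p y"
    unfolding x_def y_def using p_integral_seq_term[OF pr tint] Yc p_integral_of_int[OF pr] by auto
  have "det Y = (of_int b)\<^sup>2 - t * of_int a * of_int b + (of_int a)\<^sup>2" unfolding Y by (rule det_bracket)
  then have det: "det Y = y\<^sup>2 - t * x * y + x\<^sup>2"
    using seq_term_norm_invariant[of t Y n] by (simp add: Yc x_def y_def)
  obtain m :: int where m: "zero_mod p (y - of_int m)" using integer_residue_exists[OF pr int(2)] by blast
  have "det Y - (of_int m)\<^sup>2 = (y - of_int m) * (y + of_int m) + x * (x - t * y)"
    unfolding det by (simp add: power2_eq_square algebra_simps)
  moreover have "zero_mod p \<dots>"
    using m n int tint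
    by (intro zero_mod_add[OF pr] zero_mod_mult[OF pr] p_integral_add[OF pr] p_integral_diff[OF pr]
        p_integral_mult[OF pr] p_integral_of_int[OF pr]) (simp_all add: x_def)
  ultimately have z: "zero_mod p (det Y - (of_int m)\<^sup>2)" by simp
  have "p_integral p (det Y)" unfolding det
    using int tint by (simp add: power2_eq_square p_integral_add[OF pr] p_integral_diff[OF pr] p_integral_mult[OF pr])
  then show "square_mod p (det (reduced_rep t X))"
    using z unfolding square_mod_def Y_def[symmetric] p_integral_iff[OF pr] by blast
qed

lemma det_reduced_rep:
  assumes "X \<in> R_ring t" "det X \<noteq> 0"
  shows "\<exists>c. det X = c\<^sup>2 * det (reduced_rep t X)"
proof -
  obtain c where "X = map_matrix ((*) c) (reduced_rep t X)"
    using is_reduced_rep_reduced_rep[OF assms] unfolding is_reduced_rep_def by blast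
  then have "det X = det (map_matrix ((*) c) (reduced_rep t X))" by simp
  also have "\<dots> = c\<^sup>2 * det (reduced_rep t X)"
    by (simp add: det_2 power2_eq_square algebra_simps)
  finally show ?thesis by blast
qed

text \<open>
  Clearing the denominator by its square turns \<open>n / m\<close> into the integer \<open>n m\<close>.
\<close>

lemma square_mod_imp_Legendre:
  assumes p: "prime p" and sq: "square_mod p r"
    and nd: "\<not> int p dvd fst (quotient_of r) * snd (quotient_of r)"
  shows "Legendre (fst (quotient_of r) * snd (quotient_of r)) (int p) = 1"
proof -
  define n m where "n = fst (quotient_of r)" and "m = snd (quotient_of r)"
  have r: "r = of_int n / of_int m" unfolding n_def m_def by (rule quotient_of_parts)
  have m: "m \<noteq> 0" using nd by (auto simp: m_def)
  obtain s :: int where "zero_mod p (r - (of_int s)\<^sup>2)" using sq by (auto simp: square_mod_def)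
  then obtain a b where ab: "\<not> int p dvd b" "int p dvd a" "r - (of_int s)\<^sup>2 = of_int a / of_int b"
    unfolding zero_mod_iff[OF p] by blast
  have "b \<noteq> 0" using ab(1) by auto
  then have "(of_int (n - s\<^sup>2 * m) * of_int b :: rat) = of_int a * of_int m"
    using ab(3) m by (simp add: r field_simps)
  then have "(n - s\<^sup>2 * m) * b = a * m" by (simp only: of_int_mult[symmetric] of_int_eq_iff)
  then have "int p dvd (n - s\<^sup>2 * m) * b" using ab(2) by simp
  then have "int p dvd n - s\<^sup>2 * m" using p ab(1) by (simp add: prime_dvd_mult_iff)
  then have "int p dvd (n - s\<^sup>2 * m) * m" by simp
  then have "[n * m = (s * m)\<^sup>2] (mod int p)"
    by (simp add: cong_iff_dvd_diff power2_eq_square algebra_simps)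
  then have "QuadRes (int p) (n * m)" unfolding QuadRes_def using cong_sym by blast
  then show ?thesis using nd unfolding Legendre_def by (simp add: cong_0_iff n_def m_def)
qed

theorem theorem31:
  fixes t :: rat and X :: "rat^2^2"
  assumes "t \<noteq> 0" "t \<noteq> 1" "t \<noteq> -1" "t \<noteq> 2" "t \<noteq> -2"
    and "X \<in> R_ring t"
    and "det X \<noteq> 0"
  shows "Gamma_primes t X \<subseteq> {p \<in> Pi_primes t. square_mod p (det (reduced_rep t X))} \<and>
    ((\<nexists>q :: rat. det X = q^2) \<longrightarrow> upper_prime_density (Gamma_primes t X) \<le> 1 / 2)"
proof (intro conjI impI)
  show "Gamma_primes t X \<subseteq> {p \<in> Pi_primes t. square_mod p (det (reduced_rep t X))}"
    using Gamma_primes_det_square[OF assms(6,7)] by blast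
  assume nonsq: "\<nexists>q :: rat. det X = q^2"
  define r where "r = det (reduced_rep t X)"
  define n m where "n = fst (quotient_of r)" and "m = snd (quotient_of r)"
  have r: "r = of_int n / of_int m" unfolding n_def m_def by (rule quotient_of_parts)
  have m: "m \<noteq> 0" unfolding m_def using quotient_of_denom_pos[of r] by (metis less_irrefl prod.collapse)
  obtain c where c: "det X = c\<^sup>2 * r" using det_reduced_rep[OF assms(6,7)] unfolding r_def by blast
  have d: "\<nexists>k. n * m = k\<^sup>2"
  proof
    assume "\<exists>k. n * m = k\<^sup>2"
    then obtain k where k: "n * m = k\<^sup>2" by blast
    have "r = of_int (n * m) / (of_int m)\<^sup>2" unfolding r using m by (simp add: power2_eq_square)
    then have "det X = (c * of_int k / of_int m)\<^sup>2"
      unfolding c k by (simp add: power_mult_distrib power_divide)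
    then show False using nonsq by blast
  qed
  then have nz: "n * m \<noteq> 0" by (metis power_zero_numeral)
  obtain chi C where chi: "quadratic_character chi C"
    "\<And>p. prime p \<Longrightarrow> odd p \<Longrightarrow> \<not> int p dvd n * m \<Longrightarrow> chi p = real_of_int (Legendre (n * m) (int p))"
    using quadratic_character_exists[OF d] by blast
  interpret quadratic_character chi C by fact
  show "upper_prime_density (Gamma_primes t X) \<le> 1 / 2"
  proof (rule upper_density_le_half)
    show "finite {p :: nat. int p dvd n * m}"
    proof (rule finite_subset)
      show "{p :: nat. int p dvd n * m} \<subseteq> {..nat \<bar>n * m\<bar>}"
      proof
        fix p :: nat assume "p \<in> {p. int p dvd n * m}"
        then have "\<bar>int p\<bar> \<le> \<bar>n * m\<bar>" using dvd_imp_le_int[OF nz, of "int p"] by simp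
        then show "p \<in> {..nat \<bar>n * m\<bar>}" by simp
      qed
    qed simp
    fix p :: nat assume p: "prime p" "p \<in> Gamma_primes t X" "p \<notin> {p. int p dvd n * m}"
    have "p \<in> Pi_primes t" "square_mod p r"
      unfolding r_def using Gamma_primes_det_square[OF assms(6,7) p(2)] by auto
    then have "odd p" by (simp add: Pi_primes_def)
    have "Legendre (n * m) (int p) = 1"
      using square_mod_imp_Legendre[OF p(1) \<open>square_mod p r\<close>] p(3) unfolding n_def m_def by simp
    then show "chi p = 1" using chi(2)[OF p(1) \<open>odd p\<close>] p(3) by simp
  qed
qed

end
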